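(* Let $G$ be a finite group. Let $\mathscr{H}_G=\{H\mid H=\operatorname{Ker}\rho \text{ for some } \rho\in\operatorname{Irr}(G)\}$, let $\underline{\mathscr{H}_G}=\mathscr{H}_G\cup\{\emptyset\}$, partially ordered by inclusion, and let $\mu\colon \underline{\mathscr{H}_G}\times\underline{\mathscr{H}_G}\to\mathbb{Z}$ be the Möbius function of the finite partially ordered set $\underline{\mathscr{H}_G}$. Then for any Galois cover $Y/X$ of finite connected graphs with $\operatorname{Gal}(Y/X)=G$, we have $$\kappa(Y)=\frac{1}{|G|}\prod_{H\in\mathscr{H}_G}\bigl([G:H]\cdot\kappa(X_H)\bigr)^{-\mu(\emptyset,H)},$$ where $X_H$ denotes the intermediate graph of $Y/X$ corresponding to $H$.
   Context: Graphs (in the sense of Serre): a graph $X=(V_X,E_X,o,t,\iota)$ consists of sets $V_X$ (vertices), $E_X$ (oriented edges) and maps $o,t\colon E_X\to V_X$, $\iota\colon E_X\to E_X$ with $\iota(\iota(e))=e$, $\iota(e)\neq e$, $o(\iota(e))=t(e)$, $t(\iota(e))=o(e)$ for all $e\in E_X$. Write $\bar e=\iota(e)$. Loops and multiple edges are allowed; each pair $\{e,\bar e\}$ is one undirected edge. The complexity $\kappa(X)$ of a finite connected graph $X$ is its number of spanning trees. A morphism $f\colon Y\to X$ is a pair of maps $V_Y\to V_X$, $E_Y\to E_X$ (both written $f$) commuting with $o$, $t$, $\iota$; it is an isomorphism if both maps are bijective. A covering map (cover) $\pi\colon Y\to X$ is a morphism that is surjective on vertices and such that for each $w\in V_Y$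 it restricts to a bijection $\{e\in E_Y\mid o(e)=w\}\to\{e\in E_X\mid o(e)=\pi(w)\}$. $\operatorname{Aut}(Y/X)$ is the group of isomorphisms $\sigma\colon Y\to Y$ with $\pi\circ\sigma=\pi$. A cover $\pi\colon Y\to X$ is a Galois cover if $Y$ is connected and $\operatorname{Aut}(Y/X)$ acts transitively on each fiber $\pi^{-1}(v)$, $v\in V_X$; then one writes $\operatorname{Gal}(Y/X)=\operatorname{Aut}(Y/X)$. For a subgroup $H\le\operatorname{Gal}(Y/X)$, the intermediate graph $X_H$ corresponding to $H$ (under the Galois correspondence between subgroups and equivalence classes of intermediate covers $Y\to X_H\to X$) is the quotient graph of $Y$ by $H$; so $X_{\{1\}}=Y$ and $X_G=X$. $\operatorname{Irr}(G)$ is the set of isomorphism classes of irreducible (complex) representations of $G$. The Möbius function of a finite partially ordered set $\mathscr{L}$ is the function $\mu\colon\mathscr{L}\times\mathscr{L}\to\mathbb{Z}$ with $\mu(x,x)=1$, $\mu(x,y)=-\sum_{z\in\mathscr{L},\,x\le z<y}\mu(x,z)$ if $x<y$, and $\mu(x,y)=0$ otherwise. *)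

theory Defs
  imports
    "HOL-Algebra.Bij"
    "HOL-Algebra.Coset"
    "HOL-Algebra.Group_Action"
    "Graph_Theory.Bidirected_Digraph"
    "Graph_Theory.Digraph_Component"
    "Jordan_Normal_Form.VS_Connect"
begin

section \<open>Graphs in the sense of Serre and their spanning trees\<close>

text \<open>
  A Serre graph is a pair of a digraph \<open>X\<close> and a fixed-point-free edge reversal \<open>r\<close> with
  \<open>bidirected_digraph X r\<close>; \<open>tail\<close> and \<open>head\<close> are \<open>o\<close> and \<open>t\<close>. That locale also fixes
  the value of \<open>r\<close> outside the arcs, where it is the identity.

  The library's \<open>tree\<close> and \<open>spanning_tree\<close> concern acyclicity of directed graphs, and would
  count \<open>[e, r e]\<close> as a cycle. Here a circuit must not use both orientations of an edge.
  A single loop \<open>[e]\<close> and a pair \<open>[e, f]\<close> of parallel edges with \<open>f \<noteq> r e\<close> are circuits.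
\<close>

definition circuit :: "('a, 'b) pre_digraph \<Rightarrow> ('b \<Rightarrow> 'b) \<Rightarrow> 'b list \<Rightarrow> bool" where
  "circuit X r p \<longleftrightarrow> pre_digraph.cycle X p \<and> (\<forall>e\<in>set p. r e \<notin> set p)"

definition serre_tree :: "('a, 'b) pre_digraph \<Rightarrow> ('b \<Rightarrow> 'b) \<Rightarrow> bool" where
  "serre_tree T r \<longleftrightarrow> Digraph_Component.connected T \<and> (\<nexists>p. circuit T r p)"

definition serre_spanning_trees ::
    "('a, 'b) pre_digraph \<Rightarrow> ('b \<Rightarrow> 'b) \<Rightarrow> ('a, 'b) pre_digraph set" where
  "serre_spanning_trees X r = {T. spanning T X \<and> r ` arcs T \<subseteq> arcs T \<and> serre_tree T r}"

definition complexity :: "('a, 'b) pre_digraph \<Rightarrow> ('b \<Rightarrow> 'b) \<Rightarrow> nat" where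
  "complexity X r = card (serre_spanning_trees X r)"

section \<open>Covers\<close>

text \<open>A morphism is the pair of its vertex map and its edge map.\<close>

definition graph_morphism ::
    "('a, 'b) pre_digraph \<Rightarrow> ('b \<Rightarrow> 'b) \<Rightarrow> ('c, 'd) pre_digraph \<Rightarrow> ('d \<Rightarrow> 'd) \<Rightarrow>
     ('a \<Rightarrow> 'c) \<times> ('b \<Rightarrow> 'd) \<Rightarrow> bool" where
  "graph_morphism Y rY X rX f \<longleftrightarrow>
     fst f \<in> verts Y \<rightarrow> verts X \<and> snd f \<in> arcs Y \<rightarrow> arcs X \<and>
     (\<forall>e\<in>arcs Y. tail X (snd f e) = fst f (tail Y e) \<and>
                 head X (snd f e) = fst f (head Y e) \<and>
                 rX (snd f e) = snd f (rY e))"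

definition graph_isomorphism ::
    "('a, 'b) pre_digraph \<Rightarrow> ('b \<Rightarrow> 'b) \<Rightarrow> ('c, 'd) pre_digraph \<Rightarrow> ('d \<Rightarrow> 'd) \<Rightarrow>
     ('a \<Rightarrow> 'c) \<times> ('b \<Rightarrow> 'd) \<Rightarrow> bool" where
  "graph_isomorphism Y rY X rX f \<longleftrightarrow>
     graph_morphism Y rY X rX f \<and>
     bij_betw (fst f) (verts Y) (verts X) \<and> bij_betw (snd f) (arcs Y) (arcs X)"

definition covering_map ::
    "('a, 'b) pre_digraph \<Rightarrow> ('b \<Rightarrow> 'b) \<Rightarrow> ('c, 'd) pre_digraph \<Rightarrow> ('d \<Rightarrow> 'd) \<Rightarrow>
     ('a \<Rightarrow> 'c) \<times> ('b \<Rightarrow> 'd) \<Rightarrow> bool" where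
  "covering_map Y rY X rX \<pi> \<longleftrightarrow>
     graph_morphism Y rY X rX \<pi> \<and>
     fst \<pi> ` verts Y = verts X \<and>
     (\<forall>w\<in>verts Y. bij_betw (snd \<pi>) (out_arcs Y w) (out_arcs X (fst \<pi> w)))"

text \<open>
  \<open>Aut(Y/X)\<close>, as a group under composition. Both components of its elements are extensional
  functions (undefined outside the vertices, respectively edges, of \<open>Y\<close>), so that two
  automorphisms which agree on \<open>Y\<close> are equal.
\<close>

definition aut_group ::
    "('a, 'b) pre_digraph \<Rightarrow> ('b \<Rightarrow> 'b) \<Rightarrow> ('a \<Rightarrow> 'c) \<times> ('b \<Rightarrow> 'd) \<Rightarrow>
     (('a \<Rightarrow> 'a) \<times> ('b \<Rightarrow> 'b)) monoid" where
  "aut_group Y rY \<pi> =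
     (BijGroup (verts Y) \<times>\<times> BijGroup (arcs Y))
       \<lparr>carrier := {\<sigma> \<in> Bij (verts Y) \<times> Bij (arcs Y).
          graph_isomorphism Y rY Y rY \<sigma> \<and>
          (\<forall>v\<in>verts Y. fst \<pi> (fst \<sigma> v) = fst \<pi> v) \<and>
          (\<forall>e\<in>arcs Y. snd \<pi> (snd \<sigma> e) = snd \<pi> e)}\<rparr>"

definition galois_cover ::
    "('a, 'b) pre_digraph \<Rightarrow> ('b \<Rightarrow> 'b) \<Rightarrow> ('c, 'd) pre_digraph \<Rightarrow> ('d \<Rightarrow> 'd) \<Rightarrow>
     ('a \<Rightarrow> 'c) \<times> ('b \<Rightarrow> 'd) \<Rightarrow> bool" where
  "galois_cover Y rY X rX \<pi> \<longleftrightarrow>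
     covering_map Y rY X rX \<pi> \<and> Digraph_Component.connected Y \<and>
     (\<forall>v\<in>verts X. \<forall>w\<in>verts Y. \<forall>w'\<in>verts Y. fst \<pi> w = v \<longrightarrow> fst \<pi> w' = v \<longrightarrow>
        (\<exists>\<sigma>\<in>carrier (aut_group Y rY \<pi>). fst \<sigma> w = w'))"

text \<open>
  The quotient of \<open>Y\<close> by a group \<open>\<Gamma>\<close> of automorphisms: its vertices and edges are the orbits,
  and since automorphisms commute with the structure maps, the image of the orbit of \<open>e\<close> under
  \<open>tail\<close>, \<open>head\<close> or \<open>r\<close> is the orbit of the image of \<open>e\<close>.
\<close>

definition quot_graph ::
    "('a, 'b) pre_digraph \<Rightarrow> (('a \<Rightarrow> 'a) \<times> ('b \<Rightarrow> 'b)) monoid \<Rightarrow> ('a set, 'b set) pre_digraph" where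
  "quot_graph Y \<Gamma> =
     \<lparr>verts = orbits \<Gamma> (verts Y) fst, arcs = orbits \<Gamma> (arcs Y) snd,
      tail = (\<lambda>E. tail Y ` E), head = (\<lambda>E. head Y ` E)\<rparr>"

definition quot_rev ::
    "('a, 'b) pre_digraph \<Rightarrow> ('b \<Rightarrow> 'b) \<Rightarrow> (('a \<Rightarrow> 'a) \<times> ('b \<Rightarrow> 'b)) monoid \<Rightarrow> 'b set \<Rightarrow> 'b set" where
  "quot_rev Y rY \<Gamma> E = (if E \<in> orbits \<Gamma> (arcs Y) snd then rY ` E else E)"

text \<open>The intermediate graph corresponding to a subgroup \<open>K\<close> of \<open>Aut(Y/X)\<close>, and its reversal.\<close>

definition intermediate_graph ::
    "('a, 'b) pre_digraph \<Rightarrow> ('b \<Rightarrow> 'b) \<Rightarrow> ('a \<Rightarrow> 'c) \<times> ('b \<Rightarrow> 'd) \<Rightarrow>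
     (('a \<Rightarrow> 'a) \<times> ('b \<Rightarrow> 'b)) set \<Rightarrow> ('a set, 'b set) pre_digraph" where
  "intermediate_graph Y rY \<pi> K = quot_graph Y ((aut_group Y rY \<pi>)\<lparr>carrier := K\<rparr>)"

definition intermediate_rev ::
    "('a, 'b) pre_digraph \<Rightarrow> ('b \<Rightarrow> 'b) \<Rightarrow> ('a \<Rightarrow> 'c) \<times> ('b \<Rightarrow> 'd) \<Rightarrow>
     (('a \<Rightarrow> 'a) \<times> ('b \<Rightarrow> 'b)) set \<Rightarrow> 'b set \<Rightarrow> 'b set" where
  "intermediate_rev Y rY \<pi> K = quot_rev Y rY ((aut_group Y rY \<pi>)\<lparr>carrier := K\<rparr>)"

section \<open>Kernels of irreducible complex representations\<close>

definition general_linear :: "nat \<Rightarrow> complex mat monoid" where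
  "general_linear n = units_of (ring_mat TYPE(complex) n ())"

definition irreducible_rep ::
    "('g, 'm) monoid_scheme \<Rightarrow> nat \<Rightarrow> ('g \<Rightarrow> complex mat) \<Rightarrow> bool" where
  "irreducible_rep G n \<rho> \<longleftrightarrow>
     \<rho> \<in> hom G (general_linear n) \<and> n > 0 \<and>
     (\<forall>W. VectorSpace.subspace class_ring W (module_vec TYPE(complex) n) \<longrightarrow>
          (\<forall>g\<in>carrier G. \<forall>w\<in>W. \<rho> g *\<^sub>v w \<in> W) \<longrightarrow>
          W = {0\<^sub>v n} \<or> W = carrier_vec n)"

text \<open>
  Every finite-dimensional complex representation is isomorphic to a matrix representation, and
  isomorphic representations have the same kernel, so this is the set of all kernels of \<open>Irr(G)\<close>.
\<close>

definition irr_kernels :: "('g, 'm) monoid_scheme \<Rightarrow> 'g set set" where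
  "irr_kernels G = {kernel G (general_linear n) \<rho> | n \<rho>. irreducible_rep G n \<rho>}"

section \<open>The Moebius function of a finite partially ordered set\<close>

text \<open>
  \<open>L\<close> carries the order of its type (inclusion, if its elements are sets). The function is 0
  outside \<open>L \<times> L\<close>, and for infinite \<open>L\<close>.
\<close>

function moebius :: "'p::order set \<Rightarrow> 'p \<Rightarrow> 'p \<Rightarrow> int" where
  "moebius L x y =
     (if finite L \<and> x \<in> L \<and> y \<in> L then
        if x = y then 1
        else if x < y then - (\<Sum>z\<in>{z\<in>L. x \<le> z \<and> z < y}. moebius L x z)
        else 0
      else 0)"
  by pat_completeness auto
termination
proof (relation "measure (\<lambda>(L, x, y). card {z\<in>L. z < y})", goal_cases)
  case 1
  show ?case by simp
next
  case (2 L x y z)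
  then show ?case by (auto intro!: psubset_card_mono)
qed

declare moebius.simps [simp del]

end

theory Submission
  imports Defs "Jordan_Normal_Form.Schur_Decomposition"
begin

text \<open>
  Let \<open>e\<^sub>H\<close> be the idempotent of the group algebra that averages over a normal subgroup \<open>H\<close>. On an
  irreducible representation with kernel \<open>K\<close> it is the identity if \<open>H \<subseteq> K\<close> and zero otherwise, so the
  defining recursion of the Moebius function at \<open>K\<close> says that \<open>\<Sum>H. -\<mu>(\<emptyset>, H) e\<^sub>H\<close> acts as the
  identity on every irreducible representation. Hence this sum equals 1 in the group algebra.

  The group acts freely on \<open>Y\<close>, and for the Laplacians \<open>L\<close> of \<open>Y\<close> and \<open>L\<^sub>H\<close> of \<open>X\<^sub>H\<close> the trace of
  \<open>L\<^sup>k e\<^sub>H\<close> is the trace of \<open>L\<^sub>H\<^sup>k\<close>. So the power sums of the eigenvalues of \<open>L\<close> are the combinations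
  of those of the \<open>L\<^sub>H\<close> with coefficients \<open>-\<mu>(\<emptyset>, H)\<close>, and so are the multiplicities of the eigenvalues.
  By the matrix tree theorem the product of the nonzero eigenvalues of the Laplacian is the number of
  vertices times the complexity, which turns this relation into the claimed product.

  The matrix tree theorem is obtained by expanding the determinant linearly in each row: a choice of
  an outgoing arc at every vertex but a root contributes 1 if following the arcs leads from every
  vertex to the root, and 0 otherwise, and these choices correspond to the spanning trees.
\<close>

section \<open>Traces and eigenvalues\<close>

text \<open>The group algebra identity is used coefficient by coefficient: for each
  \<open>g\<close>, the numbers \<open>- \<mu>({}, H) / card H\<close> over the kernels
  \<open>H\<close> containing \<open>g\<close> sum to 1 if \<open>g\<close> is the unit and to 0
  otherwise. For two vertices in one orbit of the free action, the unique \<open>g\<close> carrying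
  one to the other turns this into a statement about pairs: \<open>H\<close> contributes exactly
  when they lie in one \<open>H\<close>-orbit. Weighted with the entries of a power of the
  Laplacian, it becomes the relation of traces. The weights may have both signs, so the relation is
  no decomposition of a spectrum and eigenvalues get integer exponents. Hence the eigenvalue 0 has
  to be split off. It is simple because a connected graph has a spanning tree, and the coefficient
  of x in the characteristic polynomial is the product over the other eigenvalues. The indices [G:H]
  and the factor 1/|G| come from counting vertices: \<open>X\<^sub>H\<close> has a [G:H] vertices,
  where a = |V(Y)|/|G|. Since the weights sum to 1, the constant a leaves the product to the first
  power.\<close>

lemma mult_mat_entry:
  assumes "A \<in> carrier_mat n m" "B \<in> carrier_mat m p" "i < n" "j < p"
  shows "(A * B) $$ (i, j) = (\<Sum>k<m. A $$ (i, k) * B $$ (k, j))"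
  using assms by (auto simp: scalar_prod_def lessThan_atLeast0 intro!: sum.cong)

lemma mult_mat_vec_entry:
  assumes "A \<in> carrier_mat n m" "v \<in> carrier_vec m" "i < n"
  shows "(A *\<^sub>v v) $ i = (\<Sum>k<m. A $$ (i, k) * v $ k)"
  using assms by (auto simp: scalar_prod_def lessThan_atLeast0 intro!: sum.cong)

definition mat_trace :: "'x :: comm_ring_1 mat \<Rightarrow> 'x" where
  "mat_trace A = (\<Sum>i<dim_row A. A $$ (i, i))"

lemma mat_trace_mult_comm:
  assumes A: "A \<in> carrier_mat n m" and B: "B \<in> carrier_mat m n"
  shows "mat_trace (A * B) = mat_trace (B * A)"
proof -
  have "mat_trace (A * B) = (\<Sum>i<n. \<Sum>j<m. A $$ (i, j) * B $$ (j, i))"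
    using A B by (auto simp: mat_trace_def scalar_prod_def lessThan_atLeast0 intro!: sum.cong)
  also have "\<dots> = (\<Sum>j<m. \<Sum>i<n. B $$ (j, i) * A $$ (i, j))"
    by (subst sum.swap) (simp add: mult.commute)
  also have "\<dots> = mat_trace (B * A)"
    using A B by (auto simp: mat_trace_def scalar_prod_def lessThan_atLeast0 intro!: sum.cong)
  finally show ?thesis .
qed

lemma mat_trace_mult:
  assumes "A \<in> carrier_mat n m" "B \<in> carrier_mat m n"
  shows "mat_trace (A * B) = (\<Sum>i<n. \<Sum>j<m. A $$ (i, j) * B $$ (j, i))"
  using assms by (auto simp: mat_trace_def mult_mat_entry simp del: index_mult_mat(1) intro!: sum.cong)

lemma mat_trace_smult:
  assumes "A \<in> carrier_mat n n"
  shows "mat_trace (c \<cdot>\<^sub>m A) = c * mat_trace A"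
  using assms by (auto simp: mat_trace_def sum_distrib_left intro!: sum.cong)

text \<open>\<open>P\<close> will be the rectangular incidence matrix of vertices and orbits, so the
  Laplacians of a graph and of its quotient are related by intertwining and not by
  similarity.\<close>

lemma pow_mat_intertwine:
  fixes A B P :: "'x :: semiring_1 mat"
  assumes A: "A \<in> carrier_mat n n" and B: "B \<in> carrier_mat m m" and P: "P \<in> carrier_mat n m"
    and AP: "A * P = P * B"
  shows "A ^\<^sub>m k * P = P * B ^\<^sub>m k"
proof (induction k)
  case 0
  then show ?case using A B P by simp
next
  case (Suc k)
  have Ak: "A ^\<^sub>m k \<in> carrier_mat n n" and Bk: "B ^\<^sub>m k \<in> carrier_mat m m" using A B by auto
  have "A ^\<^sub>m Suc k * P = A ^\<^sub>m k * (P * B)"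
    unfolding AP[symmetric] pow_mat.simps by (rule assoc_mult_mat[OF Ak A P])
  also have "\<dots> = (P * B ^\<^sub>m k) * B"
    unfolding Suc[symmetric] by (rule assoc_mult_mat[symmetric, OF Ak P B])
  also have "\<dots> = P * B ^\<^sub>m Suc k"
    unfolding pow_mat.simps by (rule assoc_mult_mat[OF P Bk B])
  finally show ?case .
qed

lemma upper_triangular_mult_diag:
  fixes A B :: "'x :: comm_ring_1 mat"
  assumes A: "A \<in> carrier_mat n n" "upper_triangular A"
    and B: "B \<in> carrier_mat n n" "upper_triangular B"
  shows "upper_triangular (A * B)" "\<And>i. i < n \<Longrightarrow> (A * B) $$ (i, i) = A $$ (i, i) * B $$ (i, i)"
proof -
  have ent: "(A * B) $$ (i, j) = (\<Sum>k\<in>{0..<n}. A $$ (i, k) * B $$ (k, j))" if "i < n" "j < n" for i j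
    using A B that by (auto simp: scalar_prod_def intro!: sum.cong)
  show "upper_triangular (A * B)"
  proof (rule upper_triangularI)
    fix i j assume ij: "j < i" "i < dim_row (A * B)"
    have "A $$ (i, k) * B $$ (k, j) = 0" if "k < n" for k
      using A B ij that by (cases "k < i") (auto simp: upper_triangularD)
    then show "(A * B) $$ (i, j) = 0" using ent[of i j] ij A by (auto intro!: sum.neutral)
  qed
  show "(A * B) $$ (i, i) = A $$ (i, i) * B $$ (i, i)" if i: "i < n" for i
  proof -
    have "A $$ (i, k) * B $$ (k, i) = 0" if "k < n" "k \<noteq> i" for k
      using A B i that by (cases "k < i") (auto simp: upper_triangularD)
    then have "(\<Sum>k\<in>{0..<n}. A $$ (i, k) * B $$ (k, i)) = (\<Sum>k\<in>{i}. A $$ (i, k) * B $$ (k, i))"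
      using i by (intro sum.mono_neutral_right) auto
    then show ?thesis using ent[OF i i] by simp
  qed
qed

lemma upper_triangular_pow_diag:
  fixes A :: "'x :: comm_ring_1 mat"
  assumes A: "A \<in> carrier_mat n n" "upper_triangular A"
  shows "upper_triangular (A ^\<^sub>m k) \<and> (\<forall>i<n. (A ^\<^sub>m k) $$ (i, i) = (A $$ (i, i)) ^ k)"
proof (induction k)
  case 0
  then show ?case using A by auto
next
  case (Suc k)
  have c: "A ^\<^sub>m k \<in> carrier_mat n n" using A by simp
  show ?case
    using upper_triangular_mult_diag[OF c _ A] Suc by (simp add: mult.commute)
qed

text \<open>Schur triangularization puts the roots of the characteristic polynomial, with
  multiplicity, on the diagonal, where powers act entrywise; cyclicity of the trace discards the
  change of basis.\<close>

lemma eigenvalue_list_exists: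
  fixes A :: "complex mat"
  assumes A: "A \<in> carrier_mat n n"
  shows "\<exists>as. char_poly A = (\<Prod>a\<leftarrow>as. [:- a, 1:]) \<and>
           (\<forall>k. mat_trace (A ^\<^sub>m k) = (\<Sum>a\<leftarrow>as. a ^ k))"
proof -
  obtain es where cp: "char_poly A = (\<Prod>e\<leftarrow>es. [:- e, 1:])"
    using char_poly_factorized[OF A] by blast
  obtain B P Q where sd: "schur_decomposition A es = (B, P, Q)"
    by (cases "schur_decomposition A es")
  from schur_decomposition[OF A cp sd]
  have sim: "similar_mat_wit A B P Q" and ut: "upper_triangular B" and dg: "diag_mat B = es" by auto
  from similar_mat_witD2[OF A sim]
  have B: "B \<in> carrier_mat n n" and P: "P \<in> carrier_mat n n" and Q: "Q \<in> carrier_mat n n"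
    and QP: "Q * P = 1\<^sub>m n" by auto
  have "mat_trace (A ^\<^sub>m k) = (\<Sum>a\<leftarrow>es. a ^ k)" for k
  proof -
    have Bk: "B ^\<^sub>m k \<in> carrier_mat n n" using B by simp
    have "A ^\<^sub>m k = P * B ^\<^sub>m k * Q"
      using similar_mat_witD(3)[OF refl similar_mat_wit_pow[OF sim, of k]] .
    then have "mat_trace (A ^\<^sub>m k) = mat_trace (P * (B ^\<^sub>m k * Q))"
      using assoc_mult_mat[OF P Bk Q] by simp
    also have "\<dots> = mat_trace ((B ^\<^sub>m k * Q) * P)"
      by (rule mat_trace_mult_comm[OF P]) (use Bk Q in auto)
    also have "(B ^\<^sub>m k * Q) * P = B ^\<^sub>m k"
      using assoc_mult_mat[OF Bk Q P] QP right_mult_one_mat[OF Bk] by simp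
    also have "mat_trace (B ^\<^sub>m k) = (\<Sum>i<n. (B $$ (i, i)) ^ k)"
      using B upper_triangular_pow_diag[OF B ut, of k] Bk by (simp add: mat_trace_def)
    also have "\<dots> = (\<Sum>a\<leftarrow>es. a ^ k)"
      using B by (simp add: dg[symmetric] diag_mat_def comp_def interv_sum_list_conv_sum_set_nat
          lessThan_atLeast0)
    finally show ?thesis .
  qed
  with cp show ?thesis by blast
qed

text \<open>Linearity carries the relation from monomials to all polynomials, and a suitable
  polynomial summed over a list reads off one multiplicity. The exponent 0 is included, which covers
  constant polynomials.\<close>

lemma count_list_of_power_sums:
  fixes c :: "'i \<Rightarrow> complex"
  assumes I: "finite I"
    and ps: "\<And>k::nat. (\<Sum>a\<leftarrow>bs. a ^ k) = (\<Sum>i\<in>I. c i * (\<Sum>a\<leftarrow>as i. a ^ k))"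
  shows "of_nat (count_list bs x) = (\<Sum>i\<in>I. c i * of_nat (count_list (as i) x))"
proof -
  have expand: "(\<Sum>a\<leftarrow>xs. poly p a) = (\<Sum>k\<le>degree p. coeff p k * (\<Sum>a\<leftarrow>xs. a ^ k))"
    for p :: "complex poly" and xs
    by (induction xs) (auto simp: poly_altdef sum.distrib distrib_left)
  have gen: "(\<Sum>a\<leftarrow>bs. poly p a) = (\<Sum>i\<in>I. c i * (\<Sum>a\<leftarrow>as i. poly p a))" for p :: "complex poly"
    unfolding expand ps sum_distrib_left
    by (subst sum.swap) (simp add: mult.left_commute)
  \<comment> \<open>A polynomial that vanishes at every other entry isolates the multiplicity of \<open>x\<close>.\<close>
  define S where "S = insert x (set bs \<union> (\<Union>i\<in>I. set (as i)))"
  have S: "finite S" using I by (auto simp: S_def)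
  define p where "p = (\<Prod>b\<in>S - {x}. [:- b, 1:])"
  have p0: "poly p b = 0" if "b \<in> S" "b \<noteq> x" for b
    unfolding p_def poly_prod using that S by (intro prod_zero) auto
  have px: "poly p x \<noteq> 0" unfolding p_def poly_prod using S by auto
  have cnt: "(\<Sum>a\<leftarrow>xs. poly p a) = poly p x * of_nat (count_list xs x)" if "set xs \<subseteq> S" for xs
    using that by (induction xs) (auto simp: p0 algebra_simps)
  have "poly p x * of_nat (count_list bs x) =
      (\<Sum>i\<in>I. c i * (poly p x * of_nat (count_list (as i) x)))"
  proof -
    have "(\<Sum>i\<in>I. c i * (\<Sum>a\<leftarrow>as i. poly p a)) =
        (\<Sum>i\<in>I. c i * (poly p x * of_nat (count_list (as i) x)))"
      by (intro sum.cong refl arg_cong2[of _ _ _ _ "(*)"] cnt) (auto simp: S_def)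
    moreover have "(\<Sum>a\<leftarrow>bs. poly p a) = poly p x * of_nat (count_list bs x)"
      by (rule cnt) (auto simp: S_def)
    ultimately show ?thesis using gen[of p] by simp
  qed
  also have "\<dots> = poly p x * (\<Sum>i\<in>I. c i * of_nat (count_list (as i) x))"
    by (simp add: sum_distrib_left mult.left_commute)
  finally show ?thesis using px by simp
qed

text \<open>The set \<open>S\<close> may be larger than the list, so that several lists can be
  compared over one index set; absent entries get exponent 0.\<close>

lemma prod_list_map_eq_prod_count_superset:
  fixes f :: "'x \<Rightarrow> 'y :: comm_monoid_mult"
  assumes "finite S" "set xs \<subseteq> S"
  shows "(\<Prod>x\<leftarrow>xs. f x) = (\<Prod>x\<in>S. f x ^ count_list xs x)"
  using assms(2)
proof (induction xs)
  case (Cons y xs)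
  have "(\<Prod>x\<in>S. f x ^ count_list (y # xs) x) = (\<Prod>x\<in>S. (if x = y then f x else 1) * f x ^ count_list xs x)"
    by (intro prod.cong) auto
  also have "\<dots> = f y * (\<Prod>x\<in>S. f x ^ count_list xs x)"
    using Cons.prems assms(1) by (simp add: prod.distrib prod.delta)
  finally show ?case using Cons by simp
qed simp

text \<open>The two coefficient hypotheses say that 0 is a root and a simple one. After division by
  x the linear coefficient is a constant term, the product of the negated nonzero roots.\<close>

lemma coeff_1_prod_linear_factors:
  fixes as :: "complex list"
  assumes p: "p = (\<Prod>a\<leftarrow>as. [:- a, 1:])" and c0: "coeff p 0 = 0" and c1: "coeff p 1 \<noteq> 0"
    and S: "finite S" "set as \<subseteq> S"
  shows "coeff p 1 = (\<Prod>a\<in>S - {0}. (- a) ^ count_list as a)"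
proof -
  have c0e: "coeff (\<Prod>a\<leftarrow>xs. [:- a, 1:]) 0 = (\<Prod>a\<leftarrow>xs. - a)" for xs :: "complex list"
    by (induction xs) (auto simp: coeff_mult_0)
  have "0 \<in> set as" using c0 p c0e[of as] by (auto simp: prod_list_zero_iff)
  then have pe: "p = [:0, 1:] * (\<Prod>a\<leftarrow>remove1 0 as. [:- a, 1:])"
    unfolding p using prod_list_map_remove1[of 0 as "\<lambda>a. [:- a, 1:]"] by simp
  then have c1e: "coeff p 1 = (\<Prod>a\<leftarrow>remove1 0 as. - a)"
    by (simp add: c0e[symmetric])
  \<comment> \<open>A second root 0 would make the linear coefficient vanish.\<close>
  then have n0: "0 \<notin> set (remove1 0 as)" using c1 by (auto simp: prod_list_zero_iff)
  have "set (remove1 0 as) \<subseteq> S - {0}" using n0 S set_remove1_subset[of 0 as] by auto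
  then have "coeff p 1 = (\<Prod>a\<in>S - {0}. (- a) ^ count_list (remove1 0 as) a)"
    unfolding c1e using S by (intro prod_list_map_eq_prod_count_superset) auto
  moreover have "count_list (remove1 0 as) a = count_list as a" if "a \<noteq> 0" for a
    using that by (induction as) auto
  ultimately show ?thesis by (auto intro: prod.cong)
qed

lemma powi_sum:
  fixes x :: "'x :: field"
  assumes "x \<noteq> 0" "finite I"
  shows "x powi (\<Sum>i\<in>I. f i) = (\<Prod>i\<in>I. x powi f i)"
  using assms(2) by (induction I) (auto simp: power_int_add assms(1))

lemma prod_powi_distrib:
  fixes f :: "'i \<Rightarrow> 'x :: field"
  shows "(\<Prod>i\<in>I. f i) powi k = (\<Prod>i\<in>I. f i powi k)"
  by (induction I rule: infinite_finite_induct) (auto simp: power_int_mult_distrib)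

text \<open>The multiplicity of each complex number as an eigenvalue satisfies the same integral
  relation as the traces. Raising the nonzero \<open>- a\<close> to these multiplicities and
  exchanging the two products gives the claim.\<close>

lemma coeff_1_char_poly_of_traces:
  fixes A :: "complex mat" and B :: "'i \<Rightarrow> complex mat" and c :: "'i \<Rightarrow> int"
  assumes I: "finite I" and A: "A \<in> carrier_mat n n"
    and B: "\<And>i. i \<in> I \<Longrightarrow> B i \<in> carrier_mat (m i) (m i)"
    and tr: "\<And>k. mat_trace (A ^\<^sub>m k) = (\<Sum>i\<in>I. of_int (c i) * mat_trace (B i ^\<^sub>m k))"
    and A0: "coeff (char_poly A) 0 = 0" and A1: "coeff (char_poly A) 1 \<noteq> 0"
    and B0: "\<And>i. i \<in> I \<Longrightarrow> coeff (char_poly (B i)) 0 = 0"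
    and B1: "\<And>i. i \<in> I \<Longrightarrow> coeff (char_poly (B i)) 1 \<noteq> 0"
  shows "coeff (char_poly A) 1 = (\<Prod>i\<in>I. coeff (char_poly (B i)) 1 powi c i)"
proof -
  obtain es where es: "char_poly A = (\<Prod>a\<leftarrow>es. [:- a, 1:])" "\<And>k. mat_trace (A ^\<^sub>m k) = (\<Sum>a\<leftarrow>es. a ^ k)"
    using eigenvalue_list_exists[OF A] by blast
  have "\<forall>i\<in>I. \<exists>fs. char_poly (B i) = (\<Prod>a\<leftarrow>fs. [:- a, 1:]) \<and>
           (\<forall>k. mat_trace (B i ^\<^sub>m k) = (\<Sum>a\<leftarrow>fs. a ^ k))"
    using eigenvalue_list_exists B by blast
  then obtain fs where fs: "\<And>i. i \<in> I \<Longrightarrow> char_poly (B i) = (\<Prod>a\<leftarrow>fs i. [:- a, 1:])"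
    "\<And>i k. i \<in> I \<Longrightarrow> mat_trace (B i ^\<^sub>m k) = (\<Sum>a\<leftarrow>fs i. a ^ k)"
    by metis
  have "of_nat (count_list es x) = (\<Sum>i\<in>I. of_int (c i) * of_nat (count_list (fs i) x) :: complex)" for x
    using I by (rule count_list_of_power_sums) (use tr es fs in auto)
  \<comment> \<open>Multiplicities and weights are integers, so the relation descends from the
    complex numbers to integer exponents.\<close>
  then have cnt: "int (count_list es x) = (\<Sum>i\<in>I. c i * int (count_list (fs i) x))" for x
    by (subst of_int_eq_iff[where 'a = complex, symmetric]) simp
  define S where "S = (set es \<union> (\<Union>i\<in>I. set (fs i)))"
  have S: "finite S" using I by (auto simp: S_def)
  have "coeff (char_poly A) 1 = (\<Prod>a\<in>S - {0}. (- a) ^ count_list es a)"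
    by (rule coeff_1_prod_linear_factors[OF es(1) A0 A1 S]) (auto simp: S_def)
  \<comment> \<open>Since 0 is excluded from the product, exponents of either sign add up.\<close>
  also have "\<dots> = (\<Prod>a\<in>S - {0}. \<Prod>i\<in>I. (- a) powi (c i * int (count_list (fs i) a)))"
    by (intro prod.cong refl)
       (simp add: power_int_of_nat[symmetric] cnt I powi_sum del: power_int_of_nat)
  also have "\<dots> = (\<Prod>i\<in>I. (\<Prod>a\<in>S - {0}. (- a) ^ count_list (fs i) a) powi c i)"
    by (subst prod.swap)
       (simp add: prod_powi_distrib mult.commute[of "c _"] power_int_mult)
  also have "\<dots> = (\<Prod>i\<in>I. coeff (char_poly (B i)) 1 powi c i)"
  proof (intro prod.cong refl)
    fix i assume i: "i \<in> I"
    show "(\<Prod>a\<in>S - {0}. (- a) ^ count_list (fs i) a) powi c i = coeff (char_poly (B i)) 1 powi c i"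
      using coeff_1_prod_linear_factors[OF fs(1)[OF i] B0[OF i] B1[OF i] S]
      using \<open>i \<in> I\<close> by (metis S_def UN_upper le_supI2)
  qed
  finally show ?thesis .
qed

section \<open>Kernels of irreducible representations\<close>

lemma sum_moebius_eq_0:
  assumes L: "finite L" "x \<in> L" "y \<in> L" and xy: "x < y"
  shows "(\<Sum>z\<in>{z \<in> L. x \<le> z \<and> z \<le> y}. moebius L x z) = 0"
proof -
  have "{z \<in> L. x \<le> z \<and> z \<le> y} = insert y {z \<in> L. x \<le> z \<and> z < y}"
    using L xy by (auto simp: le_less)
  then have "(\<Sum>z\<in>{z \<in> L. x \<le> z \<and> z \<le> y}. moebius L x z) =
      moebius L x y + (\<Sum>z\<in>{z \<in> L. x \<le> z \<and> z < y}. moebius L x z)"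
    using L by simp
  also have "moebius L x y = - (\<Sum>z\<in>{z \<in> L. x \<le> z \<and> z < y}. moebius L x z)"
    using L xy by (subst moebius.simps) (simp add: less_imp_neq)
  finally show ?thesis by simp
qed

text \<open>The adjoined bottom \<open>{}\<close> contributes 1 to the vanishing sum over the
  interval from \<open>{}\<close> to \<open>K\<close>, which leaves -1 for the kernels
  themselves.\<close>

lemma sum_moebius_empty:
  fixes \<H> :: "'g set set"
  assumes H: "finite \<H>" "{} \<notin> \<H>" "K \<in> \<H>"
  shows "(\<Sum>H\<in>{H \<in> \<H>. H \<subseteq> K}. moebius (insert {} \<H>) {} H) = - 1"
proof -
  have "K \<noteq> {}" using H by auto
  then have "{} < K" by blast
  then have "(\<Sum>z\<in>{z \<in> insert {} \<H>. {} \<le> z \<and> z \<le> K}. moebius (insert {} \<H>) {} z) = 0"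
    using H by (intro sum_moebius_eq_0) auto
  also have "{z \<in> insert {} \<H>. {} \<le> z \<and> z \<le> K} = insert {} {H \<in> \<H>. H \<subseteq> K}" by auto
  finally have "moebius (insert {} \<H>) {} {} + (\<Sum>H\<in>{H \<in> \<H>. H \<subseteq> K}. moebius (insert {} \<H>) {} H) = 0"
    using H by simp
  moreover have "moebius (insert {} \<H>) {} {} = 1"
    using H by (subst moebius.simps) simp
  ultimately show ?thesis by simp
qed

text \<open>The values are invertible because the image of the inverse element is a two-sided
  inverse. The clause at the unit excludes multiplicative maps such as the zero map for
  \<open>n > 0\<close>.\<close>

lemma hom_general_linear_iff:
  assumes G: "group G"
  shows "\<rho> \<in> hom G (general_linear n) \<longleftrightarrow>
    (\<forall>g\<in>carrier G. \<rho> g \<in> carrier_mat n n) \<and>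
    (\<forall>g\<in>carrier G. \<forall>h\<in>carrier G. \<rho> (g \<otimes>\<^bsub>G\<^esub> h) = \<rho> g * \<rho> h) \<and> \<rho> \<one>\<^bsub>G\<^esub> = 1\<^sub>m n"
    (is "?l \<longleftrightarrow> ?r")
proof
  interpret G: group G by fact
  interpret R: ring "ring_mat TYPE(complex) n ()" by (rule ring_mat)
  note s = general_linear_def units_of_carrier units_of_mult units_of_one ring_mat_simps
  {
    assume l: ?l
    interpret group_hom G "general_linear n" \<rho>
      using l G R.units_group by (simp add: group_hom_def group_hom_axioms_def general_linear_def)
    show ?r
    proof (intro conjI ballI)
      show "\<rho> g \<in> carrier_mat n n" if "g \<in> carrier G" for g
        using hom_closed[OF that] by (auto simp: s Units_def)
      show "\<rho> (g \<otimes>\<^bsub>G\<^esub> h) = \<rho> g * \<rho> h" if "g \<in> carrier G" "h \<in> carrier G" for g h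
        using hom_mult[OF that] by (simp add: s)
      show "\<rho> \<one>\<^bsub>G\<^esub> = 1\<^sub>m n" using hom_one by (simp add: s)
    qed
  }
  {
    assume r: ?r
    show ?l
    proof (rule homI)
      fix g assume g: "g \<in> carrier G"
      have "\<rho> (inv\<^bsub>G\<^esub> g) * \<rho> g = 1\<^sub>m n" "\<rho> g * \<rho> (inv\<^bsub>G\<^esub> g) = 1\<^sub>m n"
        using r g by (metis G.inv_closed G.l_inv, metis G.inv_closed G.r_inv)
      then show "\<rho> g \<in> carrier (general_linear n)"
        using r g by (auto simp: s Units_def)
    qed (use r in \<open>auto simp: s\<close>)
  }
qed

section \<open>Subspaces and subrepresentations in coordinates\<close>

definition linear_subspace :: "nat \<Rightarrow> complex vec set \<Rightarrow> bool" where
  "linear_subspace n W \<longleftrightarrow> W \<subseteq> carrier_vec n \<and> 0\<^sub>v n \<in> W \<and>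
     (\<forall>v\<in>W. \<forall>w\<in>W. v + w \<in> W) \<and> (\<forall>c. \<forall>w\<in>W. c \<cdot>\<^sub>v w \<in> W)"

lemma subspace_module_vec_iff:
  "VectorSpace.subspace class_ring W (module_vec TYPE(complex) n) \<longleftrightarrow> linear_subspace n W"
  by (auto simp: VectorSpace.subspace_def submodule_def linear_subspace_def vec_vs vec_module
      module_vec_simps)

lemma eq_mat_of_mult_vec:
  fixes A :: "complex mat"
  assumes A: "A \<in> carrier_mat n m" and B: "B \<in> carrier_mat n m"
    and eq: "\<And>v. v \<in> carrier_vec m \<Longrightarrow> A *\<^sub>v v = B *\<^sub>v v"
  shows "A = B"
proof (rule eq_matI)
  fix i j assume ij: "i < dim_row B" "j < dim_col B"
  have i: "i < n" and j: "j < m" using ij B by auto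
  have "(C *\<^sub>v unit_vec m j) $ i = C $$ (i, j)" if "C \<in> carrier_mat n m" for C :: "complex mat"
    using that i j by simp
  then show "A $$ (i, j) = B $$ (i, j)" using eq[of "unit_vec m j"] A B by (metis unit_vec_carrier)
qed (use A B in auto)

text \<open>Such a matrix with \<open>m\<close> columns stands for a basis of an
  \<open>m\<close>-dimensional subspace, namely its columns; multiplication by it maps coordinates
  to vectors.\<close>

definition injective_mat :: "complex mat \<Rightarrow> bool" where
  "injective_mat B \<longleftrightarrow> (\<forall>c\<in>carrier_vec (dim_col B). B *\<^sub>v c = 0\<^sub>v (dim_row B) \<longrightarrow> c = 0\<^sub>v (dim_col B))"

lemma injective_matD:
  assumes "injective_mat B" "B \<in> carrier_mat n m" "c \<in> carrier_vec m" "B *\<^sub>v c = 0\<^sub>v n"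
  shows "c = 0\<^sub>v m"
  using assms by (auto simp: injective_mat_def)

lemma injective_mat_cancel:
  assumes B: "injective_mat B" "B \<in> carrier_mat n m" and c: "c \<in> carrier_vec m" "d \<in> carrier_vec m"
    and eq: "B *\<^sub>v c = B *\<^sub>v d"
  shows "c = d"
proof -
  have "B *\<^sub>v (c - d) = B *\<^sub>v d - B *\<^sub>v d"
    unfolding mult_minus_distrib_mat_vec[OF B(2) c] eq ..
  also have "\<dots> = 0\<^sub>v n"
    using B(2) c(2) by (intro minus_cancel_vec mult_mat_vec_carrier)
  finally have "B *\<^sub>v (c - d) = 0\<^sub>v n" .
  then have "c - d = 0\<^sub>v m" by (rule injective_matD[OF B minus_carrier_vec[OF c]])
  then have "(c - d) $ i = 0" if "i < m" for i using that by simp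
  then show ?thesis using c by (intro eq_vecI) auto
qed

text \<open>If there were more columns than rows, padding with zero rows would give a singular
  square matrix, and a null vector of it is already killed by \<open>B\<close>.\<close>

lemma injective_mat_dims:
  assumes B: "injective_mat B" "B \<in> carrier_mat n m"
  shows "m \<le> n"
proof (rule ccontr)
  assume "\<not> m \<le> n"
  then have nm: "n < m" by simp
  define C where "C = mat m m (\<lambda>(i, j). if i < n then B $$ (i, j) else 0)"
  have C: "C \<in> carrier_mat m m" by (simp add: C_def)
  have "transpose_mat C *\<^sub>v unit_vec m n = 0\<^sub>v m"
    using nm by (intro eq_vecI) (auto simp: C_def)
  moreover have "unit_vec m n \<noteq> (0\<^sub>v m :: complex vec)" using nm by simp
  ultimately have "det (transpose_mat C) = 0"
    using C by (subst det_0_iff_vec_prod_zero[of _ m]) (auto intro!: exI[of _ "unit_vec m n"])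
  then have "det C = 0" using det_transpose[OF C] by simp
  then obtain v where v: "v \<in> carrier_vec m" "v \<noteq> 0\<^sub>v m" "C *\<^sub>v v = 0\<^sub>v m"
    using det_0_iff_vec_prod_zero[OF C] by blast
  have "B *\<^sub>v v = 0\<^sub>v n"
  proof (rule eq_vecI)
    fix i assume i: "i < dim_vec (0\<^sub>v n :: complex vec)"
    have "(C *\<^sub>v v) $ i = 0" using v i nm by simp
    moreover have "row C i = row B i" using B i nm by (intro eq_vecI) (auto simp: C_def)
    ultimately show "(B *\<^sub>v v) $ i = (0\<^sub>v n) $ i" using B C i nm by simp
  qed (use B in auto)
  then show False using injective_matD[OF B v(1)] v(2) by simp
qed

lemma injective_square_mat_range:
  assumes B: "injective_mat B" "B \<in> carrier_mat n n" and w: "w \<in> carrier_vec n"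
  shows "\<exists>c\<in>carrier_vec n. B *\<^sub>v c = w"
proof -
  have "det B \<noteq> 0"
    using B injective_matD[OF B] by (auto simp: det_0_iff_vec_prod_zero[of B n])
  then obtain C where C: "C \<in> carrier_mat n n" "B * C = 1\<^sub>m n"
    using det_non_zero_imp_unit[OF B(2), where b = "()"]
    by (auto simp: Units_def ring_mat_simps)
  have "B *\<^sub>v (C *\<^sub>v w) = w"
    using B C w assoc_mult_mat_vec[OF B(2) C(1) w] by simp
  then show ?thesis using C w by (intro bexI[of _ "C *\<^sub>v w"]) auto
qed

text \<open>Among the injective matrices with range inside \<open>W\<close>, one with the most
  columns has range \<open>W\<close>: a vector of \<open>W\<close> outside the range could be
  appended as a further column. The number of columns is bounded by
  \<open>injective_mat_dims\<close>.\<close>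

lemma linear_subspace_basis:
  assumes W: "linear_subspace n W"
  shows "\<exists>m B. m \<le> n \<and> B \<in> carrier_mat n m \<and> injective_mat B \<and> (\<lambda>c. B *\<^sub>v c) ` carrier_vec m = W"
proof -
  define P where "P m \<longleftrightarrow> (\<exists>B. B \<in> carrier_mat n m \<and> injective_mat B \<and> (\<forall>c\<in>carrier_vec m. B *\<^sub>v c \<in> W))"
    for m
  have P0: "P 0"
    unfolding P_def
  proof (intro exI[of _ "mat n 0 (\<lambda>_. 0)"] conjI ballI)
    fix c :: "complex vec" assume "c \<in> carrier_vec 0"
    then have "mat n 0 (\<lambda>_. 0) *\<^sub>v c = 0\<^sub>v n" by (intro eq_vecI) (auto simp: scalar_prod_def)
    then show "mat n 0 (\<lambda>_. 0) *\<^sub>v c \<in> W" using W by (simp add: linear_subspace_def)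
  qed (auto simp: injective_mat_def)
  have bnd: "m \<le> n" if "P m" for m
    using that injective_mat_dims by (auto simp: P_def)
  obtain m where m: "P m" "\<And>k. P k \<Longrightarrow> k \<le> m"
    using ex_has_greatest_nat[of P 0 id "Suc n"] P0 bnd by (auto simp: less_Suc_eq_le)
  then obtain B where B: "B \<in> carrier_mat n m" "injective_mat B" "\<And>c. c \<in> carrier_vec m \<Longrightarrow> B *\<^sub>v c \<in> W"
    by (auto simp: P_def)
  have "w \<in> (\<lambda>c. B *\<^sub>v c) ` carrier_vec m" if w: "w \<in> W" for w
  proof (rule ccontr)
    assume nr: "w \<notin> (\<lambda>c. B *\<^sub>v c) ` carrier_vec m"
    have wc: "w \<in> carrier_vec n" using w W by (auto simp: linear_subspace_def)
    define C where "C = mat n (Suc m) (\<lambda>(i, j). if j < m then B $$ (i, j) else w $ i)"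
    have C: "C \<in> carrier_mat n (Suc m)" by (simp add: C_def)
    have Cv: "C *\<^sub>v c = B *\<^sub>v vec m (\<lambda>j. c $ j) + c $ m \<cdot>\<^sub>v w" if "c \<in> carrier_vec (Suc m)" for c
    proof (rule eq_vecI)
      fix i assume "i < dim_vec (B *\<^sub>v vec m (\<lambda>j. c $ j) + c $ m \<cdot>\<^sub>v w)"
      then have i: "i < n" using wc by simp
      then show "(C *\<^sub>v c) $ i = (B *\<^sub>v vec m (\<lambda>j. c $ j) + c $ m \<cdot>\<^sub>v w) $ i"
        using B(1) wc that
        by (auto simp: C_def scalar_prod_def intro!: sum.cong)
    qed (use wc in \<open>simp add: C_def\<close>)
    have "P (Suc m)"
      unfolding P_def
    proof (intro exI[of _ C] conjI ballI)
      show "injective_mat C"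
        unfolding injective_mat_def
      proof (intro ballI impI)
        fix c assume c: "c \<in> carrier_vec (dim_col C)" and z: "C *\<^sub>v c = 0\<^sub>v (dim_row C)"
        define c' where "c' = vec m (\<lambda>j. c $ j)"
        have c': "c' \<in> carrier_vec m" by (simp add: c'_def)
        have e: "B *\<^sub>v c' + c $ m \<cdot>\<^sub>v w = 0\<^sub>v n" using Cv c C z by (simp add: c'_def)
        have cm: "c $ m = 0"
        proof (rule ccontr)
          \<comment> \<open>Dividing the relation \<open>e\<close> by the last coefficient would
            place \<open>w\<close> in the range of \<open>B\<close>.\<close>
          assume nz: "c $ m \<noteq> 0"
          have "B *\<^sub>v ((- inverse (c $ m)) \<cdot>\<^sub>v c') = (- inverse (c $ m)) \<cdot>\<^sub>v (B *\<^sub>v c')"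
            by (rule mult_mat_vec[OF B(1) c'])
          also have "\<dots> = w"
          proof (rule eq_vecI)
            fix i assume i: "i < dim_vec w"
            then have "(B *\<^sub>v c' + c $ m \<cdot>\<^sub>v w) $ i = 0" using wc by (simp add: e)
            then have "(B *\<^sub>v c') $ i = - (c $ m * w $ i)" using i wc B(1) c' by (simp add: eq_neg_iff_add_eq_0)
            then show "((- inverse (c $ m)) \<cdot>\<^sub>v (B *\<^sub>v c')) $ i = w $ i"
              using i wc B(1) nz by simp
          qed (use wc B(1) in auto)
          finally have "w \<in> (\<lambda>c. B *\<^sub>v c) ` carrier_vec m"
            using c' by (intro image_eqI[of _ _ "(- inverse (c $ m)) \<cdot>\<^sub>v c'"]) auto
          then show False using nr by simp
        qed
        have "B *\<^sub>v c' = 0\<^sub>v n"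
        proof (rule eq_vecI)
          fix i assume i: "i < dim_vec (0\<^sub>v n :: complex vec)"
          then have "(B *\<^sub>v c' + c $ m \<cdot>\<^sub>v w) $ i = 0" by (simp add: e)
          then show "(B *\<^sub>v c') $ i = (0\<^sub>v n) $ i" using i wc cm B(1) by simp
        qed (use B(1) in auto)
        then have "c' = 0\<^sub>v m" using injective_matD[OF B(2,1) c'] by simp
        then have "c $ j = 0" if "j < m" for j
          using that by (metis c'_def index_vec index_zero_vec(1))
        then show "c = 0\<^sub>v (dim_col C)"
          using c C cm by (intro eq_vecI) (auto simp: less_Suc_eq)
      qed
      fix c :: "complex vec" assume "c \<in> carrier_vec (Suc m)"
      moreover have "B *\<^sub>v vec m (\<lambda>j. c $ j) \<in> W" by (rule B(3)) simp
      ultimately show "C *\<^sub>v c \<in> W" using W w by (simp add: Cv linear_subspace_def)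
    qed (rule C)
    then show False using m(2) by fastforce
  qed
  then have "(\<lambda>c. B *\<^sub>v c) ` carrier_vec m = W" using B(3) by auto
  then show ?thesis using B bnd m by blast
qed

text \<open>The columns of \<open>B\<close> are a basis of \<open>W\<close>. Stability lets each
  transformed basis vector be solved for in this basis, and the solutions are the columns of
  \<open>\<sigma> g\<close>. Cancelling the injective \<open>B\<close> transfers the homomorphism
  laws from \<open>\<rho>\<close> to \<open>\<sigma>\<close>.\<close>

lemma subrepresentation:
  assumes G: "group G" and \<rho>: "\<rho> \<in> hom G (general_linear n)"
    and W: "linear_subspace n W" and stable: "\<And>g w. g \<in> carrier G \<Longrightarrow> w \<in> W \<Longrightarrow> \<rho> g *\<^sub>v w \<in> W"
    and W0: "W \<noteq> {0\<^sub>v n}"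
  shows "\<exists>m B \<sigma>. 0 < m \<and> m \<le> n \<and> (W \<noteq> carrier_vec n \<longrightarrow> m < n) \<and> B \<in> carrier_mat n m \<and> injective_mat B \<and>
    (\<lambda>c. B *\<^sub>v c) ` carrier_vec m = W \<and> \<sigma> \<in> hom G (general_linear m) \<and>
    (\<forall>g\<in>carrier G. \<rho> g * B = B * \<sigma> g)"
proof -
  interpret G: group G by fact
  have \<rho>c: "\<And>g. g \<in> carrier G \<Longrightarrow> \<rho> g \<in> carrier_mat n n"
    and \<rho>m: "\<And>g h. g \<in> carrier G \<Longrightarrow> h \<in> carrier G \<Longrightarrow> \<rho> (g \<otimes>\<^bsub>G\<^esub> h) = \<rho> g * \<rho> h"
    and \<rho>1: "\<rho> \<one>\<^bsub>G\<^esub> = 1\<^sub>m n"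
    using \<rho> hom_general_linear_iff[OF G] by auto
  obtain m B where B: "m \<le> n" "B \<in> carrier_mat n m" "injective_mat B"
    "(\<lambda>c. B *\<^sub>v c) ` carrier_vec m = W"
    using linear_subspace_basis[OF W] by blast
  have m0: "0 < m"
  proof (rule ccontr)
    assume "\<not> 0 < m"
    then have "B *\<^sub>v c = 0\<^sub>v n" if "c \<in> carrier_vec m" for c
      using that B(2) by (intro eq_vecI) (auto simp: scalar_prod_def)
    then have "W \<subseteq> {0\<^sub>v n}" using B(4) by auto
    then show False using W W0 by (auto simp: linear_subspace_def)
  qed
  have mn: "m < n" if "W \<noteq> carrier_vec n"
  proof (rule ccontr)
    assume "\<not> m < n"
    then have "m = n" using B(1) by simp
    then have "carrier_vec n \<subseteq> W"
      using injective_square_mat_range[of B n] B by force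
    then show False using W that by (auto simp: linear_subspace_def)
  qed
  have "\<forall>g\<in>carrier G. \<forall>j<m. \<exists>c\<in>carrier_vec m. B *\<^sub>v c = \<rho> g *\<^sub>v col B j"
  proof (intro ballI allI impI)
    fix g j assume g: "g \<in> carrier G" and j: "j < m"
    have "B *\<^sub>v unit_vec m j \<in> W" using B(4) by auto
    moreover have "B *\<^sub>v unit_vec m j = col B j"
      using B(2) j by (intro eq_vecI) auto
    ultimately have "\<rho> g *\<^sub>v col B j \<in> W" using stable g by simp
    then have "\<rho> g *\<^sub>v col B j \<in> (\<lambda>c. B *\<^sub>v c) ` carrier_vec m" using B(4) by simp
    then show "\<exists>c\<in>carrier_vec m. B *\<^sub>v c = \<rho> g *\<^sub>v col B j" by (auto simp del: mult_mat_vec_def)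
  qed
  then obtain s where s: "\<And>g j. g \<in> carrier G \<Longrightarrow> j < m \<Longrightarrow> s g j \<in> carrier_vec m"
    "\<And>g j. g \<in> carrier G \<Longrightarrow> j < m \<Longrightarrow> B *\<^sub>v s g j = \<rho> g *\<^sub>v col B j"
    by metis
  define \<sigma> where "\<sigma> g = mat m m (\<lambda>(i, j). s g j $ i)" for g
  have \<sigma>c: "\<sigma> g \<in> carrier_mat m m" for g by (simp add: \<sigma>_def)
  have inter: "\<rho> g * B = B * \<sigma> g" if g: "g \<in> carrier G" for g
  proof (rule eq_matI)
    fix i j assume "i < dim_row (B * \<sigma> g)" "j < dim_col (B * \<sigma> g)"
    then have ij: "i < n" "j < m" using B(2) by (auto simp: \<sigma>_def)
    have "col (\<sigma> g) j = s g j" using s(1)[OF g ij(2)] ij by (intro eq_vecI) (auto simp: \<sigma>_def)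
    then have "(B * \<sigma> g) $$ (i, j) = (B *\<^sub>v s g j) $ i" using B(2) \<sigma>c[of g] ij by simp
    also have "\<dots> = (\<rho> g *\<^sub>v col B j) $ i" using s(2)[OF g ij(2)] by simp
    also have "\<dots> = (\<rho> g * B) $$ (i, j)" using B(2) \<rho>c[OF g] ij by simp
    finally show "(\<rho> g * B) $$ (i, j) = (B * \<sigma> g) $$ (i, j)" by simp
  qed (use B(2) \<rho>c[OF g] in \<open>auto simp: \<sigma>_def\<close>)
  have cancel: "C = D" if C: "C \<in> carrier_mat m m" "D \<in> carrier_mat m m" and eq: "B * C = B * D" for C D
  proof (rule eq_mat_of_mult_vec[OF C])
    fix v :: "complex vec" assume v: "v \<in> carrier_vec m"
    have "B *\<^sub>v (C *\<^sub>v v) = (B * C) *\<^sub>v v"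
      by (rule assoc_mult_mat_vec[symmetric, OF B(2) C(1) v])
    also have "\<dots> = B *\<^sub>v (D *\<^sub>v v)"
      unfolding eq by (rule assoc_mult_mat_vec[OF B(2) C(2) v])
    finally show "C *\<^sub>v v = D *\<^sub>v v"
      by (rule injective_mat_cancel[OF B(3,2) mult_mat_vec_carrier[OF C(1) v] mult_mat_vec_carrier[OF C(2) v]])
  qed
  have "\<sigma> \<in> hom G (general_linear m)"
    unfolding hom_general_linear_iff[OF G]
  proof (intro conjI ballI)
    show "\<sigma> g \<in> carrier_mat m m" for g by (rule \<sigma>c)
    fix g h assume gh: "g \<in> carrier G" "h \<in> carrier G"
    have "B * (\<sigma> g * \<sigma> h) = (B * \<sigma> g) * \<sigma> h"
      by (rule assoc_mult_mat[symmetric, OF B(2) \<sigma>c \<sigma>c])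
    also have "\<dots> = (\<rho> g * B) * \<sigma> h" using inter[OF gh(1)] by simp
    also have "\<dots> = \<rho> g * (B * \<sigma> h)" by (rule assoc_mult_mat[OF \<rho>c[OF gh(1)] B(2) \<sigma>c])
    also have "\<dots> = \<rho> g * (\<rho> h * B)" using inter[OF gh(2)] by simp
    also have "\<dots> = (\<rho> g * \<rho> h) * B"
      by (rule assoc_mult_mat[symmetric, OF \<rho>c[OF gh(1)] \<rho>c[OF gh(2)] B(2)])
    also have "\<dots> = B * \<sigma> (g \<otimes>\<^bsub>G\<^esub> h)" using inter[of "g \<otimes>\<^bsub>G\<^esub> h"] \<rho>m[OF gh] gh by simp
    finally show "\<sigma> (g \<otimes>\<^bsub>G\<^esub> h) = \<sigma> g * \<sigma> h"
      using cancel[of "\<sigma> g * \<sigma> h" "\<sigma> (g \<otimes>\<^bsub>G\<^esub> h)"] \<sigma>c mult_carrier_mat[OF \<sigma>c[of g] \<sigma>c[of h]] by simp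
  next
    have "B * \<sigma> \<one>\<^bsub>G\<^esub> = B * 1\<^sub>m m"
      using inter[OF G.one_closed] \<rho>1 B(2) by simp
    then show "\<sigma> \<one>\<^bsub>G\<^esub> = 1\<^sub>m m" using cancel[OF \<sigma>c] by simp
  qed
  then show ?thesis using B m0 mn inter by blast
qed

section \<open>Averages over normal subgroups and the identity in the group algebra\<close>

lemma (in subgroup) bij_betw_left_mult:
  assumes "group G" "g \<in> H"
  shows "bij_betw (\<lambda>h. g \<otimes> h) H H"
proof -
  interpret group G by fact
  show ?thesis
    using assms(2)
    by (intro bij_betw_byWitness[where f' = "\<lambda>h. inv g \<otimes> h"]) (auto simp: m_assoc[symmetric])
qed

text \<open>The vectors fixed by a normal subgroup form a subrepresentation, so all vectors or only
  0 are fixed. In the first case \<open>H\<close> lies in the kernel. In the second the sum is zero,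
  because its range consists of fixed vectors.\<close>

lemma irreducible_rep_sum_normal:
  assumes G: "group G" "finite (carrier G)" and irr: "irreducible_rep G n \<rho>" and N: "H \<lhd> G"
    and i: "i < n" and j: "j < n"
  shows "(\<Sum>h\<in>H. \<rho> h $$ (i, j)) =
    (if H \<subseteq> kernel G (general_linear n) \<rho> then of_nat (card H) * (if i = j then 1 else 0) else 0)"
proof -
  interpret N: normal H G by fact
  have hom: "\<rho> \<in> hom G (general_linear n)" using irr by (simp add: irreducible_rep_def)
  have \<rho>c: "\<And>g. g \<in> carrier G \<Longrightarrow> \<rho> g \<in> carrier_mat n n"
    and \<rho>m: "\<And>g h. g \<in> carrier G \<Longrightarrow> h \<in> carrier G \<Longrightarrow> \<rho> (g \<otimes>\<^bsub>G\<^esub> h) = \<rho> g * \<rho> h"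
    and \<rho>1: "\<rho> \<one>\<^bsub>G\<^esub> = 1\<^sub>m n"
    using hom hom_general_linear_iff[OF G(1)] by auto
  have one: "\<one>\<^bsub>general_linear n\<^esub> = 1\<^sub>m n"
    by (simp add: general_linear_def units_of_one ring_mat_simps)
  show ?thesis
  proof (cases "H \<subseteq> kernel G (general_linear n) \<rho>")
    case True
    then have "\<rho> h $$ (i, j) = (if i = j then 1 else 0)" if "h \<in> H" for h
      using that i j by (auto simp: kernel_def one)
    then show ?thesis using True by simp
  next
    case False
    define W where "W = {w \<in> carrier_vec n. \<forall>h\<in>H. \<rho> h *\<^sub>v w = w}"
    have lin: "linear_subspace n W"
      unfolding linear_subspace_def
    proof (intro conjI ballI allI)
      show "W \<subseteq> carrier_vec n" by (auto simp: W_def)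
      have "\<rho> h *\<^sub>v 0\<^sub>v n = 0\<^sub>v n" if "h \<in> H" for h
        using \<rho>c[OF N.mem_carrier[OF that]] by (intro eq_vecI) auto
      then show "0\<^sub>v n \<in> W" by (auto simp: W_def)
      show "v + w \<in> W" if "v \<in> W" "w \<in> W" for v w
        using that mult_add_distrib_mat_vec[OF \<rho>c[OF N.mem_carrier], of _ v w] by (auto simp: W_def)
      show "c \<cdot>\<^sub>v w \<in> W" if "w \<in> W" for c w
        using that mult_mat_vec[OF \<rho>c[OF N.mem_carrier], of _ w c] by (auto simp: W_def)
    qed
    have stable: "\<rho> g *\<^sub>v w \<in> W" if g: "g \<in> carrier G" and w: "w \<in> W" for g w
    proof -
      have wc: "w \<in> carrier_vec n" using w by (simp add: W_def)
      have "\<rho> h *\<^sub>v (\<rho> g *\<^sub>v w) = \<rho> g *\<^sub>v w" if h: "h \<in> H" for h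
      proof -
        have hc: "h \<in> carrier G" using h by simp
        \<comment> \<open>Normality enters here: \<open>h\<close> moves past \<open>g\<close> at the
          cost of a conjugate that is again in \<open>H\<close>.\<close>
        define k where "k = inv\<^bsub>G\<^esub> g \<otimes>\<^bsub>G\<^esub> h \<otimes>\<^bsub>G\<^esub> g"
        have k: "k \<in> H" unfolding k_def by (rule N.inv_op_closed1[OF g h])
        have e: "h \<otimes>\<^bsub>G\<^esub> g = g \<otimes>\<^bsub>G\<^esub> k"
          using g hc by (simp add: k_def N.m_assoc[symmetric])
        have "\<rho> h *\<^sub>v (\<rho> g *\<^sub>v w) = \<rho> (h \<otimes>\<^bsub>G\<^esub> g) *\<^sub>v w"
          unfolding \<rho>m[OF hc g] by (rule assoc_mult_mat_vec[symmetric, OF \<rho>c[OF hc] \<rho>c[OF g] wc])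
        also have "\<dots> = \<rho> g *\<^sub>v (\<rho> k *\<^sub>v w)"
          unfolding e \<rho>m[OF g N.mem_carrier[OF k]]
          by (rule assoc_mult_mat_vec[OF \<rho>c[OF g] \<rho>c[OF N.mem_carrier[OF k]] wc])
        also have "\<rho> k *\<^sub>v w = w" using w k by (simp add: W_def)
        finally show ?thesis .
      qed
      then show ?thesis using mult_mat_vec_carrier[OF \<rho>c[OF g] wc] by (simp add: W_def)
    qed
    have "W = {0\<^sub>v n} \<or> W = carrier_vec n"
      using irr lin stable by (auto simp: irreducible_rep_def subspace_module_vec_iff)
    moreover have "W \<noteq> carrier_vec n"
    proof
      assume W: "W = carrier_vec n"
      have "\<rho> h = 1\<^sub>m n" if h: "h \<in> H" for h
      proof (rule eq_mat_of_mult_vec[OF \<rho>c[OF N.mem_carrier[OF h]] one_carrier_mat])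
        fix v :: "complex vec" assume v: "v \<in> carrier_vec n"
        then have "v \<in> W" using W by simp
        then show "\<rho> h *\<^sub>v v = 1\<^sub>m n *\<^sub>v v" using h v by (simp add: W_def)
      qed
      then show False using False by (auto simp: kernel_def one)
    qed
    ultimately have W: "W = {0\<^sub>v n}" by simp
    define S where "S = mat n n (\<lambda>(i, j). \<Sum>h\<in>H. \<rho> h $$ (i, j))"
    have S: "S \<in> carrier_mat n n" by (simp add: S_def)
    \<comment> \<open>Left multiplication by \<open>g\<close> permutes the summands, so the range of
      \<open>S\<close> consists of fixed vectors.\<close>
    have gS: "\<rho> g * S = S" if g: "g \<in> H" for g
    proof (rule eq_matI)
      fix i j assume "i < dim_row S" "j < dim_col S"
      then have ij: "i < n" "j < n" by (auto simp: S_def)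
      have gc: "g \<in> carrier G" using g by simp
      have "(\<rho> g * S) $$ (i, j) = (\<Sum>k<n. \<Sum>h\<in>H. \<rho> g $$ (i, k) * \<rho> h $$ (k, j))"
        unfolding mult_mat_entry[OF \<rho>c[OF gc] S ij] using ij by (simp add: S_def sum_distrib_left)
      also have "\<dots> = (\<Sum>h\<in>H. \<rho> (g \<otimes>\<^bsub>G\<^esub> h) $$ (i, j))"
        by (subst sum.swap) (auto simp: \<rho>m[OF gc] mult_mat_entry[OF \<rho>c[OF gc] \<rho>c ij]
            simp del: index_mult_mat intro!: sum.cong)
      also have "\<dots> = (\<Sum>h\<in>H. \<rho> h $$ (i, j))"
        by (rule sum.reindex_bij_betw[OF N.bij_betw_left_mult[OF G(1) g]])
      finally show "(\<rho> g * S) $$ (i, j) = S $$ (i, j)" using ij by (simp add: S_def)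
    qed (use \<rho>c[OF N.mem_carrier[OF g]] S in auto)
    have "S = 0\<^sub>m n n"
    proof (rule eq_mat_of_mult_vec[OF S zero_carrier_mat])
      fix v :: "complex vec" assume v: "v \<in> carrier_vec n"
      have "\<rho> g *\<^sub>v (S *\<^sub>v v) = S *\<^sub>v v" if g: "g \<in> H" for g
        using assoc_mult_mat_vec[OF \<rho>c[OF N.mem_carrier[OF g]] S v] unfolding gS[OF g] by (rule sym)
      then have "S *\<^sub>v v \<in> W" using mult_mat_vec_carrier[OF S v] by (simp add: W_def)
      then have "S *\<^sub>v v = 0\<^sub>v n" using W by simp
      also have "\<dots> = 0\<^sub>m n n *\<^sub>v v" using v by (intro eq_vecI) auto
      finally show "S *\<^sub>v v = 0\<^sub>m n n *\<^sub>v v" .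
    qed
    then have "S $$ (i, j) = 0" using i j by simp
    then show ?thesis using False i j by (simp add: S_def)
  qed
qed

lemma irr_kernel_normal:
  assumes G: "group G" and H: "H \<in> irr_kernels G"
  shows "H \<lhd> G"
proof -
  interpret R: ring "ring_mat TYPE(complex) n ()" for n by (rule ring_mat)
  obtain n \<rho> where H: "H = kernel G (general_linear n) \<rho>" and irr: "irreducible_rep G n \<rho>"
    using H by (auto simp: irr_kernels_def)
  interpret group_hom G "general_linear n" \<rho>
    using irr G R.units_group
    by (simp add: group_hom_def group_hom_axioms_def general_linear_def irreducible_rep_def)
  show ?thesis unfolding H by (rule normal_kernel)
qed

lemma finite_irr_kernels:
  assumes "finite (carrier G)"
  shows "finite (irr_kernels G)"
  by (rule finite_subset[of _ "Pow (carrier G)"]) (use assms in \<open>auto simp: irr_kernels_def kernel_def\<close>)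

text \<open>
  On the regular representation \<open>z\<close> acts by a Hermitian matrix \<open>Z\<close> commuting with the action. If
  \<open>Z \<noteq> 0\<close>, then its range contains an irreducible subrepresentation, on which \<open>Z\<close> vanishes; but a
  Hermitian matrix is injective on its range.
\<close>

lemma class_function_eq_0:
  fixes z :: "'g \<Rightarrow> complex"
  assumes G: "group G" "finite (carrier G)"
    and comm: "\<And>g h. g \<in> carrier G \<Longrightarrow> h \<in> carrier G \<Longrightarrow> z (g \<otimes>\<^bsub>G\<^esub> h) = z (h \<otimes>\<^bsub>G\<^esub> g)"
    and herm: "\<And>g. g \<in> carrier G \<Longrightarrow> z (inv\<^bsub>G\<^esub> g) = cnj (z g)"
    and kill: "\<And>n \<rho> i j. irreducible_rep G n \<rho> \<Longrightarrow> i < n \<Longrightarrow> j < n \<Longrightarrow>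
      (\<Sum>g\<in>carrier G. z g * \<rho> g $$ (i, j)) = 0"
    and g: "g \<in> carrier G"
  shows "z g = 0"
proof (rule ccontr)
  assume zg: "z g \<noteq> 0"
  interpret G: group G by fact
  obtain gs where gs: "set gs = carrier G" "distinct gs" using finite_distinct_list[OF G(2)] by blast
  define N where "N = length gs"
  have gsc: "gs ! i \<in> carrier G" if "i < N" for i
    using nth_mem[of i gs] that unfolding gs(1) N_def .
  have sum_gs: "(\<Sum>k<N. f (gs ! k)) = (\<Sum>x\<in>carrier G. f x)" for f :: "'g \<Rightarrow> complex"
    unfolding N_def gs(1)[symmetric] by (rule sum.reindex_bij_betw[OF bij_betw_nth[OF gs(2) refl refl]])
  \<comment> \<open>The left regular representation by permutation matrices, with the basis
    enumerated by \<open>gs\<close>.\<close>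
  define R :: "'g \<Rightarrow> complex mat"
    where "R h = mat N N (\<lambda>(i, j). if h \<otimes>\<^bsub>G\<^esub> gs ! j = gs ! i then 1 else 0)" for h
  have R: "R h \<in> carrier_mat N N" for h by (simp add: R_def)
  have R_entry: "R h $$ (i, j) = (if h \<otimes>\<^bsub>G\<^esub> gs ! j = gs ! i then 1 else 0)" if "i < N" "j < N" for h i j
    using that by (simp add: R_def)
  have R_hom: "R \<in> hom G (general_linear N)"
    unfolding hom_general_linear_iff[OF G(1)]
  proof (intro conjI ballI)
    fix h k assume h: "h \<in> carrier G" and k: "k \<in> carrier G"
    show "R (h \<otimes>\<^bsub>G\<^esub> k) = R h * R k"
    proof (rule eq_matI)
      fix i j assume "i < dim_row (R h * R k)" "j < dim_col (R h * R k)"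
      then have ij: "i < N" "j < N" by (auto simp: R_def)
      have "(R h * R k) $$ (i, j) =
          (\<Sum>l<N. (if h \<otimes>\<^bsub>G\<^esub> gs ! l = gs ! i then 1 else 0) * (if k \<otimes>\<^bsub>G\<^esub> gs ! j = gs ! l then 1 else 0))"
        unfolding mult_mat_entry[OF R R ij] using ij by (intro sum.cong) (auto simp: R_entry)
      also have "\<dots> = (\<Sum>x\<in>carrier G. (if h \<otimes>\<^bsub>G\<^esub> x = gs ! i then 1 else 0) * (if k \<otimes>\<^bsub>G\<^esub> gs ! j = x then 1 else 0))"
        by (rule sum_gs)
      also have "\<dots> = (\<Sum>x\<in>carrier G. if k \<otimes>\<^bsub>G\<^esub> gs ! j = x then (if h \<otimes>\<^bsub>G\<^esub> x = gs ! i then 1 else 0) else 0)"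
        by (intro sum.cong) auto
      also have "\<dots> = (if h \<otimes>\<^bsub>G\<^esub> (k \<otimes>\<^bsub>G\<^esub> gs ! j) = gs ! i then 1 else 0)"
        using k gsc[OF ij(2)] G(2) by simp
      finally show "R (h \<otimes>\<^bsub>G\<^esub> k) $$ (i, j) = (R h * R k) $$ (i, j)"
        using ij h k gsc by (simp add: R_entry G.m_assoc)
    qed (auto simp: R_def)
  next
    show "R \<one>\<^bsub>G\<^esub> = 1\<^sub>m N"
    proof (rule eq_matI)
      fix i j assume "i < dim_row (1\<^sub>m N)" "j < dim_col (1\<^sub>m N)"
      then have ij: "i < N" "j < N" by auto
      have "gs ! j = gs ! i \<longleftrightarrow> i = j" using ij gs(2) by (auto simp: N_def nth_eq_iff_index_eq)
      then show "R \<one>\<^bsub>G\<^esub> $$ (i, j) = 1\<^sub>m N $$ (i, j)" using ij gsc by (simp add: R_entry)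
    qed (auto simp: R_def)
  qed (rule R)
  \<comment> \<open>The group algebra element with coefficients \<open>z\<close>, acting in the
    regular representation: only the quotient of the two group elements carries column
    \<open>j\<close> to row \<open>i\<close>.\<close>
  define Z where "Z = mat N N (\<lambda>(i, j). z (gs ! i \<otimes>\<^bsub>G\<^esub> inv\<^bsub>G\<^esub> (gs ! j)))"
  have Z: "Z \<in> carrier_mat N N" by (simp add: Z_def)
  have Z_entry: "Z $$ (i, j) = z (gs ! i \<otimes>\<^bsub>G\<^esub> inv\<^bsub>G\<^esub> (gs ! j))" if "i < N" "j < N" for i j
    using that by (simp add: Z_def)
  have Z_sum: "Z $$ (i, j) = (\<Sum>h\<in>carrier G. z h * R h $$ (i, j))" if ij: "i < N" "j < N" for i j
  proof -
    have eq: "h \<otimes>\<^bsub>G\<^esub> gs ! j = gs ! i \<longleftrightarrow> gs ! i \<otimes>\<^bsub>G\<^esub> inv\<^bsub>G\<^esub> (gs ! j) = h" if h: "h \<in> carrier G" for h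
      using G.inv_solve_right'[OF h gsc[OF ij(1)] gsc[OF ij(2)]] by auto
    have "(\<Sum>h\<in>carrier G. z h * R h $$ (i, j)) =
        (\<Sum>h\<in>carrier G. if gs ! i \<otimes>\<^bsub>G\<^esub> inv\<^bsub>G\<^esub> (gs ! j) = h then z h else 0)"
      using ij eq by (intro sum.cong) (auto simp: R_entry)
    also have "\<dots> = Z $$ (i, j)" using G(2) gsc ij by (simp add: Z_entry)
    finally show ?thesis by simp
  qed
  have Z_herm: "Z $$ (i, j) = cnj (Z $$ (j, i))" if "i < N" "j < N" for i j
    using herm[of "gs ! j \<otimes>\<^bsub>G\<^esub> inv\<^bsub>G\<^esub> (gs ! i)"] that gsc by (simp add: Z_entry G.inv_mult_group)
  have RZ: "R h * Z = Z * R h" if h: "h \<in> carrier G" for h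
  proof (rule eq_matI)
    fix i j assume "i < dim_row (Z * R h)" "j < dim_col (Z * R h)"
    then have ij: "i < N" "j < N" by (auto simp: Z_def R_def)
    note c = gsc[OF ij(1)] gsc[OF ij(2)]
    have e1: "h \<otimes>\<^bsub>G\<^esub> x = gs ! i \<longleftrightarrow> inv\<^bsub>G\<^esub> h \<otimes>\<^bsub>G\<^esub> gs ! i = x" if "x \<in> carrier G" for x
      using G.inv_solve_left'[OF that h c(1)] by auto
    have "(R h * Z) $$ (i, j) =
        (\<Sum>l<N. (if h \<otimes>\<^bsub>G\<^esub> gs ! l = gs ! i then 1 else 0) * z (gs ! l \<otimes>\<^bsub>G\<^esub> inv\<^bsub>G\<^esub> (gs ! j)))"
      unfolding mult_mat_entry[OF R Z ij] using ij by (intro sum.cong) (auto simp: R_entry Z_entry)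
    also have "\<dots> = (\<Sum>x\<in>carrier G. (if h \<otimes>\<^bsub>G\<^esub> x = gs ! i then 1 else 0) * z (x \<otimes>\<^bsub>G\<^esub> inv\<^bsub>G\<^esub> (gs ! j)))"
      by (rule sum_gs)
    also have "\<dots> = (\<Sum>x\<in>carrier G. if inv\<^bsub>G\<^esub> h \<otimes>\<^bsub>G\<^esub> gs ! i = x then z (x \<otimes>\<^bsub>G\<^esub> inv\<^bsub>G\<^esub> (gs ! j)) else 0)"
      using e1 by (intro sum.cong) auto
    also have "\<dots> = z (inv\<^bsub>G\<^esub> h \<otimes>\<^bsub>G\<^esub> (gs ! i \<otimes>\<^bsub>G\<^esub> inv\<^bsub>G\<^esub> (gs ! j)))"
      using G(2) h c by (simp add: G.m_assoc)
    \<comment> \<open>This exchange of factors is where \<open>z\<close> being a class function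
      makes \<open>Z\<close> commute with the action.\<close>
    also have "\<dots> = z ((gs ! i \<otimes>\<^bsub>G\<^esub> inv\<^bsub>G\<^esub> (gs ! j)) \<otimes>\<^bsub>G\<^esub> inv\<^bsub>G\<^esub> h)"
      using h c by (intro comm) auto
    also have "\<dots> = (\<Sum>x\<in>carrier G. if h \<otimes>\<^bsub>G\<^esub> gs ! j = x then z (gs ! i \<otimes>\<^bsub>G\<^esub> inv\<^bsub>G\<^esub> x) else 0)"
      using G(2) h c by (simp add: G.inv_mult_group G.m_assoc)
    also have "\<dots> = (\<Sum>x\<in>carrier G. z (gs ! i \<otimes>\<^bsub>G\<^esub> inv\<^bsub>G\<^esub> x) * (if h \<otimes>\<^bsub>G\<^esub> gs ! j = x then 1 else 0))"
      by (intro sum.cong) auto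
    also have "\<dots> = (\<Sum>l<N. z (gs ! i \<otimes>\<^bsub>G\<^esub> inv\<^bsub>G\<^esub> (gs ! l)) * (if h \<otimes>\<^bsub>G\<^esub> gs ! j = gs ! l then 1 else 0))"
      by (rule sum_gs[symmetric])
    also have "\<dots> = (Z * R h) $$ (i, j)"
      unfolding mult_mat_entry[OF Z R ij] using ij by (intro sum.cong) (auto simp: R_entry Z_entry)
    finally show "(R h * Z) $$ (i, j) = (Z * R h) $$ (i, j)" .
  qed (auto simp: R_def Z_def)
  define W where "W = (\<lambda>x. Z *\<^sub>v x) ` carrier_vec N"
  have W: "linear_subspace N W"
    unfolding linear_subspace_def
  proof (intro conjI ballI allI)
    show "W \<subseteq> carrier_vec N" using mult_mat_vec_carrier[OF Z] by (auto simp: W_def)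
    have "Z *\<^sub>v 0\<^sub>v N = 0\<^sub>v N" using Z by (intro eq_vecI) auto
    then show "0\<^sub>v N \<in> W" unfolding W_def by (intro image_eqI[of _ _ "0\<^sub>v N"]) auto
    fix v assume "v \<in> W"
    then obtain x where x: "v = Z *\<^sub>v x" "x \<in> carrier_vec N" by (auto simp: W_def)
    show "c \<cdot>\<^sub>v v \<in> W" for c
      unfolding W_def x(1) mult_mat_vec[OF Z x(2), symmetric] using x(2) by (intro imageI) auto
    fix w assume "w \<in> W"
    then obtain y where y: "w = Z *\<^sub>v y" "y \<in> carrier_vec N" by (auto simp: W_def)
    show "v + w \<in> W"
      unfolding W_def x(1) y(1) mult_add_distrib_mat_vec[OF Z x(2) y(2), symmetric]
      using x(2) y(2) by (intro imageI) auto
  qed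
  have stable: "R h *\<^sub>v w \<in> W" if h: "h \<in> carrier G" and w: "w \<in> W" for h w
  proof -
    obtain x where x: "w = Z *\<^sub>v x" "x \<in> carrier_vec N" using w by (auto simp: W_def)
    have "R h *\<^sub>v w = (R h * Z) *\<^sub>v x"
      unfolding x(1) by (rule assoc_mult_mat_vec[symmetric, OF R Z x(2)])
    also have "\<dots> = Z *\<^sub>v (R h *\<^sub>v x)" unfolding RZ[OF h] by (rule assoc_mult_mat_vec[OF Z R x(2)])
    finally show ?thesis using mult_mat_vec_carrier[OF R x(2)] by (auto simp: W_def)
  qed
  have W0: "W \<noteq> {0\<^sub>v N}"
  proof
    assume W0: "W = {0\<^sub>v N}"
    have "Z = 0\<^sub>m N N"
    proof (rule eq_mat_of_mult_vec[OF Z zero_carrier_mat])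
      fix v :: "complex vec" assume v: "v \<in> carrier_vec N"
      have "Z *\<^sub>v v \<in> W" using v by (auto simp: W_def)
      then have "Z *\<^sub>v v = 0\<^sub>v N" using W0 by simp
      also have "\<dots> = 0\<^sub>m N N *\<^sub>v v" using v by (intro eq_vecI) auto
      finally show "Z *\<^sub>v v = 0\<^sub>m N N *\<^sub>v v" .
    qed
    \<comment> \<open>The entry of \<open>Z\<close> in the row of \<open>g\<close> and the column of
      the unit is \<open>z g\<close>.\<close>
    moreover obtain i where i: "i < N" "gs ! i = g" using g gs(1) by (metis N_def in_set_conv_nth)
    moreover obtain j where j: "j < N" "gs ! j = \<one>\<^bsub>G\<^esub>"
      using G.one_closed gs(1) by (metis N_def in_set_conv_nth)
    ultimately have "z g = 0" using Z_entry[OF i(1) j(1)] g by simp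
    then show False using zg by simp
  qed
  \<comment> \<open>\<open>P m\<close> says that the range of \<open>Z\<close> contains an
    \<open>m\<close>-dimensional subrepresentation. One of least positive dimension is irreducible,
    since a proper nonzero subrepresentation with basis \<open>C\<close> would embed through
    \<open>B * C\<close>.\<close>
  define P where "P m \<longleftrightarrow> 0 < m \<and> (\<exists>B \<sigma>. B \<in> carrier_mat N m \<and> injective_mat B \<and>
    (\<forall>c\<in>carrier_vec m. B *\<^sub>v c \<in> W) \<and> \<sigma> \<in> hom G (general_linear m) \<and>
    (\<forall>h\<in>carrier G. R h * B = B * \<sigma> h))" for m
  have "\<exists>m. P m"
    using subrepresentation[OF G(1) R_hom W stable W0] unfolding P_def by blast
  define m where "m = (LEAST m. P m)"
  have "P m" using \<open>\<exists>m. P m\<close> unfolding m_def by (rule LeastI_ex)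
  then obtain B \<sigma> where m: "0 < m" and B: "B \<in> carrier_mat N m" and inj: "injective_mat B"
    and BW: "\<And>c. c \<in> carrier_vec m \<Longrightarrow> B *\<^sub>v c \<in> W"
    and \<sigma>: "\<sigma> \<in> hom G (general_linear m)"
    and inter: "\<And>h. h \<in> carrier G \<Longrightarrow> R h * B = B * \<sigma> h"
    by (auto simp: P_def)
  have \<sigma>c: "\<sigma> h \<in> carrier_mat m m" if "h \<in> carrier G" for h
    using \<sigma> that hom_general_linear_iff[OF G(1)] by blast
  have irr: "irreducible_rep G m \<sigma>"
    unfolding irreducible_rep_def subspace_module_vec_iff
  proof (intro conjI allI impI)
    fix U assume U: "linear_subspace m U" and Us: "\<forall>g\<in>carrier G. \<forall>w\<in>U. \<sigma> g *\<^sub>v w \<in> U"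
    show "U = {0\<^sub>v m} \<or> U = carrier_vec m"
    proof (rule ccontr)
      assume "\<not> (U = {0\<^sub>v m} \<or> U = carrier_vec m)"
      then obtain k C \<tau> where k: "0 < k" "k < m" and C: "C \<in> carrier_mat m k" "injective_mat C"
        and \<tau>: "\<tau> \<in> hom G (general_linear k)" and inter': "\<And>h. h \<in> carrier G \<Longrightarrow> \<sigma> h * C = C * \<tau> h"
        using subrepresentation[OF G(1) \<sigma> U] Us by metis
      have BC: "B * C \<in> carrier_mat N k" using B C by simp
      have BCv: "(B * C) *\<^sub>v c = B *\<^sub>v (C *\<^sub>v c)" if "c \<in> carrier_vec k" for c
        by (rule assoc_mult_mat_vec[OF B C(1) that])
      have "P k"
        unfolding P_def
      proof (intro conjI exI[of _ "B * C"] exI[of _ \<tau>] ballI k(1) BC \<tau>)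
        show "injective_mat (B * C)"
          unfolding injective_mat_def
        proof (intro ballI impI)
          fix c assume "c \<in> carrier_vec (dim_col (B * C))" and z0: "(B * C) *\<^sub>v c = 0\<^sub>v (dim_row (B * C))"
          then have c: "c \<in> carrier_vec k" using C by auto
          have "B *\<^sub>v (C *\<^sub>v c) = 0\<^sub>v N" using z0 B unfolding BCv[OF c] by simp
          then have "C *\<^sub>v c = 0\<^sub>v m" by (rule injective_matD[OF inj B mult_mat_vec_carrier[OF C(1) c]])
          then have "c = 0\<^sub>v k" by (rule injective_matD[OF C(2,1) c])
          then show "c = 0\<^sub>v (dim_col (B * C))" using C by simp
        qed
        show "(B * C) *\<^sub>v c \<in> W" if "c \<in> carrier_vec k" for c
          unfolding BCv[OF that] by (rule BW[OF mult_mat_vec_carrier[OF C(1) that]])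
        fix h assume h: "h \<in> carrier G"
        have \<tau>c: "\<tau> h \<in> carrier_mat k k" using \<tau> h hom_general_linear_iff[OF G(1)] by blast
        have "R h * (B * C) = (B * \<sigma> h) * C"
          unfolding inter[OF h, symmetric] by (rule assoc_mult_mat[symmetric, OF R B C(1)])
        also have "\<dots> = B * (C * \<tau> h)"
          unfolding inter'[OF h, symmetric] by (rule assoc_mult_mat[OF B \<sigma>c[OF h] C(1)])
        also have "\<dots> = (B * C) * \<tau> h" by (rule assoc_mult_mat[symmetric, OF B C(1) \<tau>c])
        finally show "R h * (B * C) = (B * C) * \<tau> h" .
      qed
      then show False using not_less_Least k(2) unfolding m_def by blast
    qed
  qed (use \<sigma> m in auto)
  \<comment> \<open>On this subrepresentation \<open>Z\<close> acts by the combination of the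
    \<open>\<sigma> h\<close> with coefficients \<open>z h\<close>, which \<open>kill\<close>
    annihilates.\<close>
  have ZB: "Z * B = 0\<^sub>m N m"
  proof (rule eq_matI)
    fix i j assume "i < dim_row (0\<^sub>m N m)" "j < dim_col (0\<^sub>m N m)"
    then have ij: "i < N" "j < m" by auto
    have "(Z * B) $$ (i, j) = (\<Sum>k<N. \<Sum>h\<in>carrier G. z h * (R h $$ (i, k) * B $$ (k, j)))"
      unfolding mult_mat_entry[OF Z B ij] using ij
      by (intro sum.cong) (auto simp: Z_sum sum_distrib_right mult.assoc)
    also have "\<dots> = (\<Sum>h\<in>carrier G. z h * (R h * B) $$ (i, j))"
      unfolding mult_mat_entry[OF R B ij] sum_distrib_left by (rule sum.swap)
    also have "\<dots> = (\<Sum>h\<in>carrier G. \<Sum>k<m. z h * (B $$ (i, k) * \<sigma> h $$ (k, j)))"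
    proof (intro sum.cong refl)
      fix h assume h: "h \<in> carrier G"
      show "z h * (R h * B) $$ (i, j) = (\<Sum>k<m. z h * (B $$ (i, k) * \<sigma> h $$ (k, j)))"
        unfolding inter[OF h] mult_mat_entry[OF B \<sigma>c[OF h] ij] by (rule sum_distrib_left)
    qed
    also have "\<dots> = (\<Sum>k<m. B $$ (i, k) * (\<Sum>h\<in>carrier G. z h * \<sigma> h $$ (k, j)))"
      unfolding sum_distrib_left by (subst sum.swap) (simp add: mult.left_commute)
    also have "\<dots> = 0" using kill[OF irr _ ij(2)] by simp
    finally show "(Z * B) $$ (i, j) = 0\<^sub>m N m $$ (i, j)" using ij by simp
  qed (use B Z in auto)
  define w where "w = B *\<^sub>v unit_vec m 0"
  have "w \<in> W" unfolding w_def by (rule BW) simp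
  then obtain x where x: "w = Z *\<^sub>v x" "x \<in> carrier_vec N" by (auto simp: W_def)
  have wc: "w \<in> carrier_vec N" unfolding x(1) by (rule mult_mat_vec_carrier[OF Z x(2)])
  have "Z *\<^sub>v w = (Z * B) *\<^sub>v unit_vec m 0"
    unfolding w_def by (rule assoc_mult_mat_vec[symmetric, OF Z B unit_vec_carrier])
  then have Zw: "Z *\<^sub>v w = 0\<^sub>v N" unfolding ZB by (intro eq_vecI) auto
  \<comment> \<open>With \<open>w = Z x\<close> and \<open>Z w = 0\<close>, the Hermitian property
    gives <w, w> = <Z x, w> = <x, Z w> = 0.\<close>
  have "(\<Sum>i<N. w $ i * cnj (w $ i)) = (\<Sum>i<N. \<Sum>k<N. Z $$ (i, k) * x $ k * cnj (w $ i))"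
    by (intro sum.cong) (auto simp: x(1) mult_mat_vec_entry[OF Z x(2)] sum_distrib_right simp del: index_mult_mat_vec)
  also have "\<dots> = (\<Sum>k<N. x $ k * cnj (\<Sum>i<N. Z $$ (k, i) * w $ i))"
    unfolding cnj_sum sum_distrib_left
    by (subst sum.swap, intro sum.cong refl) (simp add: Z_herm[symmetric] mult.left_commute mult.assoc)
  also have "\<dots> = (\<Sum>k<N. x $ k * cnj ((Z *\<^sub>v w) $ k))"
    by (intro sum.cong refl) (simp add: mult_mat_vec_entry[OF Z wc] del: index_mult_mat_vec)
  also have "\<dots> = 0" unfolding Zw by simp
  finally have "(\<Sum>i<N. w $ i * cnj (w $ i)) = 0" .
  then have "complex_of_real (\<Sum>i<N. (cmod (w $ i))\<^sup>2) = 0"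
    unfolding of_real_sum complex_norm_square .
  then have "(\<Sum>i<N. (cmod (w $ i))\<^sup>2) = 0" by (simp only: of_real_eq_0_iff)
  then have "w $ i = 0" if "i < N" for i using that by (simp add: sum_nonneg_eq_0_iff)
  then have "w = 0\<^sub>v N" using wc by (intro eq_vecI) auto
  then have "unit_vec m 0 = (0\<^sub>v m :: complex vec)"
    unfolding w_def by (rule injective_matD[OF inj B unit_vec_carrier])
  then show False using m by simp
qed

text \<open>This is the coefficient at \<open>g\<close> of the identity in the group algebra, as the
  average over \<open>H\<close> has coefficient \<open>1 / card H\<close> on \<open>H\<close>. The
  difference \<open>z\<close> of the two sides is a class function because kernels are normal, and
  Hermitian because they are closed under inverses and the weights are real.\<close>

theorem sum_moebius_irr_kernels:
  assumes G: "group G" "finite (carrier G)" and g: "g \<in> carrier G"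
  shows "(\<Sum>H\<in>{H \<in> irr_kernels G. g \<in> H}.
      of_int (- moebius (insert {} (irr_kernels G)) {} H) / of_nat (card H)) =
    (if g = \<one>\<^bsub>G\<^esub> then 1 else 0 :: complex)"
proof -
  interpret G: group G by fact
  let ?\<H> = "irr_kernels G"
  have fin: "finite ?\<H>" by (rule finite_irr_kernels[OF G(2)])
  have nrm: "H \<lhd> G" if "H \<in> ?\<H>" for H by (rule irr_kernel_normal[OF G(1) that])
  have sub: "subgroup H G" if "H \<in> ?\<H>" for H using nrm[OF that] by (rule normal_imp_subgroup)
  have Hc: "H \<subseteq> carrier G" if "H \<in> ?\<H>" for H using sub[OF that] by (rule subgroup.subset)
  have cH: "card H \<noteq> 0" if "H \<in> ?\<H>" for H
    using subgroup.one_closed[OF sub[OF that]] finite_subset[OF Hc[OF that] G(2)] by auto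
  define \<mu> where "\<mu> H = moebius (insert {} ?\<H>) {} H" for H
  define c :: "_ \<Rightarrow> complex" where "c H = of_int (- \<mu> H) / of_nat (card H)" for H
  define z where "z x = (if x = \<one>\<^bsub>G\<^esub> then 1 else 0) - (\<Sum>H\<in>?\<H>. if x \<in> H then c H else 0)" for x
  have "z g = 0"
  proof (rule class_function_eq_0[OF G _ _ _ g])
    fix x y assume xy: "x \<in> carrier G" "y \<in> carrier G"
    have "x \<otimes>\<^bsub>G\<^esub> y \<in> H \<longleftrightarrow> y \<otimes>\<^bsub>G\<^esub> x \<in> H" if H: "H \<in> ?\<H>" for H
    proof -
      interpret normal H G by (rule nrm[OF H])
      have "b \<otimes>\<^bsub>G\<^esub> a \<in> H" if "a \<otimes>\<^bsub>G\<^esub> b \<in> H" "a \<in> carrier G" "b \<in> carrier G" for a b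
        using inv_op_closed1[OF that(2) that(1)] that(2,3) by (simp add: G.m_assoc[symmetric])
      then show ?thesis using xy by blast
    qed
    moreover have "x \<otimes>\<^bsub>G\<^esub> y = \<one>\<^bsub>G\<^esub> \<longleftrightarrow> y \<otimes>\<^bsub>G\<^esub> x = \<one>\<^bsub>G\<^esub>" using xy G.inv_comm by blast
    ultimately show "z (x \<otimes>\<^bsub>G\<^esub> y) = z (y \<otimes>\<^bsub>G\<^esub> x)" by (auto simp: z_def intro!: sum.cong)
  next
    fix x assume x: "x \<in> carrier G"
    have "inv\<^bsub>G\<^esub> x \<in> H \<longleftrightarrow> x \<in> H" if H: "H \<in> ?\<H>" for H
      using subgroup.m_inv_closed[OF sub[OF H]] G.inv_inv[OF x] by metis
    moreover have "cnj (c H) = c H" for H by (simp add: c_def)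
    moreover have "inv\<^bsub>G\<^esub> x = \<one>\<^bsub>G\<^esub> \<longleftrightarrow> x = \<one>\<^bsub>G\<^esub>" using G.inv_eq_1_iff[OF x] .
    ultimately show "z (inv\<^bsub>G\<^esub> x) = cnj (z x)"
      by (auto simp: z_def if_distrib[of cnj] intro!: sum.cong)
  next
    fix n \<rho> i j assume irr: "irreducible_rep G n \<rho>" and ij: "i < n" "j < n"
    define K where "K = kernel G (general_linear n) \<rho>"
    have K: "K \<in> ?\<H>" using irr unfolding K_def irr_kernels_def by blast
    define \<delta> where "\<delta> = (if i = j then 1 else 0 :: complex)"
    have "\<rho> \<one>\<^bsub>G\<^esub> = 1\<^sub>m n"
      using irr hom_general_linear_iff[OF G(1)] by (simp add: irreducible_rep_def)
    then have \<rho>1: "\<rho> \<one>\<^bsub>G\<^esub> $$ (i, j) = \<delta>" using ij by (simp add: \<delta>_def)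
    have "(\<Sum>x\<in>carrier G. z x * \<rho> x $$ (i, j)) =
        (\<Sum>x\<in>carrier G. if x = \<one>\<^bsub>G\<^esub> then \<rho> x $$ (i, j) else 0) -
        (\<Sum>x\<in>carrier G. \<Sum>H\<in>?\<H>. if x \<in> H then c H * \<rho> x $$ (i, j) else 0)"
      unfolding sum_subtractf[symmetric] z_def left_diff_distrib sum_distrib_right
      by (intro sum.cong refl arg_cong2[where f = "(-)"]) auto
    also have "(\<Sum>x\<in>carrier G. if x = \<one>\<^bsub>G\<^esub> then \<rho> x $$ (i, j) else 0) = \<delta>"
      using G(2) \<rho>1 by simp
    also have "(\<Sum>x\<in>carrier G. \<Sum>H\<in>?\<H>. if x \<in> H then c H * \<rho> x $$ (i, j) else 0) =
        (\<Sum>H\<in>?\<H>. c H * (\<Sum>x\<in>H. \<rho> x $$ (i, j)))"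
    proof (subst sum.swap, intro sum.cong refl)
      fix H assume H: "H \<in> ?\<H>"
      have "(\<Sum>x\<in>carrier G. if x \<in> H then c H * \<rho> x $$ (i, j) else 0) =
          (\<Sum>x\<in>carrier G \<inter> H. c H * \<rho> x $$ (i, j))"
        by (rule sum.inter_restrict[symmetric, OF G(2)])
      also have "carrier G \<inter> H = H" using Hc[OF H] by auto
      finally show "(\<Sum>x\<in>carrier G. if x \<in> H then c H * \<rho> x $$ (i, j) else 0) =
          c H * (\<Sum>x\<in>H. \<rho> x $$ (i, j))"
        by (simp add: sum_distrib_left)
    qed
    also have "\<dots> = (\<Sum>H\<in>?\<H>. if H \<subseteq> K then - of_int (\<mu> H) * \<delta> else 0)"
    proof (intro sum.cong refl)
      fix H assume H: "H \<in> ?\<H>"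
      show "c H * (\<Sum>x\<in>H. \<rho> x $$ (i, j)) = (if H \<subseteq> K then - of_int (\<mu> H) * \<delta> else 0)"
        unfolding irreducible_rep_sum_normal[OF G irr nrm[OF H] ij]
        using cH[OF H] by (simp add: c_def K_def \<delta>_def)
    qed
    also have "\<dots> = (\<Sum>H\<in>{H \<in> ?\<H>. H \<subseteq> K}. - of_int (\<mu> H) * \<delta>)"
      by (rule sum.inter_filter[symmetric, OF fin])
    also have "\<dots> = - of_int (\<Sum>H\<in>{H \<in> ?\<H>. H \<subseteq> K}. \<mu> H) * \<delta>"
      by (simp add: sum_distrib_right sum_negf)
    also have "(\<Sum>H\<in>{H \<in> ?\<H>. H \<subseteq> K}. \<mu> H) = - 1"
      unfolding \<mu>_def by (rule sum_moebius_empty[OF fin _ K]) (use cH[of "{}"] in auto)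
    finally show "(\<Sum>x\<in>carrier G. z x * \<rho> x $$ (i, j)) = 0" by simp
  qed
  then have "(if g = \<one>\<^bsub>G\<^esub> then 1 else 0) = (\<Sum>H\<in>?\<H>. if g \<in> H then c H else 0)"
    by (simp add: z_def)
  also have "\<dots> = (\<Sum>H\<in>{H \<in> ?\<H>. g \<in> H}. c H)" by (rule sum.inter_filter[symmetric, OF fin])
  finally show ?thesis by (simp add: c_def \<mu>_def)
qed

section \<open>The matrix tree theorem\<close>

text \<open>The iteration does not stop at the root. For the choices of arcs below,
  \<open>h r\<close> is an arbitrary value, and only the first visit to \<open>r\<close>
  matters.\<close>

definition reaches :: "('a \<Rightarrow> 'a) \<Rightarrow> 'a \<Rightarrow> 'a \<Rightarrow> bool" where
  "reaches h r v \<longleftrightarrow> (\<exists>k. (h ^^ k) v = r)"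

definition depth :: "('a \<Rightarrow> 'a) \<Rightarrow> 'a \<Rightarrow> 'a \<Rightarrow> nat" where
  "depth h r v = (LEAST k. (h ^^ k) v = r)"

lemma reaches_root [simp]: "reaches h r r"
  unfolding reaches_def by (rule exI[of _ 0]) simp

lemma reaches_step_iff:
  assumes "v \<noteq> r"
  shows "reaches h r (h v) \<longleftrightarrow> reaches h r v"
proof
  assume "reaches h r (h v)"
  then obtain k where "(h ^^ k) (h v) = r" by (auto simp: reaches_def)
  then have "(h ^^ Suc k) v = r" by (simp add: funpow_swap1)
  then show "reaches h r v" unfolding reaches_def by blast
next
  assume "reaches h r v"
  then obtain k where k: "(h ^^ k) v = r" by (auto simp: reaches_def)
  then obtain l where "k = Suc l" using assms by (cases k) auto
  then have "(h ^^ l) (h v) = r" using k by (simp add: funpow_swap1)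
  then show "reaches h r (h v)" unfolding reaches_def by blast
qed

lemma depth_step:
  assumes "reaches h r v" "v \<noteq> r"
  shows "depth h r v = Suc (depth h r (h v))"
proof -
  obtain k where k: "(h ^^ k) v = r" using assms(1) by (auto simp: reaches_def)
  have "(LEAST k. (h ^^ k) v = r) = Suc (LEAST l. (h ^^ Suc l) v = r)"
    by (rule Least_Suc[where P = "\<lambda>k. (h ^^ k) v = r", OF k]) (use assms(2) in simp)
  then show ?thesis unfolding depth_def by (simp add: funpow_swap1)
qed

text \<open>Choose at each vertex the first arc of a shortest walk to \<open>r\<close>; each step
  then decreases the distance.\<close>

lemma (in wf_digraph) exists_reaching_choice:
  assumes r: "r \<in> verts G" and conn: "\<And>v. v \<in> verts G \<Longrightarrow> v \<rightarrow>\<^sup>* r"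
  shows "\<exists>f\<in>PiE (verts G - {r}) (out_arcs G). \<forall>v\<in>verts G. reaches (\<lambda>v. head G (f v)) r v"
proof -
  define d where "d v = (LEAST n. \<exists>p. awalk v p r \<and> length p = n)" for v
  have "\<exists>e\<in>out_arcs G v. d (head G e) < d v" if v: "v \<in> verts G" "v \<noteq> r" for v
  proof -
    have "\<exists>n. \<exists>p. awalk v p r \<and> length p = n" using conn[OF v(1)] by (auto simp: reachable_awalk)
    then have "\<exists>p. awalk v p r \<and> length p = d v" unfolding d_def by (rule LeastI_ex)
    then obtain p where p: "awalk v p r" "length p = d v" by blast
    then obtain e q where q: "p = e # q" using v(2) by (cases p) (auto simp: awalk_Nil_iff)
    have e: "e \<in> arcs G" "tail G e = v" "awalk (head G e) q r" using p(1) q by (auto simp: awalk_Cons_iff)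
    have "d (head G e) \<le> length q" unfolding d_def by (rule Least_le) (use e in blast)
    then show ?thesis using e p q by (intro bexI[of _ e]) auto
  qed
  then obtain c where c: "\<And>v. v \<in> verts G \<Longrightarrow> v \<noteq> r \<Longrightarrow> c v \<in> out_arcs G v \<and> d (head G (c v)) < d v"
    by metis
  define f where "f = restrict c (verts G - {r})"
  have "reaches (\<lambda>v. head G (f v)) r v" if "v \<in> verts G" for v
    using that
  proof (induction "d v" arbitrary: v rule: less_induct)
    case less
    show ?case
    proof (cases "v = r")
      case False
      have "reaches (\<lambda>v. head G (f v)) r (head G (f v))"
        using c[OF less.prems False] less.prems False by (intro less.hyps) (auto simp: f_def)
      then show ?thesis using reaches_step_iff[OF False] by metis
    qed simp
  qed
  moreover have "f \<in> PiE (verts G - {r}) (out_arcs G)" using c by (auto simp: f_def)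
  ultimately show ?thesis by blast
qed

text \<open>The last arc is followed by the first one, because the walk returns to its
  start.\<close>

lemma (in wf_digraph) awalk_closed_successor:
  assumes p: "awalk u p u" and e: "e \<in> set p"
  shows "\<exists>e'\<in>set p. tail G e' = head G e"
proof -
  obtain xs ys where xy: "p = xs @ e # ys" using e by (auto simp: in_set_conv_decomp)
  show ?thesis
  proof (cases ys)
    case Nil
    then have "head G e = u" using p xy by (auto simp: awalk_simps)
    moreover have "p \<noteq> []" using e by auto
    then have "tail G (hd p) = u" using p by (cases p) (auto simp: awalk_simps)
    moreover have "hd p \<in> set p" using xy by (intro hd_in_set) simp
    ultimately show ?thesis by auto
  next
    case (Cons a as)
    then have "tail G a = head G e" using p xy by (auto simp: awalk_simps)
    then show ?thesis using xy Cons by auto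
  qed
qed

text \<open>Of two different such arcs, the later one would lead back to the tail of the earlier
  one, a vertex already visited. This makes the closing of a path by an extra arc a circuit in the
  undirected sense.\<close>

lemma (in wf_digraph) apath_no_reverse:
  assumes p: "apath u p v" and a: "a \<in> set p" "b \<in> set p"
    and ab: "tail G b = head G a" "head G b = tail G a"
  shows "a = b"
proof (rule ccontr)
  assume ne: "a \<noteq> b"
  have False if dec: "p = xs @ c # ys" "d \<in> set ys" and cd: "head G d = tail G c" for xs ys c d
  proof -
    have "apath (awlast u xs) (c # ys) v" using p unfolding dec(1) apath_append_iff by blast
    then have "apath (head G c) ys v" "tail G c \<notin> set (awalk_verts (head G c) ys)"
      by (auto simp: apath_Cons_iff)
    then show False using awalk_verts_arc2[OF awalkI_apath dec(2)] cd by metis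
  qed note * = this
  obtain xs ys where xy: "p = xs @ a # ys" using a(1) by (auto simp: in_set_conv_decomp)
  have "b \<in> set xs \<or> b \<in> set ys" using a(2) xy ne by auto
  then show False
  proof
    assume "b \<in> set ys" then show False using *[OF xy, of b] ab by simp
  next
    assume "b \<in> set xs"
    then obtain us vs where "xs = us @ b # vs" by (auto simp: in_set_conv_decomp)
    then show False using *[of us b "vs @ a # ys" a] xy ab by simp
  qed
qed

lemma (in wf_digraph) symmetric_strongly_connected_imp_connected:
  assumes "symmetric G" "strongly_connected G"
  shows "connected G"
proof -
  have "arcs_ends G \<subseteq> (arcs_ends G)\<^sup>s" by (auto simp: symcl_def)
  then show ?thesis
    using assms unfolding connected_conv strongly_connected_def reachable_def
    by (meson rtrancl_on_mono subset_refl)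
qed

section \<open>Spanning trees as arborescences towards a root\<close>

locale finite_serre_graph = bidirected_digraph G arev + fin_digraph G for G arev
begin

definition arborescences :: "'a \<Rightarrow> ('a \<Rightarrow> 'b) set" where
  "arborescences r = {f \<in> PiE (verts G - {r}) (out_arcs G). \<forall>v\<in>verts G. reaches (\<lambda>v. head G (f v)) r v}"

definition arb_tree :: "'a \<Rightarrow> ('a \<Rightarrow> 'b) \<Rightarrow> ('a, 'b) pre_digraph" where
  "arb_tree r f = \<lparr>verts = verts G, arcs = f ` (verts G - {r}) \<union> arev ` f ` (verts G - {r}),
     tail = tail G, head = head G\<rparr>"

lemma arborescenceD:
  assumes "f \<in> arborescences r"
  shows "\<And>v. v \<in> verts G \<Longrightarrow> v \<noteq> r \<Longrightarrow> f v \<in> arcs G \<and> tail G (f v) = v"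
    and "\<And>v. v \<in> verts G \<Longrightarrow> reaches (\<lambda>v. head G (f v)) r v"
    and "\<And>v. v \<in> verts G \<Longrightarrow> v \<noteq> r \<Longrightarrow>
      depth (\<lambda>v. head G (f v)) r v = Suc (depth (\<lambda>v. head G (f v)) r (head G (f v)))"
proof -
  show 1: "f v \<in> arcs G \<and> tail G (f v) = v" if "v \<in> verts G" "v \<noteq> r" for v
    using assms that by (auto simp: arborescences_def PiE_iff)
  show 2: "reaches (\<lambda>v. head G (f v)) r v" if "v \<in> verts G" for v
    using assms that by (auto simp: arborescences_def)
  show "depth (\<lambda>v. head G (f v)) r v = Suc (depth (\<lambda>v. head G (f v)) r (head G (f v)))"
    if "v \<in> verts G" "v \<noteq> r" for v
    using depth_step[OF 2[OF that(1)] that(2)] .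
qed

lemma arb_tree_simps [simp]:
  "verts (arb_tree r f) = verts G" "tail (arb_tree r f) = tail G" "head (arb_tree r f) = head G"
  by (auto simp: arb_tree_def)

text \<open>The first case is an arc towards the root, along which the depth falls by one; the
  second is an arc away from it.\<close>

lemma arb_tree_arcs_cases:
  assumes "f \<in> arborescences r" "e \<in> arcs (arb_tree r f)"
  obtains "tail G e \<in> verts G" "tail G e \<noteq> r" "e = f (tail G e)"
  | "head G e \<in> verts G" "head G e \<noteq> r" "e = arev (f (head G e))"
proof -
  obtain x where x: "x \<in> verts G" "x \<noteq> r" "e = f x \<or> e = arev (f x)"
    using assms(2) by (auto simp: arb_tree_def)
  have fx: "f x \<in> arcs G" "tail G (f x) = x" using arborescenceD(1)[OF assms(1) x(1,2)] by auto
  from x(3) show ?thesis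
  proof
    assume "e = f x"
    then show ?thesis using x(1,2) fx by (intro that(1)) auto
  next
    assume "e = arev (f x)"
    then show ?thesis using x(1,2) fx by (intro that(2)) auto
  qed
qed

lemma arb_tree_arcs_subset:
  assumes "f \<in> arborescences r"
  shows "arcs (arb_tree r f) \<subseteq> arcs G"
proof
  fix e assume "e \<in> arcs (arb_tree r f)"
  then obtain x where x: "x \<in> verts G" "x \<noteq> r" "e = f x \<or> e = arev (f x)"
    by (auto simp: arb_tree_def)
  then show "e \<in> arcs G" using arborescenceD(1)[OF assms x(1,2)] by auto
qed

lemma arb_tree_wf:
  assumes "f \<in> arborescences r"
  shows "wf_digraph (arb_tree r f)"
  using arb_tree_arcs_subset[OF assms] by unfold_locales auto

lemma arb_tree_arev:
  assumes "e \<in> arcs (arb_tree r f)"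
  shows "arev e \<in> arcs (arb_tree r f)"
  using assms by (auto simp: arb_tree_def)

lemma arb_tree_symmetric:
  assumes f: "f \<in> arborescences r"
  shows "symmetric (arb_tree r f)"
  unfolding symmetric_conv
proof
  fix e assume e: "e \<in> arcs (arb_tree r f)"
  then have "e \<in> arcs G" using arb_tree_arcs_subset[OF f] by blast
  then show "\<exists>e2\<in>arcs (arb_tree r f). tail (arb_tree r f) e = head (arb_tree r f) e2 \<and>
      head (arb_tree r f) e = tail (arb_tree r f) e2"
    using arb_tree_arev[OF e] by (intro bexI[of _ "arev e"]) auto
qed

lemma arb_tree_strongly_connected:
  assumes f: "f \<in> arborescences r" and r: "r \<in> verts G"
  shows "strongly_connected (arb_tree r f)"
proof -
  interpret T: wf_digraph "arb_tree r f" by (rule arb_tree_wf[OF f])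
  have to_root: "v \<rightarrow>\<^sup>*\<^bsub>arb_tree r f\<^esub> r" if "v \<in> verts G" for v
    using that
  proof (induction "depth (\<lambda>v. head G (f v)) r v" arbitrary: v rule: less_induct)
    case less
    show ?case
    proof (cases "v = r")
      case True
      then show ?thesis using r by simp
    next
      case False
      note fv = arborescenceD(1)[OF f less.prems False]
      have "f v \<in> arcs (arb_tree r f)" using less.prems False by (auto simp: arb_tree_def)
      then have "v \<rightarrow>\<^bsub>arb_tree r f\<^esub> head G (f v)"
        using fv T.in_arcs_imp_in_arcs_ends[of "f v"] by simp
      moreover have "head G (f v) \<rightarrow>\<^sup>*\<^bsub>arb_tree r f\<^esub> r"
        using fv arborescenceD(3)[OF f less.prems False] by (intro less.hyps) auto
      ultimately show ?thesis by (rule T.adj_reachable_trans)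
    qed
  qed
  show ?thesis
  proof (rule strongly_connectedI)
    show "verts (arb_tree r f) \<noteq> {}" using r by auto
    fix u v assume "u \<in> verts (arb_tree r f)" "v \<in> verts (arb_tree r f)"
    then show "u \<rightarrow>\<^sup>*\<^bsub>arb_tree r f\<^esub> v"
      using to_root symmetric_reachable[OF arb_tree_symmetric[OF f] to_root[of v]]
      by (auto intro: T.reachable_trans)
  qed
qed

text \<open>At its deepest vertex a circuit would have to enter and leave by the same edge.\<close>

lemma arb_tree_no_circuit:
  assumes f: "f \<in> arborescences r"
  shows "\<not> circuit (arb_tree r f) arev p"
proof
  assume c: "circuit (arb_tree r f) arev p"
  interpret T: wf_digraph "arb_tree r f" by (rule arb_tree_wf[OF f])
  let ?d = "depth (\<lambda>v. head G (f v)) r"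
  obtain u where u: "T.awalk u p u" "p \<noteq> []" and rev: "\<And>e. e \<in> set p \<Longrightarrow> arev e \<notin> set p"
    using c by (auto simp: circuit_def T.cycle_def)
  have pT: "set p \<subseteq> arcs (arb_tree r f)" using u(1) by (simp add: T.awalk_def)
  have "Max ((\<lambda>e. ?d (head G e)) ` set p) \<in> (\<lambda>e. ?d (head G e)) ` set p"
    using u(2) by (intro Max_in) auto
  then obtain e where e: "e \<in> set p" "?d (head G e) = Max ((\<lambda>e. ?d (head G e)) ` set p)" by force
  have mx: "?d (head G a) \<le> ?d (head G e)" if "a \<in> set p" for a
    unfolding e(2) using that by (intro Max_ge) auto
  obtain e' where e': "e' \<in> set p" "tail G e' = head G e"
    using T.awalk_closed_successor[OF u(1) e(1)] by auto
  have "\<exists>a\<in>set p. head G a = tail G e"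
  proof -
    obtain xs ys where xy: "p = xs @ e # ys" using e(1) by (auto simp: in_set_conv_decomp)
    show ?thesis
    proof (cases xs rule: rev_cases)
      case Nil
      then have "tail G e = u" using u(1) xy by (auto simp: T.awalk_simps)
      moreover have "head G (last p) = u"
        using u by (cases p rule: rev_cases) (auto simp: T.awalk_simps)
      ultimately show ?thesis using u(2) by auto
    next
      case (snoc zs b)
      then have "head G b = tail G e" using u(1) xy by (auto simp: T.awalk_simps)
      then show ?thesis using xy snoc by auto
    qed
  qed
  then have dt: "?d (tail G e) \<le> ?d (head G e)" using mx by metis
  have eT: "e \<in> arcs (arb_tree r f)" "e' \<in> arcs (arb_tree r f)" using pT e e' by auto
  \<comment> \<open>An arc towards the root would start deeper than it ends, contrary to
    \<open>dt\<close>; hence \<open>e\<close> points away from the root.\<close>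
  have er: "e = arev (f (head G e))" "head G e \<in> verts G" "head G e \<noteq> r"
  proof -
    show "e = arev (f (head G e))" "head G e \<in> verts G" "head G e \<noteq> r"
      using arb_tree_arcs_cases[OF f eT(1)] arborescenceD(3)[OF f] dt
      by (metis Suc_n_not_le_n)+
  qed
  \<comment> \<open>If \<open>e'\<close> also pointed away from the root, its head would be deeper
    than the maximum.\<close>
  have "e' = f (head G e)"
    using arb_tree_arcs_cases[OF f eT(2)]
  proof cases
    case 1
    then show ?thesis using e' by simp
  next
    case 2
    have "head G (f (head G e')) = tail G e'"
      using 2 arborescenceD(1)[OF f 2(1,2)] by (metis tail_arev)
    then have "?d (head G e') = Suc (?d (head G e))"
      using arborescenceD(3)[OF f 2(1,2)] e'(2) by simp
    then show ?thesis using mx[OF e'(1)] by simp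
  qed
  then have "arev e' = e" using er(1) by simp
  then show False using rev[OF e'(1)] e(1) by simp
qed

lemma arb_tree_spanning_tree:
  assumes f: "f \<in> arborescences r" and r: "r \<in> verts G"
  shows "arb_tree r f \<in> serre_spanning_trees G arev"
proof -
  interpret T: wf_digraph "arb_tree r f" by (rule arb_tree_wf[OF f])
  have "connected (arb_tree r f)"
    using arb_tree_symmetric[OF f] arb_tree_strongly_connected[OF f r]
    by (rule T.symmetric_strongly_connected_imp_connected)
  then show ?thesis
    using arb_tree_no_circuit[OF f] arb_tree_arcs_subset[OF f] arb_tree_arev[of _ r f]
    by (auto simp: serre_spanning_trees_def serre_tree_def spanning_def subgraph_def compatible_def
        wf_digraph T.wf_digraph)
qed

text \<open>At a deepest vertex \<open>v\<close> of disagreement, measured by \<open>f\<close>, the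
  arc \<open>g v\<close> lies in the tree of \<open>f\<close> and must be the reverse of some
  \<open>f w\<close>. As \<open>w\<close> is deeper than \<open>v\<close>, the choices agree at
  \<open>w\<close>, so \<open>g\<close> leads from \<open>v\<close> to \<open>w\<close> and back and
  cannot reach the root.\<close>

lemma inj_on_arb_tree: "inj_on (arb_tree r) (arborescences r)"
proof (rule inj_onI, rule ccontr)
  fix f g assume f: "f \<in> arborescences r" and g: "g \<in> arborescences r"
    and eq: "arb_tree r f = arb_tree r g" and ne: "f \<noteq> g"
  let ?d = "depth (\<lambda>v. head G (f v)) r"
  define D where "D = {v \<in> verts G - {r}. f v \<noteq> g v}"
  have ext: "f \<in> extensional (verts G - {r})" "g \<in> extensional (verts G - {r})"
    using f g by (auto simp: arborescences_def PiE_def)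
  have "D \<noteq> {}" using ne extensionalityI[OF ext] by (auto simp: D_def)
  moreover have "finite D" by (simp add: D_def)
  ultimately have "Max (?d ` D) \<in> ?d ` D" by (intro Max_in) auto
  then obtain v where v: "v \<in> D" "?d v = Max (?d ` D)" by force
  have mx: "?d w \<le> ?d v" if "w \<in> D" for w
    unfolding v(2) using that \<open>finite D\<close> by (intro Max_ge) auto
  have vv: "v \<in> verts G" "v \<noteq> r" "f v \<noteq> g v" using v(1) by (auto simp: D_def)
  have gv: "tail G (g v) = v" "g v \<in> arcs G" using arborescenceD(1)[OF g vv(1,2)] by auto
  have gT: "g v \<in> arcs (arb_tree r f)" unfolding eq using vv by (auto simp: arb_tree_def)
  show False
    using arb_tree_arcs_cases[OF f gT]
  proof cases
    case 1
    then show False using gv vv by simp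
  next
    case 2
    define w where "w = head G (g v)"
    have w: "w \<in> verts G" "w \<noteq> r" "g v = arev (f w)" using 2 by (auto simp: w_def)
    have fw: "head G (f w) = v" using gv w arborescenceD(1)[OF f w(1,2)] by (metis tail_arev)
    have "?d w = Suc (?d v)" using arborescenceD(3)[OF f w(1,2)] fw by simp
    then have "w \<notin> D" using mx[of w] by auto
    then have "g w = f w" using w by (auto simp: D_def)
    then have "head G (g w) = v" using fw by simp
    then show False
      using arborescenceD(3)[OF g vv(1,2)] arborescenceD(3)[OF g w(1,2)] by (simp add: w_def)
  qed
qed

text \<open>Choices made inside \<open>T\<close> give an arborescence whose tree is contained in
  \<open>T\<close>. Any further arc of \<open>T\<close> would be closed up to a circuit by a path in
  the smaller tree.\<close>

lemma spanning_tree_is_arb_tree: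
  assumes T: "T \<in> serre_spanning_trees G arev" and r: "r \<in> verts G"
  shows "T \<in> arb_tree r ` arborescences r"
proof -
  have ts: "tail T = tail G" "head T = head G" and vT: "verts T = verts G"
    and aT: "arcs T \<subseteq> arcs G" and revT: "\<And>e. e \<in> arcs T \<Longrightarrow> arev e \<in> arcs T"
    and conn: "connected T" and nocirc: "\<And>p. \<not> circuit T arev p" and wfT: "wf_digraph T"
    using T by (auto simp: serre_spanning_trees_def serre_tree_def spanning_def subgraph_def compatible_def)
  interpret T: wf_digraph T by (rule wfT)
  have symT: "symmetric T"
    unfolding symmetric_conv ts using revT aT by (metis head_arev tail_arev subsetD)
  have sc: "strongly_connected T"
    by (rule T.symmetric_connected_imp_strongly_connected[OF symT conn])
  then have "\<exists>f\<in>PiE (verts T - {r}) (out_arcs T). \<forall>v\<in>verts T. reaches (\<lambda>v. head T (f v)) r v"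
    using r vT by (intro T.exists_reaching_choice) (auto simp: strongly_connected_def)
  then obtain f where f: "f \<in> PiE (verts G - {r}) (out_arcs T)"
    "\<And>v. v \<in> verts G \<Longrightarrow> reaches (\<lambda>v. head G (f v)) r v"
    unfolding ts vT by blast
  have fT: "f v \<in> arcs T" "tail G (f v) = v" if "v \<in> verts G" "v \<noteq> r" for v
    using f(1) that by (auto simp: PiE_iff ts)
  have fa: "f \<in> arborescences r"
    using f fT aT by (auto simp: arborescences_def PiE_iff)
  interpret F: wf_digraph "arb_tree r f" by (rule arb_tree_wf[OF fa])
  have sub: "arcs (arb_tree r f) \<subseteq> arcs T" using fT revT by (auto simp: arb_tree_def)
  have "arcs T \<subseteq> arcs (arb_tree r f)"
  proof
    fix e assume e: "e \<in> arcs T"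
    show "e \<in> arcs (arb_tree r f)"
    proof (rule ccontr)
      assume ne: "e \<notin> arcs (arb_tree r f)"
      have eG: "e \<in> arcs G" using e aT by blast
      have "head G e \<rightarrow>\<^sup>*\<^bsub>arb_tree r f\<^esub> tail G e"
        using arb_tree_strongly_connected[OF fa r] eG by (auto simp: strongly_connected_def)
      \<comment> \<open>If \<open>e\<close> is a loop, the path is empty and the circuit is
        \<open>[e]\<close>.\<close>
      then obtain p where p: "F.apath (head G e) p (tail G e)" using F.reachable_apath by blast
      have comp: "compatible (arb_tree r f) T" by (simp add: compatible_def ts)
      have pF: "set p \<subseteq> arcs (arb_tree r f)" and dist: "distinct (F.awalk_verts (head G e) p)"
        and cas: "F.cas (head G e) p (tail G e)"
        using p by (auto simp: F.apath_def F.awalk_def)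
      have "T.awalk (tail G e) (e # p) (tail G e)"
        using pF sub e eG cas aT
        by (auto simp: T.awalk_def vT ts compatible_cas[OF comp])
      moreover have "distinct (tl (T.awalk_verts (tail G e) (e # p)))"
        using dist by (simp add: ts compatible_awalk_verts[OF comp])
      ultimately have "T.cycle (e # p)" unfolding T.cycle_def by blast
      moreover have "arev a \<notin> set (e # p)" if a: "a \<in> set (e # p)" for a
      proof
        assume b: "arev a \<in> set (e # p)"
        have aG: "a \<in> arcs G" using a eG pF sub aT by auto
        have ne2: "arev a \<noteq> a" using arev_neq[OF aG] .
        have "arev e \<notin> set p" using ne pF arb_tree_arev[of "arev e" r f] by auto
        then have "a \<in> set p" "arev a \<in> set p"
          using a b ne2 arev_arev by (metis set_ConsD)+
        then show False
          using F.apath_no_reverse[OF p, of a "arev a"] aG ne2 by simp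
      qed
      ultimately have "circuit T arev (e # p)" by (auto simp: circuit_def)
      then show False using nocirc by blast
    qed
  qed
  then have "T = arb_tree r f"
    using sub ts vT by (intro pre_digraph.equality) auto
  then show ?thesis using fa by blast
qed

text \<open>The count does not depend on the root. This is why the linear coefficient of the
  characteristic polynomial carries the number of vertices as a factor, one summand for each
  root.\<close>

lemma card_arborescences:
  assumes "r \<in> verts G"
  shows "card (arborescences r) = complexity G arev"
proof -
  have "arb_tree r ` arborescences r = serre_spanning_trees G arev"
    using arb_tree_spanning_tree spanning_tree_is_arb_tree assms by blast
  then show ?thesis unfolding complexity_def using card_image[OF inj_on_arb_tree] by metis
qed

lemma finite_arborescences: "finite (arborescences r)"
  unfolding arborescences_def
  by (rule finite_subset[of _ "PiE (verts G - {r}) (out_arcs G)"]) (auto intro!: finite_PiE)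

text \<open>Needed for the linear coefficient of the characteristic polynomial to be nonzero, that
  is, for 0 to be a simple eigenvalue.\<close>

lemma complexity_pos:
  assumes "connected G"
  shows "complexity G arev > 0"
proof -
  have sym: "symmetric G"
    unfolding symmetric_conv by (metis arev_in_arcs head_arev tail_arev)
  have sc: "strongly_connected G"
    by (rule symmetric_connected_imp_strongly_connected[OF sym assms])
  then obtain r where r: "r \<in> verts G" by (auto simp: strongly_connected_def)
  have "\<exists>f. f \<in> arborescences r"
    using exists_reaching_choice[OF r] sc r by (auto simp: arborescences_def strongly_connected_def)
  then have "card (arborescences r) > 0" using finite_arborescences by (auto simp: card_gt_0_iff)
  then show ?thesis unfolding card_arborescences[OF r] .
qed

end

text \<open>The linear coefficient takes the slope from exactly one factor \<open>r\<close>; in the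
  determinant this row becomes the root.\<close>

lemma coeff_prod_linear_0_1:
  fixes c d :: "'i \<Rightarrow> 'x :: comm_ring_1"
  assumes "finite S"
  shows "coeff (\<Prod>i\<in>S. [:c i, d i:]) 0 = (\<Prod>i\<in>S. c i)"
    and "coeff (\<Prod>i\<in>S. [:c i, d i:]) 1 = (\<Sum>r\<in>S. d r * (\<Prod>i\<in>S - {r}. c i))"
proof -
  show 0: "coeff (\<Prod>i\<in>S. [:c i, d i:]) 0 = (\<Prod>i\<in>S. c i)" for S
    by (induction S rule: infinite_finite_induct) auto
  show "coeff (\<Prod>i\<in>S. [:c i, d i:]) 1 = (\<Sum>r\<in>S. d r * (\<Prod>i\<in>S - {r}. c i))"
    using assms
  proof (induction S)
    case (insert s S)
    have "(\<Prod>i\<in>insert s S - {r}. c i) = c s * (\<Prod>i\<in>S - {r}. c i)" if "r \<in> S" for r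
    proof -
      have "insert s S - {r} = insert s (S - {r})" using insert that by auto
      then show ?thesis using insert by simp
    qed
    moreover have "insert s S - {s} = S" using insert by auto
    moreover have "coeff (\<Prod>i\<in>insert s S. [:c i, d i:]) 1 =
        c s * coeff (\<Prod>i\<in>S. [:c i, d i:]) 1 + d s * coeff (\<Prod>i\<in>S. [:c i, d i:]) 0"
      using insert by simp
    ultimately show ?case
      using insert by (simp add: 0 sum_distrib_left mult.left_commute)
  qed simp
qed

section \<open>The Laplacian and the expansion of its characteristic polynomial\<close>

context finite_serre_graph
begin

text \<open>
  This is the negative of the usual Laplacian, so that its characteristic polynomial is
  \<open>det (x + Laplacian)\<close> and no signs occur in the matrix tree theorem.
\<close>

definition laplacian :: "'a list \<Rightarrow> complex mat" where
  "laplacian vs = mat (length vs) (length vs) (\<lambda>(i, j).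
     (\<Sum>e\<in>out_arcs G (vs ! i). (if head G e = vs ! j then 1 else 0) - (if i = j then 1 else 0)))"

lemma laplacian_carrier [simp]: "laplacian vs \<in> carrier_mat (length vs) (length vs)"
  by (simp add: laplacian_def)

text \<open>The identity minus the transition matrix of following the chosen arcs. The root chooses
  no arc, so row \<open>r\<close> is a unit row; it stems from the x on the diagonal.\<close>

definition arc_choice_mat :: "'a list \<Rightarrow> nat \<Rightarrow> ('a \<Rightarrow> 'b) \<Rightarrow> complex mat" where
  "arc_choice_mat vs r f = mat (length vs) (length vs) (\<lambda>(i, j).
     (if i = j then 1 else 0) - (if i \<noteq> r \<and> head G (f (vs ! i)) = vs ! j then 1 else 0))"

lemma arc_choice_mat_carrier [simp]: "arc_choice_mat vs r f \<in> carrier_mat (length vs) (length vs)"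
  by (simp add: arc_choice_mat_def)

text \<open>For an arborescence, ordering the vertices by depth makes the matrix unitriangular.
  Otherwise some vertices never reach the root, and they form a set that the chosen arcs neither
  enter nor leave.\<close>

lemma det_arc_choice_mat:
  assumes vs: "distinct vs" "set vs = verts G" and r: "r < length vs"
    and f: "f \<in> PiE (verts G - {vs ! r}) (out_arcs G)"
  shows "det (arc_choice_mat vs r f) = (if f \<in> arborescences (vs ! r) then 1 else 0)"
proof -
  let ?n = "length vs" and ?h = "\<lambda>v. head G (f v)"
  let ?M = "arc_choice_mat vs r f"
  have vsV: "vs ! i \<in> verts G" if "i < ?n" for i using nth_mem[OF that] unfolding vs(2) .
  have vs_eq: "vs ! i = vs ! j \<longleftrightarrow> i = j" if "i < ?n" "j < ?n" for i j
    using nth_eq_iff_index_eq[OF vs(1) that] .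
  have hV: "?h (vs ! i) \<in> verts G" if "i < ?n" "i \<noteq> r" for i
  proof -
    have "vs ! i \<in> verts G - {vs ! r}" using vsV[OF that(1)] vs_eq[OF that(1) r] that(2) by simp
    then have "f (vs ! i) \<in> out_arcs G (vs ! i)" using f by (rule PiE_mem[rotated])
    then show ?thesis by simp
  qed
  show ?thesis
  proof (cases "f \<in> arborescences (vs ! r)")
    case True
    let ?d = "depth ?h (vs ! r)"
    have step: "?d (vs ! i) = Suc (?d (?h (vs ! i)))" if "i < ?n" "i \<noteq> r" for i
      using arborescenceD(3)[OF True vsV[OF that(1)]] vs_eq[OF that(1) r] that(2) by simp
    \<comment> \<open>Where the product does not vanish, \<open>p\<close> moves each of its nonfixed points one step closer to
      the root.\<close>
    have "(\<Prod>i = 0..<?n. ?M $$ (i, p i)) = 0" if p: "p permutes {0..<?n}" "p \<noteq> id" for p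
    proof (rule ccontr)
      assume nz: "(\<Prod>i = 0..<?n. ?M $$ (i, p i)) \<noteq> 0"
      then have nz: "?M $$ (i, p i) \<noteq> 0" if "i < ?n" for i using that by auto
      have pn: "p i < ?n" if "i < ?n" for i using permutes_in_image[OF p(1), of i] that by simp
      define D where "D = {i. p i \<noteq> i}"
      have Dn: "i < ?n" if "i \<in> D" for i using that permutes_not_in[OF p(1), of i] by (auto simp: D_def)
      have "D \<noteq> {}" using p(2) by (auto simp: D_def)
      then obtain i where i: "i \<in> D" "\<And>j. j \<in> D \<Longrightarrow> ?d (vs ! i) \<le> ?d (vs ! j)"
        using ex_has_least_nat[of "\<lambda>i. i \<in> D" _ "\<lambda>i. ?d (vs ! i)"] by blast
      have "i \<noteq> r \<and> ?h (vs ! i) = vs ! p i"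
        using nz[OF Dn[OF i(1)]] Dn[OF i(1)] pn i(1)
        by (auto simp: arc_choice_mat_def D_def split: if_splits)
      then have "?d (vs ! i) = Suc (?d (vs ! p i))" using step[OF Dn[OF i(1)]] by simp
      moreover have "p i \<in> D" using i(1) permutes_inj[OF p(1)] by (auto simp: D_def inj_eq)
      ultimately show False using i(2)[of "p i"] by simp
    qed
    then have "det ?M = (\<Sum>p\<in>{id}. signof p * (\<Prod>i = 0..<?n. ?M $$ (i, p i)))"
      unfolding det_def'[OF arc_choice_mat_carrier]
      by (intro sum.mono_neutral_right) (auto simp: permutes_id finite_permutations)
    also have "\<dots> = (\<Prod>i = 0..<?n. ?M $$ (i, i))" by simp
    also have "\<dots> = 1"
    proof (intro prod.neutral ballI)
      fix i assume "i \<in> {0..<?n}"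
      then have i: "i < ?n" by simp
      have "\<not> (i \<noteq> r \<and> ?h (vs ! i) = vs ! i)" using step[OF i] by auto
      then show "?M $$ (i, i) = 1" using i by (auto simp: arc_choice_mat_def)
    qed
    finally show ?thesis using True by simp
  next
    case False
    \<comment> \<open>The indicator of the vertices that do not reach the root is in the null space.\<close>
    define x :: "complex vec" where "x = vec ?n (\<lambda>i. if reaches ?h (vs ! r) (vs ! i) then 0 else 1)"
    have x: "x \<in> carrier_vec ?n" by (simp add: x_def)
    obtain v where v: "v \<in> verts G" "\<not> reaches ?h (vs ! r) v"
      using False f by (auto simp: arborescences_def)
    obtain k where k: "k < ?n" "vs ! k = v" using v(1) vs(2) by (metis in_set_conv_nth)
    have "x $ k \<noteq> 0" using k v by (simp add: x_def)
    then have "x \<noteq> 0\<^sub>v ?n" using k by auto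
    moreover have "?M *\<^sub>v x = 0\<^sub>v ?n"
    proof (rule eq_vecI)
      fix i assume "i < dim_vec (0\<^sub>v ?n :: complex vec)"
      then have i: "i < ?n" by simp
      have "(?M *\<^sub>v x) $ i = (\<Sum>j = 0..<?n. ((if i = j then 1 else 0) -
          (if i \<noteq> r \<and> ?h (vs ! i) = vs ! j then 1 else 0)) * x $ j)"
        using i x by (auto simp: scalar_prod_def arc_choice_mat_def intro!: sum.cong)
      also have "\<dots> = (\<Sum>j = 0..<?n. if i = j then x $ j else 0) -
          (\<Sum>j = 0..<?n. if i \<noteq> r \<and> ?h (vs ! i) = vs ! j then x $ j else 0)"
        unfolding sum_subtractf[symmetric] left_diff_distrib
        by (intro sum.cong refl arg_cong2[where f = "(-)"]) auto
      also have "(\<Sum>j = 0..<?n. if i = j then x $ j else 0) = x $ i" using i by simp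
      also have "(\<Sum>j = 0..<?n. if i \<noteq> r \<and> ?h (vs ! i) = vs ! j then x $ j else 0) = x $ i"
      proof (cases "i = r")
        case True
        then show ?thesis using i by (simp add: x_def)
      next
        case ir: False
        obtain l where l: "l < ?n" "vs ! l = ?h (vs ! i)"
          using hV[OF i ir] vs(2) by (metis in_set_conv_nth)
        have "(\<Sum>j = 0..<?n. if i \<noteq> r \<and> ?h (vs ! i) = vs ! j then x $ j else 0) =
            (\<Sum>j = 0..<?n. if l = j then x $ j else 0)"
          using ir l vs_eq by (intro sum.cong) (auto simp flip: l(2))
        also have "\<dots> = x $ l" using l by simp
        also have "\<dots> = x $ i"
          using i l reaches_step_iff[of "vs ! i" "vs ! r" ?h] vs_eq[OF i r] ir by (simp add: x_def)
        finally show ?thesis .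
      qed
      finally show "(?M *\<^sub>v x) $ i = (0\<^sub>v ?n) $ i" using i by simp
    qed (simp add: arc_choice_mat_def)
    ultimately have "det ?M = 0"
      using x by (auto simp: det_0_iff_vec_prod_zero[OF arc_choice_mat_carrier])
    then show ?thesis using False by simp
  qed
qed

text \<open>In each Leibniz term one row \<open>r\<close> supplies the x, and each other row is a
  sum over the arcs leaving its vertex. Multiplying out yields choices of arcs away from the root
  \<open>r\<close>, whose terms reassemble into determinants.\<close>

theorem coeff_1_char_poly_laplacian:
  assumes vs: "distinct vs" "set vs = verts G"
  shows "coeff (char_poly (laplacian vs)) 1 = of_nat (length vs * complexity G arev)"
proof -
  let ?n = "length vs"
  let ?u = "\<lambda>i j e. (if i = j then 1 else 0) - (if head G e = vs ! j then 1 else 0) :: complex"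
  have vsV: "vs ! i \<in> verts G" if "i < ?n" for i using nth_mem[OF that] unfolding vs(2) .
  have vs_eq: "vs ! i = vs ! j \<longleftrightarrow> i = j" if "i < ?n" "j < ?n" for i j
    using nth_eq_iff_index_eq[OF vs(1) that] .
  have cpm: "char_poly_matrix (laplacian vs) $$ (i, j) =
      [:\<Sum>e\<in>out_arcs G (vs ! i). ?u i j e, if i = j then 1 else 0:]" if "i < ?n" "j < ?n" for i j
    using that by (auto simp: char_poly_matrix_def laplacian_def simp flip: sum_negf)
  have expand: "(\<Prod>i\<in>{0..<?n} - {r}. \<Sum>e\<in>out_arcs G (vs ! i). ?u i (p i) e) =
      (\<Sum>f\<in>PiE (verts G - {vs ! r}) (out_arcs G). \<Prod>i\<in>{0..<?n} - {r}. ?u i (p i) (f (vs ! i)))"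
    if r: "r < ?n" for r p
  proof -
    \<comment> \<open>Choices of arcs are indexed by vertices but rows by positions in
      \<open>vs\<close>; \<open>idx\<close> translates between the two.\<close>
    define idx where "idx = the_inv_into {0..<?n} (\<lambda>i. vs ! i)"
    have inj: "inj_on (\<lambda>i. vs ! i) {0..<?n}" using vs_eq by (auto simp: inj_on_def)
    have idx: "idx (vs ! i) = i" if "i < ?n" for i
      unfolding idx_def by (rule the_inv_into_f_f[OF inj]) (use that in simp)
    have bij: "bij_betw (\<lambda>i. vs ! i) ({0..<?n} - {r}) (verts G - {vs ! r})"
      unfolding bij_betw_def
    proof
      show "inj_on (\<lambda>i. vs ! i) ({0..<?n} - {r})" by (rule inj_on_subset[OF inj]) auto
      show "(\<lambda>i. vs ! i) ` ({0..<?n} - {r}) = verts G - {vs ! r}"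
      proof (intro equalityI subsetI)
        fix v assume v: "v \<in> verts G - {vs ! r}"
        then obtain i where "i < ?n" "vs ! i = v" using vs(2) by (metis DiffD1 in_set_conv_nth)
        then show "v \<in> (\<lambda>i. vs ! i) ` ({0..<?n} - {r})" using v by auto
      qed (use vsV vs_eq r in auto)
    qed
    have "(\<Prod>i\<in>{0..<?n} - {r}. \<Sum>e\<in>out_arcs G (vs ! i). ?u i (p i) e) =
        (\<Prod>i\<in>{0..<?n} - {r}. (\<lambda>v. \<Sum>e\<in>out_arcs G v. ?u (idx v) (p (idx v)) e) (vs ! i))"
      by (intro prod.cong) (auto simp: idx)
    also have "\<dots> = (\<Prod>v\<in>verts G - {vs ! r}. \<Sum>e\<in>out_arcs G v. ?u (idx v) (p (idx v)) e)"
      by (rule prod.reindex_bij_betw[OF bij])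
    also have "\<dots> = (\<Sum>f\<in>PiE (verts G - {vs ! r}) (out_arcs G).
        \<Prod>v\<in>verts G - {vs ! r}. ?u (idx v) (p (idx v)) (f v))"
      by (rule prod_sum_PiE) auto
    also have "\<dots> = (\<Sum>f\<in>PiE (verts G - {vs ! r}) (out_arcs G).
        \<Prod>i\<in>{0..<?n} - {r}. (\<lambda>v. ?u (idx v) (p (idx v)) (f v)) (vs ! i))"
      by (intro sum.cong refl prod.reindex_bij_betw[OF bij, symmetric])
    also have "\<dots> = (\<Sum>f\<in>PiE (verts G - {vs ! r}) (out_arcs G).
        \<Prod>i\<in>{0..<?n} - {r}. ?u i (p i) (f (vs ! i)))"
      by (intro sum.cong prod.cong) (auto simp: idx)
    finally show ?thesis .
  qed
  \<comment> \<open>The indicator that \<open>p\<close> fixes \<open>r\<close> is the entry in the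
    unit row \<open>r\<close>, so the product is a full Leibniz term of
    \<open>arc_choice_mat\<close>.\<close>
  have row: "(if r = p r then 1 else 0) * (\<Prod>i\<in>{0..<?n} - {r}. ?u i (p i) (f (vs ! i))) =
      (\<Prod>i = 0..<?n. arc_choice_mat vs r f $$ (i, p i))"
    if r: "r < ?n" and p: "p permutes {0..<?n}" for r p f
  proof -
    have pn: "p i < ?n" if "i < ?n" for i using permutes_in_image[OF p, of i] that by simp
    have "(\<Prod>i = 0..<?n. arc_choice_mat vs r f $$ (i, p i)) =
        arc_choice_mat vs r f $$ (r, p r) * (\<Prod>i\<in>{0..<?n} - {r}. arc_choice_mat vs r f $$ (i, p i))"
      using r by (intro prod.remove) auto
    also have "arc_choice_mat vs r f $$ (r, p r) = (if r = p r then 1 else 0)"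
      using r pn by (simp add: arc_choice_mat_def)
    also have "(\<Prod>i\<in>{0..<?n} - {r}. arc_choice_mat vs r f $$ (i, p i)) =
        (\<Prod>i\<in>{0..<?n} - {r}. ?u i (p i) (f (vs ! i)))"
      using pn by (intro prod.cong) (auto simp: arc_choice_mat_def)
    finally show ?thesis by simp
  qed
  have "coeff (char_poly (laplacian vs)) 1 = (\<Sum>p\<in>{p. p permutes {0..<?n}}.
      coeff (signof p * (\<Prod>i = 0..<?n. char_poly_matrix (laplacian vs) $$ (i, p i))) 1)"
    unfolding char_poly_def det_def'[OF char_poly_matrix_closed[OF laplacian_carrier]]
    by (rule coeff_sum)
  also have "\<dots> = (\<Sum>p\<in>{p. p permutes {0..<?n}}. signof p * (\<Sum>r = 0..<?n.
      \<Sum>f\<in>PiE (verts G - {vs ! r}) (out_arcs G). \<Prod>i = 0..<?n. arc_choice_mat vs r f $$ (i, p i)))"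
  proof (intro sum.cong refl)
    fix p assume "p \<in> {p. p permutes {0..<?n}}"
    then have p: "p permutes {0..<?n}" by simp
    have pn: "p i < ?n" if "i < ?n" for i using permutes_in_image[OF p, of i] that by simp
    have "(\<Prod>i = 0..<?n. char_poly_matrix (laplacian vs) $$ (i, p i)) =
        (\<Prod>i = 0..<?n. [:\<Sum>e\<in>out_arcs G (vs ! i). ?u i (p i) e, if i = p i then 1 else 0:])"
      using pn by (intro prod.cong) (auto simp: cpm)
    then have "coeff (\<Prod>i = 0..<?n. char_poly_matrix (laplacian vs) $$ (i, p i)) 1 =
        (\<Sum>r = 0..<?n. (if r = p r then 1 else 0) *
          (\<Prod>i\<in>{0..<?n} - {r}. \<Sum>e\<in>out_arcs G (vs ! i). ?u i (p i) e))"
      by (simp only: coeff_prod_linear_0_1(2)[OF finite_atLeastLessThan])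
    also have "\<dots> = (\<Sum>r = 0..<?n. \<Sum>f\<in>PiE (verts G - {vs ! r}) (out_arcs G).
        \<Prod>i = 0..<?n. arc_choice_mat vs r f $$ (i, p i))"
    proof (intro sum.cong refl)
      fix r assume "r \<in> {0..<?n}"
      then have r: "r < ?n" by simp
      show "(if r = p r then 1 else 0) * (\<Prod>i\<in>{0..<?n} - {r}. \<Sum>e\<in>out_arcs G (vs ! i). ?u i (p i) e) =
        (\<Sum>f\<in>PiE (verts G - {vs ! r}) (out_arcs G). \<Prod>i = 0..<?n. arc_choice_mat vs r f $$ (i, p i))"
        unfolding expand[OF r] sum_distrib_left by (intro sum.cong refl row[OF r p])
    qed
    finally have e: "coeff (\<Prod>i = 0..<?n. char_poly_matrix (laplacian vs) $$ (i, p i)) 1 =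
        (\<Sum>r = 0..<?n. \<Sum>f\<in>PiE (verts G - {vs ! r}) (out_arcs G).
          \<Prod>i = 0..<?n. arc_choice_mat vs r f $$ (i, p i))" .
    have "coeff (signof p * q) 1 = signof p * coeff q 1" for q :: "complex poly"
      by (simp add: sign_def)
    then show "coeff (signof p * (\<Prod>i = 0..<?n. char_poly_matrix (laplacian vs) $$ (i, p i))) 1 =
        signof p * (\<Sum>r = 0..<?n. \<Sum>f\<in>PiE (verts G - {vs ! r}) (out_arcs G).
          \<Prod>i = 0..<?n. arc_choice_mat vs r f $$ (i, p i))"
      unfolding e[symmetric] by blast
  qed
  \<comment> \<open>Moving the sum over permutations innermost restores one determinant for each
    root and choice.\<close>
  also have "\<dots> = (\<Sum>r = 0..<?n. \<Sum>f\<in>PiE (verts G - {vs ! r}) (out_arcs G). det (arc_choice_mat vs r f))"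
    unfolding sum_distrib_left det_def'[OF arc_choice_mat_carrier]
    by (subst sum.swap, intro sum.cong refl, rule sum.swap)
  also have "\<dots> = (\<Sum>r = 0..<?n. of_nat (complexity G arev))"
  proof (intro sum.cong refl)
    fix r assume "r \<in> {0..<?n}"
    then have r: "r < ?n" by simp
    let ?P = "PiE (verts G - {vs ! r}) (out_arcs G)"
    have fin: "finite ?P" by (intro finite_PiE) auto
    have "(\<Sum>f\<in>?P. det (arc_choice_mat vs r f)) =
        (\<Sum>f\<in>?P. if f \<in> arborescences (vs ! r) then 1 else 0)"
      by (intro sum.cong refl det_arc_choice_mat[OF vs r])
    also have "\<dots> = of_nat (card (?P \<inter> arborescences (vs ! r)))"
      using fin by (simp add: sum.inter_restrict[symmetric])
    also have "?P \<inter> arborescences (vs ! r) = arborescences (vs ! r)" by (auto simp: arborescences_def)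
    finally show "(\<Sum>f\<in>?P. det (arc_choice_mat vs r f)) = of_nat (complexity G arev)"
      using card_arborescences[OF vsV[OF r]] by simp
  qed
  also have "\<dots> = of_nat (?n * complexity G arev)" by simp
  finally show ?thesis .
qed

text \<open>All row sums vanish, so the vector of ones is an eigenvector for 0.\<close>

lemma coeff_0_char_poly_laplacian:
  assumes vs: "distinct vs" "set vs = verts G" and ne: "verts G \<noteq> {}"
  shows "coeff (char_poly (laplacian vs)) 0 = 0"
proof -
  let ?n = "length vs"
  define x :: "complex vec" where "x = vec ?n (\<lambda>_. 1)"
  have "?n \<noteq> 0" using ne vs(2) by auto
  then have "x $ 0 \<noteq> (0\<^sub>v ?n :: complex vec) $ 0" by (simp add: x_def)
  then have "x \<noteq> 0\<^sub>v ?n" by metis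
  moreover have "laplacian vs *\<^sub>v x = 0 \<cdot>\<^sub>v x"
  proof (rule eq_vecI)
    fix i assume "i < dim_vec (0 \<cdot>\<^sub>v x)"
    then have i: "i < ?n" by (simp add: x_def)
    have "(laplacian vs *\<^sub>v x) $ i = (\<Sum>j = 0..<?n. \<Sum>e\<in>out_arcs G (vs ! i).
        (if head G e = vs ! j then 1 else 0) - (if i = j then 1 else 0))"
      using i by (auto simp: laplacian_def x_def scalar_prod_def intro!: sum.cong)
    also have "\<dots> = (\<Sum>e\<in>out_arcs G (vs ! i). (\<Sum>j = 0..<?n. if head G e = vs ! j then 1 else 0) - 1)"
      by (subst sum.swap) (use i in \<open>simp add: sum_subtractf\<close>)
    also have "\<dots> = 0"
    proof (intro sum.neutral ballI)
      fix e assume "e \<in> out_arcs G (vs ! i)"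
      then have "head G e \<in> set vs" using vs(2) by simp
      then obtain l where l: "l < ?n" "vs ! l = head G e" by (metis in_set_conv_nth)
      have "(\<Sum>j = 0..<?n. if head G e = vs ! j then 1 else 0) =
          (\<Sum>j = 0..<?n. if l = j then 1 else 0 :: complex)"
        using l(1) nth_eq_iff_index_eq[OF vs(1) l(1)] by (intro sum.cong) (auto simp flip: l(2))
      also have "\<dots> = 1" using l(1) by simp
      finally show "(\<Sum>j = 0..<?n. if head G e = vs ! j then 1 else 0) - 1 = (0 :: complex)" by simp
    qed
    finally show "(laplacian vs *\<^sub>v x) $ i = (0 \<cdot>\<^sub>v x) $ i" using i by (simp add: x_def)
  qed (simp add: laplacian_def x_def)
  ultimately have "eigenvector (laplacian vs) x 0"
    by (simp add: eigenvector_def laplacian_def x_def)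
  then have "poly (char_poly (laplacian vs)) 0 = 0"
    using eigenvalue_root_char_poly[OF laplacian_carrier] unfolding eigenvalue_def by blast
  then show ?thesis by (simp add: poly_0_coeff_0)
qed

end

section \<open>Quotients by free actions\<close>

text \<open>Freeness on vertices gives every orbit the size of the subgroup and makes the projection
  a local bijection. It does not prevent an element from flipping an edge;
  \<open>no_inversion\<close> does, and thereby keeps the reversal of each quotient free of fixed
  points.\<close>

locale free_serre_action = Y: finite_serre_graph Y rY + Gr: group G
  for Y :: "('a, 'b) pre_digraph" and rY :: "'b \<Rightarrow> 'b" and G :: "('g, 'm) monoid_scheme" +
  fixes av :: "'g \<Rightarrow> 'a \<Rightarrow> 'a" and ae :: "'g \<Rightarrow> 'b \<Rightarrow> 'b"
  assumes finite_group: "finite (carrier G)"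
    and av_closed: "g \<in> carrier G \<Longrightarrow> v \<in> verts Y \<Longrightarrow> av g v \<in> verts Y"
    and ae_closed: "g \<in> carrier G \<Longrightarrow> e \<in> arcs Y \<Longrightarrow> ae g e \<in> arcs Y"
    and av_one: "v \<in> verts Y \<Longrightarrow> av \<one>\<^bsub>G\<^esub> v = v"
    and ae_one: "e \<in> arcs Y \<Longrightarrow> ae \<one>\<^bsub>G\<^esub> e = e"
    and av_mult: "g \<in> carrier G \<Longrightarrow> h \<in> carrier G \<Longrightarrow> v \<in> verts Y \<Longrightarrow> av (g \<otimes>\<^bsub>G\<^esub> h) v = av g (av h v)"
    and ae_mult: "g \<in> carrier G \<Longrightarrow> h \<in> carrier G \<Longrightarrow> e \<in> arcs Y \<Longrightarrow> ae (g \<otimes>\<^bsub>G\<^esub> h) e = ae g (ae h e)"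
    and tail_ae: "g \<in> carrier G \<Longrightarrow> e \<in> arcs Y \<Longrightarrow> tail Y (ae g e) = av g (tail Y e)"
    and head_ae: "g \<in> carrier G \<Longrightarrow> e \<in> arcs Y \<Longrightarrow> head Y (ae g e) = av g (head Y e)"
    and rev_ae: "g \<in> carrier G \<Longrightarrow> e \<in> arcs Y \<Longrightarrow> rY (ae g e) = ae g (rY e)"
    and free: "g \<in> carrier G \<Longrightarrow> v \<in> verts Y \<Longrightarrow> av g v = v \<Longrightarrow> g = \<one>\<^bsub>G\<^esub>"
    and no_inversion: "g \<in> carrier G \<Longrightarrow> e \<in> arcs Y \<Longrightarrow> ae g e \<noteq> rY e"
begin

definition vorb :: "'g set \<Rightarrow> 'a \<Rightarrow> 'a set" where
  "vorb H v = (\<lambda>g. av g v) ` H"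

definition eorb :: "'g set \<Rightarrow> 'b \<Rightarrow> 'b set" where
  "eorb H e = (\<lambda>g. ae g e) ` H"

definition quotient :: "'g set \<Rightarrow> ('a set, 'b set) pre_digraph" where
  "quotient H = \<lparr>verts = vorb H ` verts Y, arcs = eorb H ` arcs Y,
     tail = (\<lambda>E. tail Y ` E), head = (\<lambda>E. head Y ` E)\<rparr>"

definition quotient_rev :: "'g set \<Rightarrow> 'b set \<Rightarrow> 'b set" where
  "quotient_rev H E = (if E \<in> eorb H ` arcs Y then rY ` E else E)"

lemma quotient_simps [simp]:
  "verts (quotient H) = vorb H ` verts Y" "arcs (quotient H) = eorb H ` arcs Y"
  "tail (quotient H) E = tail Y ` E" "head (quotient H) E = head Y ` E"
  by (auto simp: quotient_def)

lemma av_inv: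
  assumes "g \<in> carrier G" "v \<in> verts Y"
  shows "av (inv\<^bsub>G\<^esub> g) (av g v) = v"
  using assms av_mult[of "inv\<^bsub>G\<^esub> g" g v] av_one by simp

lemma av_eq_iff:
  assumes "g \<in> carrier G" "h \<in> carrier G" "v \<in> verts Y"
  shows "av g v = av h v \<longleftrightarrow> g = h"
proof
  assume eq: "av g v = av h v"
  have "av (inv\<^bsub>G\<^esub> h \<otimes>\<^bsub>G\<^esub> g) v = v"
    using assms av_inv[OF assms(2,3)] by (simp add: av_mult eq)
  then have "inv\<^bsub>G\<^esub> h \<otimes>\<^bsub>G\<^esub> g = \<one>\<^bsub>G\<^esub>" using assms by (intro free[of _ v]) auto
  then show "g = h" using assms by (metis Gr.inv_closed Gr.inv_equality Gr.inv_inv)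
qed simp

context
  fixes H assumes H: "subgroup H G"
begin

lemma subgroup_carrier: "g \<in> H \<Longrightarrow> g \<in> carrier G"
  using subgroup.mem_carrier[OF H] .

lemma vorb_self: "v \<in> verts Y \<Longrightarrow> v \<in> vorb H v"
  unfolding vorb_def using av_one subgroup.one_closed[OF H] by (metis imageI)

lemma eorb_self: "e \<in> arcs Y \<Longrightarrow> e \<in> eorb H e"
  unfolding eorb_def using ae_one subgroup.one_closed[OF H] by (metis imageI)

lemma vorb_subset: "v \<in> verts Y \<Longrightarrow> vorb H v \<subseteq> verts Y"
  using av_closed subgroup_carrier by (auto simp: vorb_def)

lemma vorb_av:
  assumes g: "g \<in> H" and v: "v \<in> verts Y"
  shows "vorb H (av g v) = vorb H v"
proof -
  have "vorb H (av g v) = (\<lambda>h. av (h \<otimes>\<^bsub>G\<^esub> g) v) ` H"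
    using g v subgroup_carrier by (auto simp: vorb_def av_mult)
  also have "\<dots> = (\<lambda>h. av h v) ` ((\<lambda>h. h \<otimes>\<^bsub>G\<^esub> g) ` H)" by (simp add: image_image)
  also have "(\<lambda>h. h \<otimes>\<^bsub>G\<^esub> g) ` H = H"
    using subgroup.rcos_const[OF H Gr.is_group g] by (auto simp: r_coset_def)
  finally show ?thesis by (simp add: vorb_def)
qed

lemma eorb_ae:
  assumes g: "g \<in> H" and e: "e \<in> arcs Y"
  shows "eorb H (ae g e) = eorb H e"
proof -
  have "eorb H (ae g e) = (\<lambda>h. ae (h \<otimes>\<^bsub>G\<^esub> g) e) ` H"
    using g e subgroup_carrier by (auto simp: eorb_def ae_mult)
  also have "\<dots> = (\<lambda>h. ae h e) ` ((\<lambda>h. h \<otimes>\<^bsub>G\<^esub> g) ` H)" by (simp add: image_image)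
  also have "(\<lambda>h. h \<otimes>\<^bsub>G\<^esub> g) ` H = H"
    using subgroup.rcos_const[OF H Gr.is_group g] by (auto simp: r_coset_def)
  finally show ?thesis by (simp add: eorb_def)
qed

lemma vorb_eq_iff:
  assumes "v \<in> verts Y" "w \<in> verts Y"
  shows "vorb H v = vorb H w \<longleftrightarrow> w \<in> vorb H v"
proof
  assume "vorb H v = vorb H w"
  then show "w \<in> vorb H v" using vorb_self[OF assms(2)] by simp
next
  assume "w \<in> vorb H v"
  then obtain g where "g \<in> H" "w = av g v" by (auto simp: vorb_def)
  then show "vorb H v = vorb H w" using vorb_av assms(1) by simp
qed

lemma mem_vorb_iff:
  assumes "v \<in> verts Y" "q \<in> vorb H ` verts Y"
  shows "v \<in> q \<longleftrightarrow> vorb H v = q"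
proof -
  obtain w where "w \<in> verts Y" "q = vorb H w" using assms(2) by auto
  then show ?thesis using vorb_eq_iff[of w v] assms(1) by auto
qed

lemma eorb_eq_iff:
  assumes "e \<in> arcs Y" "f \<in> arcs Y"
  shows "eorb H e = eorb H f \<longleftrightarrow> f \<in> eorb H e"
proof
  assume "eorb H e = eorb H f"
  then show "f \<in> eorb H e" using eorb_self[OF assms(2)] by simp
next
  assume "f \<in> eorb H e"
  then obtain g where "g \<in> H" "f = ae g e" by (auto simp: eorb_def)
  then show "eorb H e = eorb H f" using eorb_ae assms(1) by simp
qed

lemma tail_eorb: "e \<in> arcs Y \<Longrightarrow> tail Y ` eorb H e = vorb H (tail Y e)"
  by (auto simp: eorb_def vorb_def tail_ae subgroup_carrier image_image)

lemma head_eorb: "e \<in> arcs Y \<Longrightarrow> head Y ` eorb H e = vorb H (head Y e)"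
  by (auto simp: eorb_def vorb_def head_ae subgroup_carrier image_image)

lemma rev_eorb: "e \<in> arcs Y \<Longrightarrow> rY ` eorb H e = eorb H (rY e)"
  by (auto simp: eorb_def rev_ae subgroup_carrier image_image)

lemma card_vorb: "v \<in> verts Y \<Longrightarrow> card (vorb H v) = card H"
  unfolding vorb_def by (intro card_image inj_onI) (simp add: av_eq_iff subgroup_carrier)

lemma quotient_serre: "finite_serre_graph (quotient H) (quotient_rev H)"
proof -
  have "wf_digraph (quotient H)"
    by unfold_locales (auto simp: tail_eorb head_eorb)
  then interpret Q: wf_digraph "quotient H" .
  have "bidirected_digraph (quotient H) (quotient_rev H)"
  proof (rule Q.bidirected_digraphI)
    show "quotient_rev H E = E" if "E \<notin> arcs (quotient H)" for E
      using that by (simp add: quotient_rev_def)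
    fix E assume "E \<in> arcs (quotient H)"
    then obtain e where e: "e \<in> arcs Y" "E = eorb H e" by auto
    have r: "quotient_rev H E = eorb H (rY e)" using e by (simp add: quotient_rev_def rev_eorb)
    show "quotient_rev H E \<noteq> E"
    proof
      assume "quotient_rev H E = E"
      then have "rY e \<in> eorb H e" using r e eorb_self[of "rY e"] by simp
      then obtain g where "g \<in> H" "rY e = ae g e" by (auto simp: eorb_def)
      then show False using no_inversion[OF subgroup_carrier e(1), of g] by simp
    qed
    show "quotient_rev H (quotient_rev H E) = E"
      unfolding r using e by (simp add: quotient_rev_def rev_eorb)
    show "tail (quotient H) (quotient_rev H E) = head (quotient H) E"
      unfolding r using e by (simp add: tail_eorb head_eorb)
  qed
  then interpret B: bidirected_digraph "quotient H" "quotient_rev H" .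
  show ?thesis by unfold_locales auto
qed

lemma quotient_connected:
  assumes "connected Y"
  shows "connected (quotient H)"
proof -
  interpret Q: finite_serre_graph "quotient H" "quotient_rev H" by (rule quotient_serre)
  have "symmetric Y"
    unfolding symmetric_conv by (metis Y.arev_in_arcs Y.head_arev Y.tail_arev)
  then have sc: "strongly_connected Y" using assms by (rule Y.symmetric_connected_imp_strongly_connected)
  have reach: "vorb H u \<rightarrow>\<^sup>*\<^bsub>quotient H\<^esub> vorb H v" if "u \<rightarrow>\<^sup>*\<^bsub>Y\<^esub> v" for u v
    using that
  proof (induction rule: Y.reachable_induct)
    case base
    then show ?case by (intro Q.reachable_refl) simp
  next
    case (step x y)
    from step(2) obtain e where e: "e \<in> arcs Y" "tail Y e = x" "head Y e = y" by auto
    have "vorb H x \<rightarrow>\<^bsub>quotient H\<^esub> vorb H y"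
      using e Q.in_arcs_imp_in_arcs_ends[of "eorb H e"] by (auto simp: tail_eorb head_eorb)
    with step.IH show ?case by (rule Q.reachable_adj_trans)
  qed
  have "symmetric (quotient H)"
    unfolding symmetric_conv by (metis Q.arev_in_arcs Q.head_arev Q.tail_arev)
  moreover have "strongly_connected (quotient H)"
    using sc reach by (auto simp: strongly_connected_def)
  ultimately show ?thesis by (rule Q.symmetric_strongly_connected_imp_connected)
qed

text \<open>The projection to the quotient is a covering. Two arcs at \<open>v\<close> in one orbit
  differ by an element fixing \<open>v\<close>, hence by the unit; an arc orbit that starts at the
  orbit of \<open>v\<close> has a translate starting at \<open>v\<close>.\<close>

lemma bij_betw_out_arcs:
  assumes v: "v \<in> verts Y"
  shows "bij_betw (eorb H) (out_arcs Y v) (out_arcs (quotient H) (vorb H v))"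
  unfolding bij_betw_def
proof
  show "inj_on (eorb H) (out_arcs Y v)"
  proof (rule inj_onI)
    fix e f assume e: "e \<in> out_arcs Y v" and f: "f \<in> out_arcs Y v" and eq: "eorb H e = eorb H f"
    then have "f \<in> eorb H e" using eorb_eq_iff[of e f] by auto
    then obtain g where g: "g \<in> H" "f = ae g e" by (auto simp: eorb_def)
    have "av g v = v" using e f g tail_ae[OF subgroup_carrier[OF g(1)], of e] by auto
    then have "g = \<one>\<^bsub>G\<^esub>" using free[OF subgroup_carrier[OF g(1)] v] by simp
    then show "e = f" using g e ae_one by auto
  qed
  show "eorb H ` out_arcs Y v = out_arcs (quotient H) (vorb H v)"
  proof (intro equalityI subsetI)
    fix E assume "E \<in> out_arcs (quotient H) (vorb H v)"
    then obtain e where e: "e \<in> arcs Y" "E = eorb H e" "vorb H (tail Y e) = vorb H v"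
      by (auto simp: tail_eorb)
    then have "v \<in> vorb H (tail Y e)" using v by (simp add: vorb_eq_iff)
    then obtain g where g: "g \<in> H" "v = av g (tail Y e)" by (auto simp: vorb_def)
    have "ae g e \<in> out_arcs Y v" using g e subgroup_carrier by (auto simp: ae_closed tail_ae)
    moreover have "E = eorb H (ae g e)" using e g by (simp add: eorb_ae)
    ultimately show "E \<in> eorb H ` out_arcs Y v" by blast
  next
    fix E assume "E \<in> eorb H ` out_arcs Y v"
    then obtain e where "e \<in> arcs Y" "tail Y e = v" "E = eorb H e" by auto
    then show "E \<in> out_arcs (quotient H) (vorb H v)" using tail_eorb[of e] by simp
  qed
qed

text \<open>Divided by \<open>card H\<close>, the left side is the trace of the power times the
  average over \<open>H\<close>. With the vertex-orbit incidence matrix \<open>P\<close>, the orbit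
  relation is \<open>P * transpose_mat P\<close>, and \<open>?L * P = P * ?K\<close> since arcs
  leaving a vertex correspond to arcs leaving its orbit. Cyclicity of the trace then brings in
  \<open>transpose_mat P * P\<close>, a scalar matrix because all orbits have \<open>card H\<close>
  elements.\<close>

lemma laplacian_trace:
  assumes ys: "distinct ys" "set ys = verts Y" and qs: "distinct qs" "set qs = verts (quotient H)"
  shows "(\<Sum>i<length ys. \<Sum>j<length ys. (Y.laplacian ys ^\<^sub>m k) $$ (i, j) *
      (if vorb H (ys ! i) = vorb H (ys ! j) then 1 else 0)) =
    of_nat (card H) * mat_trace (finite_serre_graph.laplacian (quotient H) qs ^\<^sub>m k)"
proof -
  interpret Q: finite_serre_graph "quotient H" "quotient_rev H" by (rule quotient_serre)
  let ?n = "length ys" and ?m = "length qs"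
  let ?L = "Y.laplacian ys" and ?K = "Q.laplacian qs"
  have L: "?L \<in> carrier_mat ?n ?n" and K: "?K \<in> carrier_mat ?m ?m" by simp_all
  have yV: "ys ! i \<in> verts Y" if "i < ?n" for i using nth_mem[OF that] unfolding ys(2) .
  have qV: "qs ! j \<in> vorb H ` verts Y" if "j < ?m" for j using nth_mem[OF that] qs(2) by simp
  have q_eq: "qs ! i = qs ! j \<longleftrightarrow> i = j" if "i < ?m" "j < ?m" for i j
    using nth_eq_iff_index_eq[OF qs(1) that] .
  have sum_ys: "(\<Sum>k<?n. f (ys ! k)) = (\<Sum>v\<in>verts Y. f v)" for f :: "'a \<Rightarrow> complex"
    unfolding ys(2)[symmetric] by (rule sum.reindex_bij_betw[OF bij_betw_nth[OF ys(1) refl refl]])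
  have sum_qs: "(\<Sum>k<?m. f (qs ! k)) = (\<Sum>q\<in>vorb H ` verts Y. f q)" for f :: "'a set \<Rightarrow> complex"
    using sum.reindex_bij_betw[OF bij_betw_nth[OF qs(1) refl refl], of f] qs(2) by simp
  define P :: "complex mat" where "P = mat ?n ?m (\<lambda>(i, j). if vorb H (ys ! i) = qs ! j then 1 else 0)"
  have P: "P \<in> carrier_mat ?n ?m" by (simp add: P_def)
  have LP: "?L * P = P * ?K"
  proof (rule eq_matI)
    fix i j assume "i < dim_row (P * ?K)" "j < dim_col (P * ?K)"
    then have ij: "i < ?n" "j < ?m" using P K by auto
    let ?\<delta> = "\<lambda>q. if q = qs ! j then 1 else 0 :: complex"
    have "(?L * P) $$ (i, j) = (\<Sum>k<?n. \<Sum>e\<in>out_arcs Y (ys ! i).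
        ((if head Y e = ys ! k then 1 else 0) - (if i = k then 1 else 0)) * ?\<delta> (vorb H (ys ! k)))"
      unfolding mult_mat_entry[OF L P ij] using ij
      by (intro sum.cong) (auto simp: Y.laplacian_def P_def sum_distrib_right)
    also have "\<dots> = (\<Sum>e\<in>out_arcs Y (ys ! i).
        (\<Sum>k<?n. if head Y e = ys ! k then ?\<delta> (vorb H (ys ! k)) else 0) -
        (\<Sum>k<?n. if i = k then ?\<delta> (vorb H (ys ! k)) else 0))"
      unfolding sum_subtractf[symmetric] left_diff_distrib
      by (subst sum.swap) (intro sum.cong refl arg_cong2[where f = "(-)"], auto)
    also have "\<dots> = (\<Sum>e\<in>out_arcs Y (ys ! i). ?\<delta> (vorb H (head Y e)) - ?\<delta> (vorb H (ys ! i)))"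
    proof (intro sum.cong refl arg_cong2[where f = "(-)"])
      fix e assume "e \<in> out_arcs Y (ys ! i)"
      then show "(\<Sum>k<?n. if head Y e = ys ! k then ?\<delta> (vorb H (ys ! k)) else 0) = ?\<delta> (vorb H (head Y e))"
        unfolding sum_ys[of "\<lambda>v. if head Y e = v then ?\<delta> (vorb H v) else 0"] by simp
      show "(\<Sum>k<?n. if i = k then ?\<delta> (vorb H (ys ! k)) else 0) = ?\<delta> (vorb H (ys ! i))"
        using ij by simp
    qed
    also have "\<dots> = (\<Sum>e\<in>out_arcs Y (ys ! i).
        (\<lambda>E. ?\<delta> (head (quotient H) E) - ?\<delta> (vorb H (ys ! i))) (eorb H e))"
      by (intro sum.cong) (auto simp: head_eorb)
    also have "\<dots> = (\<Sum>E\<in>out_arcs (quotient H) (vorb H (ys ! i)).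
        ?\<delta> (head (quotient H) E) - ?\<delta> (vorb H (ys ! i)))"
      by (rule sum.reindex_bij_betw[OF bij_betw_out_arcs[OF yV[OF ij(1)]]])
    also have "\<dots> = (\<Sum>q\<in>vorb H ` verts Y. if vorb H (ys ! i) = q then
        \<Sum>E\<in>out_arcs (quotient H) q. ?\<delta> (head (quotient H) E) - ?\<delta> q else 0)"
      using yV[OF ij(1)] by simp
    also have "\<dots> = (\<Sum>k<?m. if vorb H (ys ! i) = qs ! k then
        \<Sum>E\<in>out_arcs (quotient H) (qs ! k). ?\<delta> (head (quotient H) E) - ?\<delta> (qs ! k) else 0)"
      by (rule sum_qs[symmetric])
    also have "\<dots> = (P * ?K) $$ (i, j)"
      unfolding mult_mat_entry[OF P K ij] using ij
      by (intro sum.cong) (auto simp: Q.laplacian_def P_def q_eq)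
    finally show "(?L * P) $$ (i, j) = (P * ?K) $$ (i, j)" .
  qed (use P in \<open>auto simp: Y.laplacian_def Q.laplacian_def\<close>)
  have Pt: "transpose_mat P \<in> carrier_mat ?m ?n" using P by simp
  have Lk: "?L ^\<^sub>m k \<in> carrier_mat ?n ?n" and Kk: "?K ^\<^sub>m k \<in> carrier_mat ?m ?m" by simp_all
  have PPt: "(P * transpose_mat P) $$ (j, i) = (if vorb H (ys ! i) = vorb H (ys ! j) then 1 else 0)"
    if ij: "i < ?n" "j < ?n" for i j
  proof -
    have "(P * transpose_mat P) $$ (j, i) = (\<Sum>k<?m. (\<lambda>q. if vorb H (ys ! j) = q then
        (if vorb H (ys ! i) = q then 1 else 0) else 0) (qs ! k))"
      unfolding mult_mat_entry[OF P Pt ij(2,1)] using ij by (intro sum.cong) (auto simp: P_def)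
    also have "\<dots> = (\<Sum>q\<in>vorb H ` verts Y. if vorb H (ys ! j) = q then
        (if vorb H (ys ! i) = q then 1 else 0) else 0)"
      by (rule sum_qs)
    also have "\<dots> = (if vorb H (ys ! i) = vorb H (ys ! j) then 1 else 0)" using yV[OF ij(2)] by simp
    finally show ?thesis .
  qed
  have PtP: "transpose_mat P * P = of_nat (card H) \<cdot>\<^sub>m 1\<^sub>m ?m"
  proof (rule eq_matI)
    fix i j assume "i < dim_row (of_nat (card H) \<cdot>\<^sub>m 1\<^sub>m ?m :: complex mat)"
      "j < dim_col (of_nat (card H) \<cdot>\<^sub>m 1\<^sub>m ?m :: complex mat)"
    then have ij: "i < ?m" "j < ?m" by auto
    have "(transpose_mat P * P) $$ (i, j) =
        (\<Sum>k<?n. (\<lambda>v. if vorb H v = qs ! i \<and> vorb H v = qs ! j then 1 else 0) (ys ! k))"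
      unfolding mult_mat_entry[OF Pt P ij] using ij by (intro sum.cong) (auto simp: P_def)
    also have "\<dots> = (\<Sum>v\<in>verts Y. if vorb H v = qs ! i \<and> vorb H v = qs ! j then 1 else 0)"
      by (rule sum_ys)
    also have "\<dots> = (\<Sum>v\<in>verts Y. if v \<in> qs ! i \<and> i = j then 1 else 0)"
      using mem_vorb_iff[OF _ qV[OF ij(1)]] q_eq[OF ij] by (intro sum.cong) auto
    also have "\<dots> = (if i = j then of_nat (card (verts Y \<inter> qs ! i)) else 0)"
      by (simp add: sum.inter_restrict[symmetric])
    also have "verts Y \<inter> qs ! i = qs ! i" using qV[OF ij(1)] vorb_subset by auto
    also have "card (qs ! i) = card H" using qV[OF ij(1)] card_vorb by auto
    finally show "(transpose_mat P * P) $$ (i, j) = (of_nat (card H) \<cdot>\<^sub>m 1\<^sub>m ?m) $$ (i, j)"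
      using ij by simp
  qed (use P in auto)
  have "(\<Sum>i<?n. \<Sum>j<?n. (?L ^\<^sub>m k) $$ (i, j) * (if vorb H (ys ! i) = vorb H (ys ! j) then 1 else 0)) =
      (\<Sum>i<?n. \<Sum>j<?n. (?L ^\<^sub>m k) $$ (i, j) * (P * transpose_mat P) $$ (j, i))"
    by (intro sum.cong refl) (simp add: PPt del: index_mult_mat(1))
  also have "\<dots> = mat_trace (?L ^\<^sub>m k * (P * transpose_mat P))"
    by (rule mat_trace_mult[symmetric, OF Lk mult_carrier_mat[OF P Pt]])
  also have "?L ^\<^sub>m k * (P * transpose_mat P) = (?L ^\<^sub>m k * P) * transpose_mat P"
    by (rule assoc_mult_mat[symmetric, OF Lk P Pt])
  also have "\<dots> = P * (?K ^\<^sub>m k * transpose_mat P)"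
    unfolding pow_mat_intertwine[OF L K P LP] by (rule assoc_mult_mat[OF P Kk Pt])
  also have "mat_trace \<dots> = mat_trace ((?K ^\<^sub>m k * transpose_mat P) * P)"
    by (rule mat_trace_mult_comm[OF P mult_carrier_mat[OF Kk Pt]])
  also have "(?K ^\<^sub>m k * transpose_mat P) * P = ?K ^\<^sub>m k * (transpose_mat P * P)"
    by (rule assoc_mult_mat[OF Kk Pt P])
  also have "mat_trace \<dots> = of_nat (card H) * mat_trace (?K ^\<^sub>m k)"
    unfolding PtP mult_smult_distrib[OF Kk one_carrier_mat] right_mult_one_mat[OF Kk]
    by (rule mat_trace_smult[OF Kk])
  finally show ?thesis .
qed

text \<open>The trace formula at exponent 0, where both powers are identity matrices and the traces
  count vertices.\<close>

lemma card_verts_quotient: "card (verts Y) = card H * card (verts (quotient H))"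
proof -
  obtain ys where ys: "set ys = verts Y" "distinct ys"
    using finite_distinct_list[OF Y.finite_verts] by blast
  obtain qs where qs: "set qs = verts (quotient H)" "distinct qs"
    using finite_distinct_list[of "verts (quotient H)"] by auto
  interpret Q: finite_serre_graph "quotient H" "quotient_rev H" by (rule quotient_serre)
  have "of_nat (length ys) = (\<Sum>i<length ys. \<Sum>j<length ys. (Y.laplacian ys ^\<^sub>m 0) $$ (i, j) *
      (if vorb H (ys ! i) = vorb H (ys ! j) then 1 else 0))"
  proof -
    have "(\<Sum>j<length ys. (Y.laplacian ys ^\<^sub>m 0) $$ (i, j) *
      (if vorb H (ys ! i) = vorb H (ys ! j) then 1 else 0)) = 1" if i: "i < length ys" for i
    proof -
      have "(\<Sum>j<length ys. (Y.laplacian ys ^\<^sub>m 0) $$ (i, j) *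
          (if vorb H (ys ! i) = vorb H (ys ! j) then 1 else 0)) =
          (\<Sum>j<length ys. if i = j then 1 else 0)"
        using i by (intro sum.cong) (auto simp: Y.laplacian_def)
      then show ?thesis using i by simp
    qed
    then show ?thesis by simp
  qed
  also have "\<dots> = of_nat (card H) * mat_trace (Q.laplacian qs ^\<^sub>m 0)"
    by (rule laplacian_trace[OF ys(2,1) qs(2,1)])
  also have "mat_trace (Q.laplacian qs ^\<^sub>m 0) = of_nat (length qs)"
    by (simp add: mat_trace_def Q.laplacian_def)
  finally have "complex_of_nat (length ys) = of_nat (card H * length qs)" by simp
  then show ?thesis
    using distinct_card[OF ys(2)] distinct_card[OF qs(2)] unfolding ys(1) qs(1) of_nat_eq_iff by simp
qed

end


text \<open>This holds for any integer weights that write the unit of the group algebra as a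
  combination of averages over subgroups; the Moebius values are one such choice.\<close>

theorem complexity_eq_prod_quotients:
  fixes \<H> :: "'g set set" and c :: "'g set \<Rightarrow> int"
  assumes conn: "connected Y" and fin: "finite \<H>" and sub: "\<And>H. H \<in> \<H> \<Longrightarrow> subgroup H G"
    and weights: "\<And>g. g \<in> carrier G \<Longrightarrow>
      (\<Sum>H\<in>{H \<in> \<H>. g \<in> H}. of_int (c H) / of_nat (card H)) = (if g = \<one>\<^bsub>G\<^esub> then 1 else 0 :: complex)"
  shows "real (complexity Y rY) = 1 / real (card (carrier G)) *
    (\<Prod>H\<in>\<H>. (real (card (rcosets\<^bsub>G\<^esub> H)) * real (complexity (quotient H) (quotient_rev H))) powi c H)"
proof -
  have Hc: "H \<subseteq> carrier G" if "H \<in> \<H>" for H using subgroup.subset[OF sub[OF that]] .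
  have cH: "card H \<noteq> 0" if "H \<in> \<H>" for H
    using subgroup.one_closed[OF sub[OF that]] finite_subset[OF Hc[OF that] finite_group] by auto
  have weights': "(\<Sum>H\<in>\<H>. if g \<in> H then of_int (c H) / of_nat (card H) else 0) =
      (if g = \<one>\<^bsub>G\<^esub> then 1 else 0 :: complex)" if "g \<in> carrier G" for g
    using weights[OF that] by (simp add: sum.inter_filter[OF fin])
  \<comment> \<open>Summing the weight identity over the whole group, that is, applying the
    augmentation.\<close>
  have csum: "(\<Sum>H\<in>\<H>. c H) = 1"
  proof -
    have "of_int (\<Sum>H\<in>\<H>. c H) = (\<Sum>H\<in>\<H>. \<Sum>g\<in>carrier G. if g \<in> H then of_int (c H) / of_nat (card H) else 0 :: complex)"
      unfolding of_int_sum
    proof (intro sum.cong refl)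
      fix H assume H: "H \<in> \<H>"
      have "(\<Sum>g\<in>carrier G. if g \<in> H then of_int (c H) / of_nat (card H) else 0 :: complex) =
          (\<Sum>g\<in>carrier G \<inter> H. of_int (c H) / of_nat (card H))"
        by (rule sum.inter_restrict[symmetric, OF finite_group])
      also have "carrier G \<inter> H = H" using Hc[OF H] by auto
      finally show "of_int (c H) = (\<Sum>g\<in>carrier G. if g \<in> H then of_int (c H) / of_nat (card H) else 0 :: complex)"
        using cH[OF H] by simp
    qed
    also have "\<dots> = (\<Sum>g\<in>carrier G. if g = \<one>\<^bsub>G\<^esub> then 1 else 0)"
      by (subst sum.swap) (simp add: weights')
    also have "\<dots> = 1" using finite_group by simp
    finally show ?thesis by (metis of_int_1 of_int_eq_iff)
  qed
  \<comment> \<open>If \<open>w = av g v\<close>, freeness makes \<open>g\<close> unique, and the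
    two vertices share an \<open>H\<close>-orbit iff \<open>g\<close> is in \<open>H\<close>.
    Vertices in different orbits of the whole group share no \<open>H\<close>-orbit, so both sides
    vanish.\<close>
  have orbit_weights: "(\<Sum>H\<in>\<H>. if vorb H v = vorb H w then of_int (c H) / of_nat (card H) else 0) =
      (if v = w then 1 else 0 :: complex)" if v: "v \<in> verts Y" and w: "w \<in> verts Y" for v w
  proof (cases "\<exists>g\<in>carrier G. w = av g v")
    case True
    then obtain g where g: "g \<in> carrier G" "w = av g v" by blast
    have "vorb H v = vorb H w \<longleftrightarrow> g \<in> H" if "H \<in> \<H>" for H
    proof -
      have "vorb H v = vorb H w \<longleftrightarrow> (\<exists>h\<in>H. av g v = av h v)"
        unfolding vorb_eq_iff[OF sub[OF that] v w] using g by (auto simp: vorb_def)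
      also have "\<dots> \<longleftrightarrow> g \<in> H" using av_eq_iff[OF g(1) _ v] Hc[OF that] by blast
      finally show ?thesis .
    qed
    then have "(\<Sum>H\<in>\<H>. if vorb H v = vorb H w then of_int (c H) / of_nat (card H) else 0) =
        (if g = \<one>\<^bsub>G\<^esub> then 1 else 0 :: complex)"
      using weights'[OF g(1)] by (simp cong: sum.cong)
    moreover have "v = w \<longleftrightarrow> g = \<one>\<^bsub>G\<^esub>" using free[OF g(1) v] g av_one[OF v] by metis
    ultimately show ?thesis by simp
  next
    case False
    have "vorb H v \<noteq> vorb H w" if "H \<in> \<H>" for H
    proof
      assume "vorb H v = vorb H w"
      then have "w \<in> vorb H v" using vorb_eq_iff[OF sub[OF that] v w] by simp
      then show False using False Hc[OF that] by (auto simp: vorb_def)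
    qed
    moreover have "v \<noteq> w" using False av_one[OF v] Gr.one_closed by metis
    ultimately show ?thesis by simp
  qed
  have Q: "finite_serre_graph (quotient H) (quotient_rev H)" if "H \<in> \<H>" for H
    by (rule quotient_serre[OF sub[OF that]])
  have Qconn: "connected (quotient H)" if "H \<in> \<H>" for H
    by (rule quotient_connected[OF sub[OF that] conn])
  have Yne: "verts Y \<noteq> {}" using conn unfolding connected_conv by blast
  obtain ys where ys: "distinct ys" "set ys = verts Y"
    using finite_distinct_list[OF Y.finite_verts] by blast
  have "\<forall>H. \<exists>qs. distinct qs \<and> set qs = verts (quotient H)"
    using finite_distinct_list[of "verts (quotient H)" for H] by (simp add: conj_commute)
  then obtain qs where qs: "\<And>H. distinct (qs H)" "\<And>H. set (qs H) = verts (quotient H)" by metis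
  let ?n = "length ys" and ?L = "Y.laplacian ys"
  let ?K = "\<lambda>H. finite_serre_graph.laplacian (quotient H) (qs H)"
  have n: "?n = card (verts Y)" using distinct_card[OF ys(1)] ys(2) by simp
  have m: "length (qs H) = card (verts (quotient H))" for H using distinct_card[OF qs(1)] qs(2) by metis
  have tr: "mat_trace (?L ^\<^sub>m k) = (\<Sum>H\<in>\<H>. of_int (c H) * mat_trace (?K H ^\<^sub>m k))" for k
  proof -
    have "mat_trace (?L ^\<^sub>m k) = (\<Sum>i<?n. \<Sum>j<?n. (?L ^\<^sub>m k) $$ (i, j) * (if ys ! i = ys ! j then 1 else 0))"
    proof -
      have "(\<Sum>j<?n. (?L ^\<^sub>m k) $$ (i, j) * (if ys ! i = ys ! j then 1 else 0)) = (?L ^\<^sub>m k) $$ (i, i)"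
        if i: "i < ?n" for i
      proof -
        have "(\<Sum>j<?n. (?L ^\<^sub>m k) $$ (i, j) * (if ys ! i = ys ! j then 1 else 0)) =
            (\<Sum>j<?n. if i = j then (?L ^\<^sub>m k) $$ (i, j) else 0)"
          using nth_eq_iff_index_eq[OF ys(1) i] by (intro sum.cong) auto
        then show ?thesis using i by simp
      qed
      moreover have "dim_row (?L ^\<^sub>m k) = ?n" by (simp add: Y.laplacian_def)
      ultimately show ?thesis unfolding mat_trace_def by (intro sum.cong) auto
    qed
    also have "\<dots> = (\<Sum>i<?n. \<Sum>j<?n. \<Sum>H\<in>\<H>. of_int (c H) / of_nat (card H) *
        ((?L ^\<^sub>m k) $$ (i, j) * (if vorb H (ys ! i) = vorb H (ys ! j) then 1 else 0)))"
    proof (intro sum.cong refl)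
      fix i j assume "i \<in> {..<?n}" "j \<in> {..<?n}"
      then have "ys ! i \<in> verts Y" "ys ! j \<in> verts Y" using ys(2) nth_mem by blast+
      note w = orbit_weights[OF this, symmetric]
      show "(?L ^\<^sub>m k) $$ (i, j) * (if ys ! i = ys ! j then 1 else 0) =
          (\<Sum>H\<in>\<H>. of_int (c H) / of_nat (card H) *
            ((?L ^\<^sub>m k) $$ (i, j) * (if vorb H (ys ! i) = vorb H (ys ! j) then 1 else 0)))"
        unfolding w sum_distrib_left by (intro sum.cong) auto
    qed
    also have "\<dots> = (\<Sum>H\<in>\<H>. of_int (c H) / of_nat (card H) * (\<Sum>i<?n. \<Sum>j<?n.
        (?L ^\<^sub>m k) $$ (i, j) * (if vorb H (ys ! i) = vorb H (ys ! j) then 1 else 0)))"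
    proof -
      have "(\<Sum>i<?n. \<Sum>j<?n. \<Sum>H\<in>\<H>. F i j H) = (\<Sum>H\<in>\<H>. \<Sum>i<?n. \<Sum>j<?n. F i j H)"
        for F :: "nat \<Rightarrow> nat \<Rightarrow> 'g set \<Rightarrow> complex"
        by (subst sum.swap, subst (2) sum.swap, rule refl)
      then show ?thesis by (simp only: sum_distrib_left)
    qed
    also have "\<dots> = (\<Sum>H\<in>\<H>. of_int (c H) * mat_trace (?K H ^\<^sub>m k))"
    proof (intro sum.cong refl)
      fix H assume H: "H \<in> \<H>"
      show "of_int (c H) / of_nat (card H) * (\<Sum>i<?n. \<Sum>j<?n.
          (?L ^\<^sub>m k) $$ (i, j) * (if vorb H (ys ! i) = vorb H (ys ! j) then 1 else 0)) =
          of_int (c H) * mat_trace (?K H ^\<^sub>m k)"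
        unfolding laplacian_trace[OF sub[OF H] ys qs] using cH[OF H] by simp
    qed
    finally show ?thesis .
  qed
  have YC: "coeff (char_poly ?L) 1 = of_nat (?n * complexity Y rY)"
    by (rule Y.coeff_1_char_poly_laplacian[OF ys])
  have QC: "coeff (char_poly (?K H)) 1 = of_nat (length (qs H) * complexity (quotient H) (quotient_rev H))"
    if "H \<in> \<H>" for H
    by (rule finite_serre_graph.coeff_1_char_poly_laplacian[OF Q[OF that] qs])
  have n0: "?n > 0" using n Yne by (simp add: card_gt_0_iff)
  have m0: "length (qs H) > 0" for H using m[of H] Yne by (simp add: card_gt_0_iff)
  have \<kappa>Y: "complexity Y rY > 0" by (rule Y.complexity_pos[OF conn])
  have \<kappa>Q: "complexity (quotient H) (quotient_rev H) > 0" if "H \<in> \<H>" for H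
    by (rule finite_serre_graph.complexity_pos[OF Q[OF that] Qconn[OF that]])
  have "coeff (char_poly ?L) 1 = (\<Prod>H\<in>\<H>. coeff (char_poly (?K H)) 1 powi c H)"
  proof (rule coeff_1_char_poly_of_traces[OF fin Y.laplacian_carrier _ tr])
    show "?K H \<in> carrier_mat (length (qs H)) (length (qs H))" if "H \<in> \<H>" for H
      by (rule finite_serre_graph.laplacian_carrier[OF Q[OF that]])
    show "coeff (char_poly ?L) 0 = 0" by (rule Y.coeff_0_char_poly_laplacian[OF ys Yne])
    show "coeff (char_poly ?L) 1 \<noteq> 0" unfolding YC of_nat_eq_0_iff using n0 \<kappa>Y by simp
    show "coeff (char_poly (?K H)) 0 = 0" if "H \<in> \<H>" for H
      by (rule finite_serre_graph.coeff_0_char_poly_laplacian[OF Q[OF that] qs]) (use Yne in simp)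
    show "coeff (char_poly (?K H)) 1 \<noteq> 0" if "H \<in> \<H>" for H
      unfolding QC[OF that] of_nat_eq_0_iff using m0 \<kappa>Q[OF that] by simp
  qed
  also have "\<dots> = (\<Prod>H\<in>\<H>. of_nat (length (qs H) * complexity (quotient H) (quotient_rev H)) powi c H)"
    by (intro prod.cong refl) (simp only: QC)
  finally have "complex_of_real (real (?n * complexity Y rY)) =
      complex_of_real (\<Prod>H\<in>\<H>. real (length (qs H) * complexity (quotient H) (quotient_rev H)) powi c H)"
    unfolding YC by simp
  then have e: "real ?n * real (complexity Y rY) =
      (\<Prod>H\<in>\<H>. (real (length (qs H)) * real (complexity (quotient H) (quotient_rev H))) powi c H)"
    by (simp only: of_real_eq_iff of_nat_mult)
  \<comment> \<open>The number of vertex orbits of the whole group; the quotient by \<open>H\<close>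
    has \<open>a\<close> times the index of \<open>H\<close> vertices. By \<open>csum\<close> the
    factor \<open>a\<close> comes out once, and cancelling \<open>?n\<close> leaves one over the
    group order.\<close>
  define a where "a = real ?n / real (card (carrier G))"
  have G0: "card (carrier G) > 0" using finite_group Gr.one_closed by (auto simp: card_gt_0_iff)
  have a0: "a \<noteq> 0" using n0 G0 by (simp add: a_def)
  have idx: "real (length (qs H)) = a * real (card (rcosets\<^bsub>G\<^esub> H))" if H: "H \<in> \<H>" for H
  proof -
    have lag: "real (card (carrier G)) = real (card (rcosets\<^bsub>G\<^esub> H)) * real (card H)"
      using Gr.lagrange[OF sub[OF H]] unfolding of_nat_mult[symmetric] by (simp add: Coset.order_def)
    have "real ?n = real (card H) * real (length (qs H))"
      unfolding n m of_nat_mult[symmetric] using card_verts_quotient[OF sub[OF H]] by simp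
    moreover have "real (card (rcosets\<^bsub>G\<^esub> H)) \<noteq> 0" using lag G0 by force
    ultimately show ?thesis unfolding a_def lag using cH[OF H] by simp
  qed
  have "(\<Prod>H\<in>\<H>. (real (length (qs H)) * real (complexity (quotient H) (quotient_rev H))) powi c H) =
      (\<Prod>H\<in>\<H>. a powi c H * (real (card (rcosets\<^bsub>G\<^esub> H)) * real (complexity (quotient H) (quotient_rev H))) powi c H)"
    by (intro prod.cong refl) (simp only: idx power_int_mult_distrib mult.assoc)
  also have "\<dots> = a powi (\<Sum>H\<in>\<H>. c H) *
      (\<Prod>H\<in>\<H>. (real (card (rcosets\<^bsub>G\<^esub> H)) * real (complexity (quotient H) (quotient_rev H))) powi c H)"
    unfolding powi_sum[OF a0 fin] by (rule prod.distrib)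
  finally have "real ?n * real (complexity Y rY) = real ?n * (1 / real (card (carrier G)) *
      (\<Prod>H\<in>\<H>. (real (card (rcosets\<^bsub>G\<^esub> H)) * real (complexity (quotient H) (quotient_rev H))) powi c H))"
    unfolding e csum a_def by simp
  then show ?thesis using n0 by (simp only: mult_cancel_left) simp
qed

end

section \<open>Galois covers\<close>

locale graph_cover = Y: finite_serre_graph Y rY + X: bidirected_digraph X rX
  for Y :: "('a, 'b) pre_digraph" and rY :: "'b \<Rightarrow> 'b" and X :: "('c, 'd) pre_digraph" and rX :: "'d \<Rightarrow> 'd" +
  fixes \<pi> :: "('a \<Rightarrow> 'c) \<times> ('b \<Rightarrow> 'd)"
  assumes cover: "covering_map Y rY X rX \<pi>" and conn: "connected Y"
begin

lemma aut_groupD: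
  assumes "\<sigma> \<in> carrier (aut_group Y rY \<pi>)"
  shows "fst \<sigma> \<in> Bij (verts Y)" "snd \<sigma> \<in> Bij (arcs Y)"
    and "\<And>v. v \<in> verts Y \<Longrightarrow> fst \<sigma> v \<in> verts Y" "\<And>e. e \<in> arcs Y \<Longrightarrow> snd \<sigma> e \<in> arcs Y"
    and "\<And>e. e \<in> arcs Y \<Longrightarrow> tail Y (snd \<sigma> e) = fst \<sigma> (tail Y e)"
    and "\<And>e. e \<in> arcs Y \<Longrightarrow> head Y (snd \<sigma> e) = fst \<sigma> (head Y e)"
    and "\<And>e. e \<in> arcs Y \<Longrightarrow> rY (snd \<sigma> e) = snd \<sigma> (rY e)"
    and "\<And>e. e \<in> arcs Y \<Longrightarrow> snd \<pi> (snd \<sigma> e) = snd \<pi> e"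
  using assms
  by (auto simp: aut_group_def graph_isomorphism_def graph_morphism_def Bij_def dest: bij_betwE)

lemma aut_group_mult:
  assumes "\<sigma> \<in> carrier (aut_group Y rY \<pi>)" "\<tau> \<in> carrier (aut_group Y rY \<pi>)"
  shows "v \<in> verts Y \<Longrightarrow> fst (\<sigma> \<otimes>\<^bsub>aut_group Y rY \<pi>\<^esub> \<tau>) v = fst \<sigma> (fst \<tau> v)"
    and "e \<in> arcs Y \<Longrightarrow> snd (\<sigma> \<otimes>\<^bsub>aut_group Y rY \<pi>\<^esub> \<tau>) e = snd \<sigma> (snd \<tau> e)"
  using aut_groupD(1,2)[OF assms(1)] aut_groupD(1,2)[OF assms(2)]
  by (auto simp: aut_group_def DirProd_def BijGroup_def compose_def split: prod.splits)

text \<open>Uniqueness of lifts: \<open>\<pi>\<close> is injective on the arcs leaving a fixed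
  vertex, so these arcs and then their heads are fixed, and connectedness spreads this over all of
  \<open>Y\<close>.\<close>

lemma aut_fixes_all:
  assumes \<sigma>: "\<sigma> \<in> carrier (aut_group Y rY \<pi>)" and v: "v \<in> verts Y" "fst \<sigma> v = v"
  shows "\<And>w. w \<in> verts Y \<Longrightarrow> fst \<sigma> w = w" and "\<And>e. e \<in> arcs Y \<Longrightarrow> snd \<sigma> e = e"
proof -
  have arc: "snd \<sigma> e = e" if e: "e \<in> arcs Y" "fst \<sigma> (tail Y e) = tail Y e" for e
  proof -
    have inj: "inj_on (snd \<pi>) (out_arcs Y (tail Y e))"
      using cover e(1) by (auto simp: covering_map_def bij_betw_def)
    show ?thesis
      by (rule inj_onD[OF inj aut_groupD(8)[OF \<sigma> e(1)]]) (use aut_groupD(4,5)[OF \<sigma> e(1)] e in auto)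
  qed
  have "symmetric Y"
    unfolding symmetric_conv by (metis Y.arev_in_arcs Y.head_arev Y.tail_arev)
  then have sc: "strongly_connected Y" using conn by (rule Y.symmetric_connected_imp_strongly_connected)
  show vert: "fst \<sigma> w = w" if "w \<in> verts Y" for w
  proof -
    have "v \<rightarrow>\<^sup>*\<^bsub>Y\<^esub> w" using sc v(1) that by (auto simp: strongly_connected_def)
    then show ?thesis
    proof (induction rule: Y.reachable_induct)
      case (step x y)
      from step(2) obtain e where e: "e \<in> arcs Y" "tail Y e = x" "head Y e = y" by auto
      then show ?case using arc[OF e(1)] aut_groupD(6)[OF \<sigma> e(1)] step.IH by simp
    qed (rule v(2))
  qed
  show "snd \<sigma> e = e" if "e \<in> arcs Y" for e using arc[OF that] vert that by simp
qed

text \<open>An inverted arc would project to an arc of \<open>X\<close> that is its own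
  reverse.\<close>

lemma no_inversion:
  assumes \<sigma>: "\<sigma> \<in> carrier (aut_group Y rY \<pi>)" and e: "e \<in> arcs Y"
  shows "snd \<sigma> e \<noteq> rY e"
proof
  assume "snd \<sigma> e = rY e"
  then have "snd \<pi> e = rX (snd \<pi> e)" "snd \<pi> e \<in> arcs X"
    using aut_groupD(8)[OF \<sigma> e] cover e by (auto simp: covering_map_def graph_morphism_def)
  then show False using X.arev_neq by metis
qed

lemma free_serre_action:
  fixes G :: "('g, 'm) monoid_scheme"
  assumes G: "group G" "finite (carrier G)" and \<phi>: "\<phi> \<in> iso G (aut_group Y rY \<pi>)"
  shows "free_serre_action Y rY G (\<lambda>g. fst (\<phi> g)) (\<lambda>g. snd (\<phi> g))"
proof -
  interpret G: group G by fact
  have \<phi>c: "\<phi> g \<in> carrier (aut_group Y rY \<pi>)" if "g \<in> carrier G" for g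
    using \<phi> that by (auto simp: iso_def hom_def)
  have \<phi>m: "\<phi> (g \<otimes>\<^bsub>G\<^esub> h) = \<phi> g \<otimes>\<^bsub>aut_group Y rY \<pi>\<^esub> \<phi> h" if "g \<in> carrier G" "h \<in> carrier G" for g h
    using \<phi> that by (auto simp: iso_def hom_def)
  have \<phi>inj: "inj_on \<phi> (carrier G)" using \<phi> by (auto simp: iso_def bij_betw_def)
  note D = aut_groupD[OF \<phi>c]
  \<comment> \<open>The image of the unit is an idempotent injective map, hence the identity; the
    unit of \<open>aut_group\<close> need not be identified.\<close>
  have one_v: "fst (\<phi> \<one>\<^bsub>G\<^esub>) v = v" if "v \<in> verts Y" for v
  proof -
    have "fst (\<phi> \<one>\<^bsub>G\<^esub>) (fst (\<phi> \<one>\<^bsub>G\<^esub>) v) = fst (\<phi> \<one>\<^bsub>G\<^esub>) v"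
      using aut_group_mult(1)[OF \<phi>c \<phi>c that, of "\<one>\<^bsub>G\<^esub>" "\<one>\<^bsub>G\<^esub>"] by (simp flip: \<phi>m)
    then show ?thesis
      using D(1,3)[OF G.one_closed] that by (auto simp: Bij_def bij_betw_def inj_on_eq_iff)
  qed
  have one_e: "snd (\<phi> \<one>\<^bsub>G\<^esub>) e = e" if "e \<in> arcs Y" for e
  proof -
    have "tail Y e \<in> verts Y" using that by simp
    then show ?thesis using aut_fixes_all(2)[OF \<phi>c[OF G.one_closed] _ one_v that] by blast
  qed
  show ?thesis
  proof
    show "finite (carrier G)" by fact
    fix g assume g: "g \<in> carrier G"
    show "fst (\<phi> g) v \<in> verts Y" if "v \<in> verts Y" for v using D(3)[OF g that] .
    show "snd (\<phi> g) e \<in> arcs Y" if "e \<in> arcs Y" for e using D(4)[OF g that] .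
    show "fst (\<phi> (g \<otimes>\<^bsub>G\<^esub> h)) v = fst (\<phi> g) (fst (\<phi> h) v)" if "h \<in> carrier G" "v \<in> verts Y" for h v
      unfolding \<phi>m[OF g that(1)] by (rule aut_group_mult(1)[OF \<phi>c[OF g] \<phi>c[OF that(1)] that(2)])
    show "snd (\<phi> (g \<otimes>\<^bsub>G\<^esub> h)) e = snd (\<phi> g) (snd (\<phi> h) e)" if "h \<in> carrier G" "e \<in> arcs Y" for h e
      unfolding \<phi>m[OF g that(1)] by (rule aut_group_mult(2)[OF \<phi>c[OF g] \<phi>c[OF that(1)] that(2)])
    show "tail Y (snd (\<phi> g) e) = fst (\<phi> g) (tail Y e)" if "e \<in> arcs Y" for e using D(5)[OF g that] .
    show "head Y (snd (\<phi> g) e) = fst (\<phi> g) (head Y e)" if "e \<in> arcs Y" for e using D(6)[OF g that] .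
    show "rY (snd (\<phi> g) e) = snd (\<phi> g) (rY e)" if "e \<in> arcs Y" for e using D(7)[OF g that] .
    show "snd (\<phi> g) e \<noteq> rY e" if "e \<in> arcs Y" for e using no_inversion[OF \<phi>c[OF g] that] .
    fix v assume v: "v \<in> verts Y" "fst (\<phi> g) v = v"
    \<comment> \<open>Extensionality turns agreement on \<open>Y\<close> into equality of
      automorphisms, to which injectivity of \<open>\<phi>\<close> applies.\<close>
    have "fst (\<phi> g) = fst (\<phi> \<one>\<^bsub>G\<^esub>)"
    proof (rule extensionalityI)
      show "fst (\<phi> g) \<in> extensional (verts Y)" "fst (\<phi> \<one>\<^bsub>G\<^esub>) \<in> extensional (verts Y)"
        using D(1)[OF g] D(1)[OF G.one_closed] by (auto simp: Bij_def)
    qed (simp add: aut_fixes_all(1)[OF \<phi>c[OF g] v] one_v)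
    moreover have "snd (\<phi> g) = snd (\<phi> \<one>\<^bsub>G\<^esub>)"
    proof (rule extensionalityI)
      show "snd (\<phi> g) \<in> extensional (arcs Y)" "snd (\<phi> \<one>\<^bsub>G\<^esub>) \<in> extensional (arcs Y)"
        using D(2)[OF g] D(2)[OF G.one_closed] by (auto simp: Bij_def)
    qed (simp add: aut_fixes_all(2)[OF \<phi>c[OF g] v] one_e)
    ultimately have "\<phi> g = \<phi> \<one>\<^bsub>G\<^esub>" by (rule prod_eqI)
    then show "g = \<one>\<^bsub>G\<^esub>" using \<phi>inj g by (simp add: inj_on_eq_iff)
  qed (use one_v one_e in auto)
qed

end

lemma orbit_image: "orbit (\<Gamma>\<lparr>carrier := \<phi> ` H\<rparr>) F x = (\<lambda>g. F (\<phi> g) x) ` H"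
  by (auto simp: orbit_def)

theorem theorem1p1:
  fixes G :: "('g, 'm) monoid_scheme"
    and X :: "('c, 'd) pre_digraph" and rX :: "'d \<Rightarrow> 'd"
    and Y :: "('a, 'b) pre_digraph" and rY :: "'b \<Rightarrow> 'b"
    and \<pi> :: "('a \<Rightarrow> 'c) \<times> ('b \<Rightarrow> 'd)"
    and \<phi> :: "'g \<Rightarrow> ('a \<Rightarrow> 'a) \<times> ('b \<Rightarrow> 'b)"
  assumes "group G" and "finite (carrier G)"
    and "bidirected_digraph X rX" and "fin_digraph X" and "Digraph_Component.connected X"
    and "bidirected_digraph Y rY" and "fin_digraph Y" and "Digraph_Component.connected Y"
    and "galois_cover Y rY X rX \<pi>"
    and "\<phi> \<in> iso G (aut_group Y rY \<pi>)"
  shows "real (complexity Y rY) =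
    1 / real (card (carrier G)) *
    (\<Prod>H\<in>irr_kernels G.
       (real (card (rcosets\<^bsub>G\<^esub> H)) *
        real (complexity (intermediate_graph Y rY \<pi> (\<phi> ` H)) (intermediate_rev Y rY \<pi> (\<phi> ` H))))
         powi (- moebius (insert {} (irr_kernels G)) {} H))"
proof -
  interpret Y: finite_serre_graph Y rY
    using assms(6,7) by (rule finite_serre_graph.intro)
  interpret C: graph_cover Y rY X rX \<pi>
    using assms(3,8,9) Y.finite_serre_graph_axioms
    by (simp add: graph_cover_def graph_cover_axioms_def galois_cover_def)
  interpret A: free_serre_action Y rY G "\<lambda>g. fst (\<phi> g)" "\<lambda>g. snd (\<phi> g)"
    by (rule C.free_serre_action[OF assms(1,2,10)])
  \<comment> \<open>The orbits coincide as sets, so the intermediate graphs are equal, and not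
    merely isomorphic, to the quotients of the action.\<close>
  have orbits: "orbit (aut_group Y rY \<pi>\<lparr>carrier := \<phi> ` H\<rparr>) fst = A.vorb H"
    "orbit (aut_group Y rY \<pi>\<lparr>carrier := \<phi> ` H\<rparr>) snd = A.eorb H" for H
    by (rule ext, simp only: orbit_image A.vorb_def A.eorb_def)+
  have graph: "intermediate_graph Y rY \<pi> (\<phi> ` H) = A.quotient H" for H
    by (simp add: intermediate_graph_def quot_graph_def A.quotient_def orbits_def orbits Setcompr_eq_image)
  have rev: "intermediate_rev Y rY \<pi> (\<phi> ` H) = A.quotient_rev H" for H
    by (simp add: fun_eq_iff intermediate_rev_def quot_rev_def A.quotient_rev_def orbits_def orbits
        Setcompr_eq_image)
  show ?thesis
    unfolding graph rev
  proof (rule A.complexity_eq_prod_quotients[OF assms(8)])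
    show "finite (irr_kernels G)" by (rule finite_irr_kernels[OF assms(2)])
    show "subgroup H G" if "H \<in> irr_kernels G" for H
      using irr_kernel_normal[OF assms(1) that] by (rule normal_imp_subgroup)
  qed (rule sum_moebius_irr_kernels[OF assms(1,2)])
qed

end
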